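(* Let $A$ be a Lie algebroid. (i) If a Poisson structure $\pi$ and a presymplectic structure $\omega$ on $A$ constitute a $P\Omega$-structure, then their graphs $(\overline{\mathrm{graph}\,\pi},\mathrm{graph}\,\omega)$ constitute a Dirac pair. (ii) Conversely, if the graphs $(\overline{\mathrm{graph}\,\pi},\mathrm{graph}\,\omega)$ of a Poisson structure $\pi$ and a presymplectic structure $\omega$ on $A$ constitute a Dirac pair, and if $\pi$ is non-degenerate, then $\pi$ and $\omega$ constitute a $P\Omega$-structure.
   Context: $[~,~]$ denotes the Lie algebroid bracket on $\Gamma A$, and also the Schouten--Nijenhuis bracket on $\Gamma(\wedge^\bullet A)$; $\mathrm d$ is the Lie algebroid differential. A bivector $\pi\in\Gamma(\wedge^2A)$ is identified with the map $\pi:A^*\to A$, $\pi\xi=i_\xi\pi$; a $2$-form $\omega\in\Gamma(\wedge^2A^* )$ is identified with the map $\omega:A\to A^*$, $\omega x=-i_x\omega$; also with the induced maps on sections. $\pi$ is non-degenerate if it is invertible as a bundle map. $\pi$ is a Poisson structure if $[\pi,\pi]=0$; $\omega$ is a presymplectic structure if $\mathrm d\omega=0$. In $A\oplus A^*$, $\overline{\mathrm{graph}\,\pi}=\{(\pi\xi,\xi)\mid\xi\in A^*\}$ and $\mathrm{graph}\,\omega=\{(x,\omega x)\mid x\in A\}$. A $P\Omega$-structure on $A$ is a pair $(\pi,\omega)$ of a bivector and a $2$-form such that $\pi$ is a Poisson bivector and both $\omega$ and $\omega_N=\omega\circ N$ are closed, where $N=\pi\circ\omega$. A Dirac structure on $A$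 is a maximally isotropic subbundle of $A\oplus A^*$ (for the pairing $\langle X+\xi,Y+\eta\rangle=\langle\xi,Y\rangle+\langle\eta,X\rangle$) whose space of sections is closed under the Dorfman bracket $[X+\xi,Y+\eta]=[X,Y]+\mathcal L_X\eta-i_Y(\mathrm d\xi)$. Graphs of Poisson bivectors and of closed $2$-forms are Dirac structures (known fact). Relations are taken at the level of sections. For a relation $\mathbf N\subset\Gamma A\times\Gamma A$, the dual relation is $\mathbf N^*=\{(\beta,\alpha)\in\Gamma(A^* )\times\Gamma(A^* )\mid\langle\alpha,u\rangle=\langle\beta,v\rangle\ \forall(u,v)\in\mathbf N\}$. $\mathbf N$ is a Nijenhuis relation if $\langle\alpha,[v_1,v_2]\rangle-\langle\alpha',[v_1,u_2]+[u_1,v_2]\rangle+\langle\alpha'',[u_1,u_2]\rangle=0$ for all $(u_1,v_1),(u_2,v_2)\in\mathbf N$ and all $(\alpha,\alpha'),(\alpha',\alpha'')\in\mathbf N^*$. A Dirac pair is a pair $(L,L')$ of Dirac structures on $A$ such that $\mathbf N_{L,L'}=\{(x,y)\in\Gamma A\times\Gamma A\mid\exists\,\xi\in\Gamma(A^* ),\ (x,\xi)\in\Gamma L',\ (y,\xi)\in\Gamma L\}$ is a Nijenhuis relation. *)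

theory Defs
  imports "HOL-Analysis.Analysis"
begin

section \<open>Smooth functions, manifolds and vector bundles\<close>

text \<open>
  $\mathbb R^n$ is the library's topological space \<^term>\<open>Euclidean_space n\<close> of sequences vanishing from
  index $n$ on; in contrast to the types of class \<^class>\<open>euclidean_space\<close> this includes $n = 0$, so
  that Lie algebras (Lie algebroids over a point) and bundles of rank $0$ are covered.
\<close>

definition partial :: "nat \<Rightarrow> ((nat \<Rightarrow> real) \<Rightarrow> real) \<Rightarrow> (nat \<Rightarrow> real) \<Rightarrow> real" where
  "partial i f x = deriv (\<lambda>t. f (x(i := t))) (x i)"

text \<open>Functions of class $C^k$ on a set \<open>U\<close>, intended for \<open>U\<close> open in $\mathbb R^n$.\<close>

fun Ck :: "nat \<Rightarrow> nat \<Rightarrow> (nat \<Rightarrow> real) set \<Rightarrow> ((nat \<Rightarrow> real) \<Rightarrow> real) \<Rightarrow> bool" where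
  "Ck n 0 U f \<longleftrightarrow> continuous_map (subtopology (Euclidean_space n) U) euclideanreal f"
| "Ck n (Suc k) U f \<longleftrightarrow>
     continuous_map (subtopology (Euclidean_space n) U) euclideanreal f \<and>
     (\<forall>i<n. (\<forall>x\<in>U. (\<lambda>t. f (x(i := t))) differentiable (at (x i))) \<and> Ck n k U (partial i f))"

definition smooth_Rn :: "nat \<Rightarrow> (nat \<Rightarrow> real) set \<Rightarrow> ((nat \<Rightarrow> real) \<Rightarrow> real) \<Rightarrow> bool" where
  "smooth_Rn n U f \<longleftrightarrow> (\<forall>k. Ck n k U f)"

text \<open>The manifold is the whole type \<open>'m\<close>; its smooth structure is given by an atlas, a set of
  charts $(U,\kappa)$.\<close>

record 'm manifold =
  mdim :: nat
  charts :: "('m set \<times> ('m \<Rightarrow> nat \<Rightarrow> real)) set"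

definition smooth_manifold ::
  "('m::{t2_space,second_countable_topology}, 'z) manifold_scheme \<Rightarrow> bool" where
  "smooth_manifold M \<longleftrightarrow>
     (\<Union>(U, \<kappa>)\<in>charts M. U) = UNIV \<and>
     (\<forall>(U, \<kappa>)\<in>charts M. open U \<and> openin (Euclidean_space (mdim M)) (\<kappa> ` U) \<and>
        homeomorphic_map (top_of_set U) (subtopology (Euclidean_space (mdim M)) (\<kappa> ` U)) \<kappa>) \<and>
     (\<forall>(U, \<kappa>)\<in>charts M. \<forall>(V, \<mu>)\<in>charts M. \<forall>i<mdim M.
        smooth_Rn (mdim M) (\<kappa> ` (U \<inter> V)) (\<lambda>x. \<mu> (inv_into U \<kappa> x) i))"

definition smooth_on ::
  "('m::{t2_space,second_countable_topology}, 'z) manifold_scheme \<Rightarrow> 'm set \<Rightarrow> ('m \<Rightarrow> real) \<Rightarrow> bool" where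
  "smooth_on M W f \<longleftrightarrow>
     (\<forall>(U, \<kappa>)\<in>charts M. smooth_Rn (mdim M) (\<kappa> ` (U \<inter> W)) (\<lambda>x. f (inv_into U \<kappa> x)))"

abbreviation smooth_fun ::
  "('m::{t2_space,second_countable_topology}, 'z) manifold_scheme \<Rightarrow> ('m \<Rightarrow> real) \<Rightarrow> bool" where
  "smooth_fun M f \<equiv> smooth_on M UNIV f"

text \<open>$T_pM$, as the space of derivations of $C^\infty(M)$ at \<open>p\<close>; only the values of \<open>D\<close> on smooth
  functions matter.\<close>

definition tangent_space ::
  "('m::{t2_space,second_countable_topology}, 'z) manifold_scheme \<Rightarrow> 'm \<Rightarrow> (('m \<Rightarrow> real) \<Rightarrow> real) set" where
  "tangent_space M p = {D.
     (\<forall>f g. smooth_fun M f \<longrightarrow> smooth_fun M g \<longrightarrow>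
        D (\<lambda>q. f q + g q) = D f + D g \<and> D (\<lambda>q. f q * g q) = f p * D g + g p * D f) \<and>
     (\<forall>c f. smooth_fun M f \<longrightarrow> D (\<lambda>q. c * f q) = c * D f)}"

text \<open>A vector bundle of rank $k$: the fibre over \<open>p\<close> is a linear subspace \<open>fib p\<close> of the type \<open>'a\<close>
  (which carries no topology; the total space is the disjoint union of the fibres). A local
  trivialisation $(U,\varphi)$ consists of linear isomorphisms $\varphi_p$ from the fibres over $U$ onto
  $\mathbb R^k$, and the smooth structure is given by a bundle atlas with smooth transition matrices.\<close>

record ('m, 'a) vbundle = "'m manifold" +
  vrank :: nat
  fib :: "'m \<Rightarrow> 'a set"
  trivs :: "('m set \<times> ('m \<Rightarrow> 'a \<Rightarrow> nat \<Rightarrow> real)) set"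

definition linear_fun_on :: "'a::real_vector set \<Rightarrow> ('a \<Rightarrow> real) \<Rightarrow> bool" where
  "linear_fun_on S h \<longleftrightarrow>
     (\<forall>v\<in>S. \<forall>w\<in>S. h (v + w) = h v + h w) \<and> (\<forall>c. \<forall>v\<in>S. h (c *\<^sub>R v) = c * h v)"

text \<open>The local frame $e_j$ and dual frame $e^i$ of a trivialisation.\<close>

definition frame :: "('m, 'a, 'z) vbundle_scheme \<Rightarrow> 'm set \<times> ('m \<Rightarrow> 'a \<Rightarrow> nat \<Rightarrow> real) \<Rightarrow> nat \<Rightarrow> 'm \<Rightarrow> 'a" where
  "frame A T j p = inv_into (fib A p) (snd T p) (\<lambda>i. if i = j then 1 else 0)"

definition coframe ::
  "('m, 'a, 'z) vbundle_scheme \<Rightarrow> 'm set \<times> ('m \<Rightarrow> 'a \<Rightarrow> nat \<Rightarrow> real) \<Rightarrow> nat \<Rightarrow> 'm \<Rightarrow> 'a \<Rightarrow> real" where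
  "coframe A T i p = (\<lambda>v. if v \<in> fib A p then snd T p v i else 0)"

definition vector_bundle ::
  "('m::{t2_space,second_countable_topology}, 'a::real_vector, 'z) vbundle_scheme \<Rightarrow> bool" where
  "vector_bundle A \<longleftrightarrow>
     smooth_manifold A \<and>
     (\<forall>p. subspace (fib A p)) \<and>
     (\<Union>(U, \<phi>)\<in>trivs A. U) = UNIV \<and>
     (\<forall>(U, \<phi>)\<in>trivs A. open U \<and>
        (\<forall>p\<in>U. (\<forall>i. linear_fun_on (fib A p) (\<lambda>v. \<phi> p v i)) \<and>
               bij_betw (\<phi> p) (fib A p) (topspace (Euclidean_space (vrank A))))) \<and>
     (\<forall>S\<in>trivs A. \<forall>T\<in>trivs A. \<forall>i<vrank A. \<forall>j<vrank A.
        smooth_on A (fst S \<inter> fst T) (\<lambda>p. coframe A S i p (frame A T j p)))"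

definition smooth_section_on ::
  "('m::{t2_space,second_countable_topology}, 'a::real_vector, 'z) vbundle_scheme
    \<Rightarrow> 'm set \<Rightarrow> ('m \<Rightarrow> 'a) \<Rightarrow> bool" where
  "smooth_section_on A W X \<longleftrightarrow>
     (\<forall>p\<in>W. X p \<in> fib A p) \<and>
     (\<forall>T\<in>trivs A. \<forall>i<vrank A. smooth_on A (fst T \<inter> W) (\<lambda>p. coframe A T i p (X p)))"

definition sections ::
  "('m::{t2_space,second_countable_topology}, 'a::real_vector, 'z) vbundle_scheme \<Rightarrow> ('m \<Rightarrow> 'a) set" where
  "sections A = {X. smooth_section_on A UNIV X}"

text \<open>The dual bundle. Functionals are extended by \<open>0\<close> outside the fibre, so that they are equal
  as soon as they agree on it.\<close>

definition dual_fib :: "('m, 'a::real_vector, 'z) vbundle_scheme \<Rightarrow> 'm \<Rightarrow> ('a \<Rightarrow> real) set" where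
  "dual_fib A p = {\<xi>. linear_fun_on (fib A p) \<xi> \<and> (\<forall>v. v \<notin> fib A p \<longrightarrow> \<xi> v = 0)}"

definition smooth_dual_section_on ::
  "('m::{t2_space,second_countable_topology}, 'a::real_vector, 'z) vbundle_scheme
    \<Rightarrow> 'm set \<Rightarrow> ('m \<Rightarrow> 'a \<Rightarrow> real) \<Rightarrow> bool" where
  "smooth_dual_section_on A W \<xi> \<longleftrightarrow>
     (\<forall>p\<in>W. \<xi> p \<in> dual_fib A p) \<and>
     (\<forall>T\<in>trivs A. \<forall>j<vrank A. smooth_on A (fst T \<inter> W) (\<lambda>p. \<xi> p (frame A T j p)))"

definition dual_sections ::
  "('m::{t2_space,second_countable_topology}, 'a::real_vector, 'z) vbundle_scheme
    \<Rightarrow> ('m \<Rightarrow> 'a \<Rightarrow> real) set" where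
  "dual_sections A = {\<xi>. smooth_dual_section_on A UNIV \<xi>}"


section \<open>Lie algebroids\<close>

text \<open>\<open>anchor p\<close> is the fibre map $A_p \to T_pM$.\<close>

record ('m, 'a) lie_algebroid = "('m, 'a) vbundle" +
  brk :: "('m \<Rightarrow> 'a) \<Rightarrow> ('m \<Rightarrow> 'a) \<Rightarrow> 'm \<Rightarrow> 'a"
  anchor :: "'m \<Rightarrow> 'a \<Rightarrow> ('m \<Rightarrow> real) \<Rightarrow> real"

definition anchor_sec ::
  "('m, 'a, 'z) lie_algebroid_scheme \<Rightarrow> ('m \<Rightarrow> 'a) \<Rightarrow> ('m \<Rightarrow> real) \<Rightarrow> 'm \<Rightarrow> real" where
  "anchor_sec A X f = (\<lambda>p. anchor A p (X p) f)"

definition lie_algebroid ::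
  "('m::{t2_space,second_countable_topology}, 'a::real_vector, 'z) lie_algebroid_scheme \<Rightarrow> bool" where
  "lie_algebroid A \<longleftrightarrow>
     vector_bundle A \<and>
     \<comment> \<open>the anchor is a smooth bundle map into the tangent bundle\<close>
     (\<forall>p. \<forall>v\<in>fib A p. anchor A p v \<in> tangent_space A p) \<and>
     (\<forall>p f. smooth_fun A f \<longrightarrow> linear_fun_on (fib A p) (\<lambda>v. anchor A p v f)) \<and>
     (\<forall>X\<in>sections A. \<forall>f. smooth_fun A f \<longrightarrow> smooth_fun A (anchor_sec A X f)) \<and>
     \<comment> \<open>\<open>\<Gamma>A\<close> is a real Lie algebra\<close>
     (\<forall>X\<in>sections A. \<forall>Y\<in>sections A. brk A X Y \<in> sections A) \<and>
     (\<forall>X\<in>sections A. \<forall>Y\<in>sections A. \<forall>Z\<in>sections A.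
        brk A (\<lambda>p. X p + Y p) Z = (\<lambda>p. brk A X Z p + brk A Y Z p)) \<and>
     (\<forall>c. \<forall>X\<in>sections A. \<forall>Y\<in>sections A. brk A (\<lambda>p. c *\<^sub>R X p) Y = (\<lambda>p. c *\<^sub>R brk A X Y p)) \<and>
     (\<forall>X\<in>sections A. \<forall>Y\<in>sections A. brk A X Y = (\<lambda>p. - brk A Y X p)) \<and>
     (\<forall>X\<in>sections A. \<forall>Y\<in>sections A. \<forall>Z\<in>sections A.
        (\<lambda>p. brk A X (brk A Y Z) p + brk A Y (brk A Z X) p + brk A Z (brk A X Y) p) = (\<lambda>p. 0)) \<and>
     \<comment> \<open>compatibility of bracket and anchor\<close>
     (\<forall>X\<in>sections A. \<forall>Y\<in>sections A. \<forall>f. smooth_fun A f \<longrightarrow>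
        anchor_sec A (brk A X Y) f =
          (\<lambda>p. anchor_sec A X (anchor_sec A Y f) p - anchor_sec A Y (anchor_sec A X f) p)) \<and>
     (\<forall>X\<in>sections A. \<forall>Y\<in>sections A. \<forall>f. smooth_fun A f \<longrightarrow>
        brk A X (\<lambda>p. f p *\<^sub>R Y p) = (\<lambda>p. f p *\<^sub>R brk A X Y p + anchor_sec A X f p *\<^sub>R Y p))"

definition pair_sec :: "('m \<Rightarrow> 'a \<Rightarrow> real) \<Rightarrow> ('m \<Rightarrow> 'a) \<Rightarrow> 'm \<Rightarrow> real" where
  "pair_sec \<xi> X = (\<lambda>p. \<xi> p (X p))"

text \<open>The Lie algebroid differential on $1$- and $2$-forms, evaluated on sections.\<close>

definition diff1 ::
  "('m, 'a, 'z) lie_algebroid_scheme \<Rightarrow> ('m \<Rightarrow> 'a \<Rightarrow> real) \<Rightarrow> ('m \<Rightarrow> 'a) \<Rightarrow> ('m \<Rightarrow> 'a) \<Rightarrow> 'm \<Rightarrow> real" where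
  "diff1 A \<xi> X Y = (\<lambda>p.
     anchor_sec A X (pair_sec \<xi> Y) p - anchor_sec A Y (pair_sec \<xi> X) p - pair_sec \<xi> (brk A X Y) p)"

definition eval2 :: "('m \<Rightarrow> 'a \<Rightarrow> 'a \<Rightarrow> real) \<Rightarrow> ('m \<Rightarrow> 'a) \<Rightarrow> ('m \<Rightarrow> 'a) \<Rightarrow> 'm \<Rightarrow> real" where
  "eval2 \<omega> X Y = (\<lambda>p. \<omega> p (X p) (Y p))"

definition diff2 ::
  "('m, 'a, 'z) lie_algebroid_scheme \<Rightarrow> ('m \<Rightarrow> 'a \<Rightarrow> 'a \<Rightarrow> real)
    \<Rightarrow> ('m \<Rightarrow> 'a) \<Rightarrow> ('m \<Rightarrow> 'a) \<Rightarrow> ('m \<Rightarrow> 'a) \<Rightarrow> 'm \<Rightarrow> real" where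
  "diff2 A \<omega> X Y Z = (\<lambda>p.
     anchor_sec A X (eval2 \<omega> Y Z) p - anchor_sec A Y (eval2 \<omega> X Z) p + anchor_sec A Z (eval2 \<omega> X Y) p
     - eval2 \<omega> (brk A X Y) Z p + eval2 \<omega> (brk A X Z) Y p - eval2 \<omega> (brk A Y Z) X p)"

definition closed_form2 ::
  "('m::{t2_space,second_countable_topology}, 'a::real_vector, 'z) lie_algebroid_scheme
    \<Rightarrow> ('m \<Rightarrow> 'a \<Rightarrow> 'a \<Rightarrow> real) \<Rightarrow> bool" where
  "closed_form2 A \<omega> \<longleftrightarrow>
     (\<forall>X\<in>sections A. \<forall>Y\<in>sections A. \<forall>Z\<in>sections A. diff2 A \<omega> X Y Z = (\<lambda>p. 0))"

text \<open>The section of $A^*$ whose pairing with every section \<open>Z\<close> of \<open>A\<close> is the function \<open>F Z\<close>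
  (it exists uniquely when \<open>F\<close> is $C^\infty(M)$-linear).\<close>

definition dual_section_of ::
  "('m::{t2_space,second_countable_topology}, 'a::real_vector, 'z) vbundle_scheme
    \<Rightarrow> (('m \<Rightarrow> 'a) \<Rightarrow> 'm \<Rightarrow> real) \<Rightarrow> 'm \<Rightarrow> 'a \<Rightarrow> real" where
  "dual_section_of A F = (THE \<zeta>. \<zeta> \<in> dual_sections A \<and> (\<forall>Z\<in>sections A. pair_sec \<zeta> Z = F Z))"

definition lie_deriv ::
  "('m::{t2_space,second_countable_topology}, 'a::real_vector, 'z) lie_algebroid_scheme
    \<Rightarrow> ('m \<Rightarrow> 'a) \<Rightarrow> ('m \<Rightarrow> 'a \<Rightarrow> real) \<Rightarrow> 'm \<Rightarrow> 'a \<Rightarrow> real" where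
  "lie_deriv A X \<eta> = dual_section_of A
     (\<lambda>Z p. anchor_sec A X (pair_sec \<eta> Z) p - pair_sec \<eta> (brk A X Z) p)"

text \<open>$i_Y(\mathrm d\xi)$\<close>

definition int_diff ::
  "('m::{t2_space,second_countable_topology}, 'a::real_vector, 'z) lie_algebroid_scheme
    \<Rightarrow> ('m \<Rightarrow> 'a) \<Rightarrow> ('m \<Rightarrow> 'a \<Rightarrow> real) \<Rightarrow> 'm \<Rightarrow> 'a \<Rightarrow> real" where
  "int_diff A Y \<xi> = dual_section_of A (\<lambda>Z. diff1 A \<xi> Y Z)"


section \<open>Bivectors and 2-forms\<close>

text \<open>An element of $\wedge^2 A_p$ is an alternating bilinear form on $A_p^*$.\<close>

definition bivector ::
  "('m::{t2_space,second_countable_topology}, 'a::real_vector, 'z) vbundle_scheme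
    \<Rightarrow> ('m \<Rightarrow> ('a \<Rightarrow> real) \<Rightarrow> ('a \<Rightarrow> real) \<Rightarrow> real) \<Rightarrow> bool" where
  "bivector A \<pi> \<longleftrightarrow>
     (\<forall>p. \<forall>\<xi>\<in>dual_fib A p. \<forall>\<eta>\<in>dual_fib A p. \<forall>\<zeta>\<in>dual_fib A p. \<forall>c.
        \<pi> p (\<lambda>v. \<xi> v + \<eta> v) \<zeta> = \<pi> p \<xi> \<zeta> + \<pi> p \<eta> \<zeta> \<and>
        \<pi> p (\<lambda>v. c * \<xi> v) \<zeta> = c * \<pi> p \<xi> \<zeta> \<and>
        \<pi> p \<xi> \<eta> = - \<pi> p \<eta> \<xi>) \<and>
     (\<forall>T\<in>trivs A. \<forall>i<vrank A. \<forall>j<vrank A.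
        smooth_on A (fst T) (\<lambda>p. \<pi> p (coframe A T i p) (coframe A T j p)))"

definition form2 ::
  "('m::{t2_space,second_countable_topology}, 'a::real_vector, 'z) vbundle_scheme
    \<Rightarrow> ('m \<Rightarrow> 'a \<Rightarrow> 'a \<Rightarrow> real) \<Rightarrow> bool" where
  "form2 A \<omega> \<longleftrightarrow>
     (\<forall>p. \<forall>x\<in>fib A p. \<forall>y\<in>fib A p. linear_fun_on (fib A p) (\<lambda>v. \<omega> p v y) \<and> \<omega> p x y = - \<omega> p y x) \<and>
     (\<forall>T\<in>trivs A. \<forall>i<vrank A. \<forall>j<vrank A.
        smooth_on A (fst T) (\<lambda>p. \<omega> p (frame A T i p) (frame A T j p)))"

text \<open>$\pi\xi = i_\xi\pi$, i.e. $\langle\eta, \pi\xi\rangle = \pi(\xi,\eta)$, using $A_p = A_p^{**}$;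
  $\omega x = -i_x\omega$, i.e. $\langle\omega x, y\rangle = -\omega(x,y)$.\<close>

definition sharp ::
  "('m, 'a::real_vector, 'z) vbundle_scheme \<Rightarrow> ('m \<Rightarrow> ('a \<Rightarrow> real) \<Rightarrow> ('a \<Rightarrow> real) \<Rightarrow> real)
    \<Rightarrow> 'm \<Rightarrow> ('a \<Rightarrow> real) \<Rightarrow> 'a" where
  "sharp A \<pi> p \<xi> = (THE v. v \<in> fib A p \<and> (\<forall>\<eta>\<in>dual_fib A p. \<eta> v = \<pi> p \<xi> \<eta>))"

definition flat ::
  "('m, 'a::real_vector, 'z) vbundle_scheme \<Rightarrow> ('m \<Rightarrow> 'a \<Rightarrow> 'a \<Rightarrow> real) \<Rightarrow> 'm \<Rightarrow> 'a \<Rightarrow> 'a \<Rightarrow> real" where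
  "flat A \<omega> p x = (\<lambda>y. if y \<in> fib A p then - \<omega> p x y else 0)"

text \<open>Inverse of the identification \<^const>\<open>flat\<close>: the $2$-form of a (skew) map $F : A \to A^*$.\<close>

definition form_of_map :: "('m \<Rightarrow> 'a \<Rightarrow> 'a \<Rightarrow> real) \<Rightarrow> 'm \<Rightarrow> 'a \<Rightarrow> 'a \<Rightarrow> real" where
  "form_of_map F p x y = - F p x y"

definition smooth_bundle_map_to_dual ::
  "('m::{t2_space,second_countable_topology}, 'a::real_vector, 'z) vbundle_scheme
    \<Rightarrow> ('m \<Rightarrow> 'a \<Rightarrow> 'a \<Rightarrow> real) \<Rightarrow> bool" where
  "smooth_bundle_map_to_dual A F \<longleftrightarrow>
     (\<forall>p. (\<forall>x\<in>fib A p. F p x \<in> dual_fib A p) \<and> (\<forall>y\<in>fib A p. linear_fun_on (fib A p) (\<lambda>x. F p x y))) \<and>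
     (\<forall>T\<in>trivs A. \<forall>i<vrank A. \<forall>j<vrank A.
        smooth_on A (fst T) (\<lambda>p. F p (frame A T i p) (frame A T j p)))"

text \<open>Invertibility of $\pi : A^* \to A$ as a bundle map.\<close>

definition nondegenerate ::
  "('m::{t2_space,second_countable_topology}, 'a::real_vector, 'z) vbundle_scheme
    \<Rightarrow> ('m \<Rightarrow> ('a \<Rightarrow> real) \<Rightarrow> ('a \<Rightarrow> real) \<Rightarrow> real) \<Rightarrow> bool" where
  "nondegenerate A \<pi> \<longleftrightarrow>
     (\<exists>F. smooth_bundle_map_to_dual A F \<and>
        (\<forall>p. (\<forall>\<xi>\<in>dual_fib A p. F p (sharp A \<pi> p \<xi>) = \<xi>) \<and>
             (\<forall>x\<in>fib A p. sharp A \<pi> p (F p x) = x)))"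

text \<open>
  The Schouten--Nijenhuis bracket of two bivectors. It is a local operation, given on decomposable
  bivectors by
  $[X_1\wedge X_2, Y_1\wedge Y_2] = \sum_{i,j} (-1)^{i+j} [X_i,Y_j]\wedge X_{3-i}\wedge Y_{3-j}$,
  and near every point each bivector is a finite sum of decomposable ones. The value of the
  trivector at \<open>p\<close> is taken on three elements of $A_p^*$.
\<close>

definition wedge2 :: "'a \<Rightarrow> 'a \<Rightarrow> ('a \<Rightarrow> real) \<Rightarrow> ('a \<Rightarrow> real) \<Rightarrow> real" where
  "wedge2 u v \<alpha> \<beta> = \<alpha> u * \<beta> v - \<alpha> v * \<beta> u"

definition wedge3 :: "'a \<Rightarrow> 'a \<Rightarrow> 'a \<Rightarrow> ('a \<Rightarrow> real) \<Rightarrow> ('a \<Rightarrow> real) \<Rightarrow> ('a \<Rightarrow> real) \<Rightarrow> real" where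
  "wedge3 u v w \<alpha> \<beta> \<gamma> =
     \<alpha> u * wedge2 v w \<beta> \<gamma> + \<alpha> v * wedge2 w u \<beta> \<gamma> + \<alpha> w * wedge2 u v \<beta> \<gamma>"

definition decomposition_on ::
  "('m::{t2_space,second_countable_topology}, 'a::real_vector, 'z) vbundle_scheme \<Rightarrow> 'm set
    \<Rightarrow> ('m \<Rightarrow> ('a \<Rightarrow> real) \<Rightarrow> ('a \<Rightarrow> real) \<Rightarrow> real) \<Rightarrow> (('m \<Rightarrow> 'a) \<times> ('m \<Rightarrow> 'a)) list \<Rightarrow> bool" where
  "decomposition_on A W P xs \<longleftrightarrow>
     set xs \<subseteq> sections A \<times> sections A \<and>
     (\<forall>q\<in>W. \<forall>\<alpha>\<in>dual_fib A q. \<forall>\<beta>\<in>dual_fib A q.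
        P q \<alpha> \<beta> = (\<Sum>(X, Y)\<leftarrow>xs. wedge2 (X q) (Y q) \<alpha> \<beta>))"

definition schouten_decomposable ::
  "('m, 'a, 'z) lie_algebroid_scheme \<Rightarrow> ('m \<Rightarrow> 'a) \<Rightarrow> ('m \<Rightarrow> 'a) \<Rightarrow> ('m \<Rightarrow> 'a) \<Rightarrow> ('m \<Rightarrow> 'a)
    \<Rightarrow> 'm \<Rightarrow> ('a \<Rightarrow> real) \<Rightarrow> ('a \<Rightarrow> real) \<Rightarrow> ('a \<Rightarrow> real) \<Rightarrow> real" where
  "schouten_decomposable A X1 X2 Y1 Y2 p \<alpha> \<beta> \<gamma> =
       wedge3 (brk A X1 Y1 p) (X2 p) (Y2 p) \<alpha> \<beta> \<gamma> - wedge3 (brk A X1 Y2 p) (X2 p) (Y1 p) \<alpha> \<beta> \<gamma>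
     - wedge3 (brk A X2 Y1 p) (X1 p) (Y2 p) \<alpha> \<beta> \<gamma> + wedge3 (brk A X2 Y2 p) (X1 p) (Y1 p) \<alpha> \<beta> \<gamma>"

definition schouten ::
  "('m::{t2_space,second_countable_topology}, 'a::real_vector, 'z) lie_algebroid_scheme
    \<Rightarrow> ('m \<Rightarrow> ('a \<Rightarrow> real) \<Rightarrow> ('a \<Rightarrow> real) \<Rightarrow> real) \<Rightarrow> ('m \<Rightarrow> ('a \<Rightarrow> real) \<Rightarrow> ('a \<Rightarrow> real) \<Rightarrow> real)
    \<Rightarrow> 'm \<Rightarrow> ('a \<Rightarrow> real) \<Rightarrow> ('a \<Rightarrow> real) \<Rightarrow> ('a \<Rightarrow> real) \<Rightarrow> real" where
  "schouten A P Q p \<alpha> \<beta> \<gamma> = (THE r. \<exists>W xs ys. open W \<and> p \<in> W \<and>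
     decomposition_on A W P xs \<and> decomposition_on A W Q ys \<and>
     r = (\<Sum>(X1, X2)\<leftarrow>xs. \<Sum>(Y1, Y2)\<leftarrow>ys. schouten_decomposable A X1 X2 Y1 Y2 p \<alpha> \<beta> \<gamma>))"

definition poisson ::
  "('m::{t2_space,second_countable_topology}, 'a::real_vector, 'z) lie_algebroid_scheme
    \<Rightarrow> ('m \<Rightarrow> ('a \<Rightarrow> real) \<Rightarrow> ('a \<Rightarrow> real) \<Rightarrow> real) \<Rightarrow> bool" where
  "poisson A \<pi> \<longleftrightarrow> bivector A \<pi> \<and>
     (\<forall>p. \<forall>\<alpha>\<in>dual_fib A p. \<forall>\<beta>\<in>dual_fib A p. \<forall>\<gamma>\<in>dual_fib A p. schouten A \<pi> \<pi> p \<alpha> \<beta> \<gamma> = 0)"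

definition presymplectic ::
  "('m::{t2_space,second_countable_topology}, 'a::real_vector, 'z) lie_algebroid_scheme
    \<Rightarrow> ('m \<Rightarrow> 'a \<Rightarrow> 'a \<Rightarrow> real) \<Rightarrow> bool" where
  "presymplectic A \<omega> \<longleftrightarrow> form2 A \<omega> \<and> closed_form2 A \<omega>"

text \<open>$N = \pi\circ\omega$ and $\omega_N = \omega\circ N$\<close>

definition N_map ::
  "('m, 'a::real_vector, 'z) vbundle_scheme \<Rightarrow> ('m \<Rightarrow> ('a \<Rightarrow> real) \<Rightarrow> ('a \<Rightarrow> real) \<Rightarrow> real)
    \<Rightarrow> ('m \<Rightarrow> 'a \<Rightarrow> 'a \<Rightarrow> real) \<Rightarrow> 'm \<Rightarrow> 'a \<Rightarrow> 'a" where
  "N_map A \<pi> \<omega> p x = sharp A \<pi> p (flat A \<omega> p x)"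

definition omega_N ::
  "('m, 'a::real_vector, 'z) vbundle_scheme \<Rightarrow> ('m \<Rightarrow> ('a \<Rightarrow> real) \<Rightarrow> ('a \<Rightarrow> real) \<Rightarrow> real)
    \<Rightarrow> ('m \<Rightarrow> 'a \<Rightarrow> 'a \<Rightarrow> real) \<Rightarrow> 'm \<Rightarrow> 'a \<Rightarrow> 'a \<Rightarrow> real" where
  "omega_N A \<pi> \<omega> = form_of_map (\<lambda>p x. flat A \<omega> p (N_map A \<pi> \<omega> p x))"

definition P_Omega_structure ::
  "('m::{t2_space,second_countable_topology}, 'a::real_vector, 'z) lie_algebroid_scheme
    \<Rightarrow> ('m \<Rightarrow> ('a \<Rightarrow> real) \<Rightarrow> ('a \<Rightarrow> real) \<Rightarrow> real) \<Rightarrow> ('m \<Rightarrow> 'a \<Rightarrow> 'a \<Rightarrow> real) \<Rightarrow> bool" where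
  "P_Omega_structure A \<pi> \<omega> \<longleftrightarrow>
     bivector A \<pi> \<and> form2 A \<omega> \<and> poisson A \<pi> \<and> closed_form2 A \<omega> \<and> closed_form2 A (omega_N A \<pi> \<omega>)"


section \<open>Dirac structures and Dirac pairs\<close>

text \<open>Subsets of $A \oplus A^*$ are given by their fibres.\<close>

definition graph_bivector ::
  "('m, 'a::real_vector, 'z) vbundle_scheme \<Rightarrow> ('m \<Rightarrow> ('a \<Rightarrow> real) \<Rightarrow> ('a \<Rightarrow> real) \<Rightarrow> real)
    \<Rightarrow> 'm \<Rightarrow> ('a \<times> ('a \<Rightarrow> real)) set" where
  "graph_bivector A \<pi> p = {(sharp A \<pi> p \<xi>, \<xi>) |\<xi>. \<xi> \<in> dual_fib A p}"

definition graph_form ::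
  "('m, 'a::real_vector, 'z) vbundle_scheme \<Rightarrow> ('m \<Rightarrow> 'a \<Rightarrow> 'a \<Rightarrow> real)
    \<Rightarrow> 'm \<Rightarrow> ('a \<times> ('a \<Rightarrow> real)) set" where
  "graph_form A \<omega> p = {(x, flat A \<omega> p x) |x. x \<in> fib A p}"

definition linear_subspace_sum ::
  "('m, 'a::real_vector, 'z) vbundle_scheme \<Rightarrow> 'm \<Rightarrow> ('a \<times> ('a \<Rightarrow> real)) set \<Rightarrow> bool" where
  "linear_subspace_sum A p S \<longleftrightarrow>
     S \<subseteq> fib A p \<times> dual_fib A p \<and> (0, \<lambda>v. 0) \<in> S \<and>
     (\<forall>(x, \<xi>)\<in>S. \<forall>(y, \<eta>)\<in>S. (x + y, \<lambda>v. \<xi> v + \<eta> v) \<in> S) \<and>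
     (\<forall>c. \<forall>(x, \<xi>)\<in>S. (c *\<^sub>R x, \<lambda>v. c * \<xi> v) \<in> S)"

text \<open>A (smooth) subbundle of $A \oplus A^*$ of rank \<open>r\<close>: locally, there are \<open>r\<close> smooth sections
  forming a basis of the fibre at every point.\<close>

definition subbundle_sum ::
  "('m::{t2_space,second_countable_topology}, 'a::real_vector, 'z) vbundle_scheme
    \<Rightarrow> ('m \<Rightarrow> ('a \<times> ('a \<Rightarrow> real)) set) \<Rightarrow> bool" where
  "subbundle_sum A L \<longleftrightarrow>
     (\<forall>p. linear_subspace_sum A p (L p)) \<and>
     (\<exists>r. \<forall>p. \<exists>W X \<xi>. open W \<and> p \<in> W \<and>
        (\<forall>i<r. smooth_section_on A W (X i) \<and> smooth_dual_section_on A W (\<xi> i) \<and>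
               (\<forall>q\<in>W. (X i q, \<xi> i q) \<in> L q)) \<and>
        (\<forall>q\<in>W. \<forall>l\<in>L q. \<exists>!c. c \<in> topspace (Euclidean_space r) \<and>
           l = (\<Sum>i<r. c i *\<^sub>R X i q, \<lambda>v. \<Sum>i<r. c i * \<xi> i q v)))"

definition isotropic :: "('a \<times> ('a \<Rightarrow> real)) set \<Rightarrow> bool" where
  "isotropic S \<longleftrightarrow> (\<forall>(x, \<xi>)\<in>S. \<forall>(y, \<eta>)\<in>S. \<xi> y + \<eta> x = 0)"

definition maximally_isotropic ::
  "('m, 'a::real_vector, 'z) vbundle_scheme \<Rightarrow> 'm \<Rightarrow> ('a \<times> ('a \<Rightarrow> real)) set \<Rightarrow> bool" where
  "maximally_isotropic A p S \<longleftrightarrow>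
     linear_subspace_sum A p S \<and> isotropic S \<and>
     (\<forall>S'. linear_subspace_sum A p S' \<and> isotropic S' \<and> S \<subseteq> S' \<longrightarrow> S' = S)"

text \<open>$\Gamma L$\<close>

definition sections_sum ::
  "('m::{t2_space,second_countable_topology}, 'a::real_vector, 'z) vbundle_scheme
    \<Rightarrow> ('m \<Rightarrow> ('a \<times> ('a \<Rightarrow> real)) set) \<Rightarrow> (('m \<Rightarrow> 'a) \<times> ('m \<Rightarrow> 'a \<Rightarrow> real)) set" where
  "sections_sum A L = {(X, \<xi>). X \<in> sections A \<and> \<xi> \<in> dual_sections A \<and> (\<forall>p. (X p, \<xi> p) \<in> L p)}"

fun dorfman ::
  "('m::{t2_space,second_countable_topology}, 'a::real_vector, 'z) lie_algebroid_scheme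
    \<Rightarrow> ('m \<Rightarrow> 'a) \<times> ('m \<Rightarrow> 'a \<Rightarrow> real) \<Rightarrow> ('m \<Rightarrow> 'a) \<times> ('m \<Rightarrow> 'a \<Rightarrow> real)
    \<Rightarrow> ('m \<Rightarrow> 'a) \<times> ('m \<Rightarrow> 'a \<Rightarrow> real)" where
  "dorfman A (X, \<xi>) (Y, \<eta>) = (brk A X Y, \<lambda>p v. lie_deriv A X \<eta> p v - int_diff A Y \<xi> p v)"

definition dirac_structure ::
  "('m::{t2_space,second_countable_topology}, 'a::real_vector, 'z) lie_algebroid_scheme
    \<Rightarrow> ('m \<Rightarrow> ('a \<times> ('a \<Rightarrow> real)) set) \<Rightarrow> bool" where
  "dirac_structure A L \<longleftrightarrow>
     subbundle_sum A L \<and> (\<forall>p. maximally_isotropic A p (L p)) \<and>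
     (\<forall>s\<in>sections_sum A L. \<forall>t\<in>sections_sum A L. dorfman A s t \<in> sections_sum A L)"

definition dual_relation ::
  "('m::{t2_space,second_countable_topology}, 'a::real_vector, 'z) vbundle_scheme
    \<Rightarrow> (('m \<Rightarrow> 'a) \<times> ('m \<Rightarrow> 'a)) set \<Rightarrow> (('m \<Rightarrow> 'a \<Rightarrow> real) \<times> ('m \<Rightarrow> 'a \<Rightarrow> real)) set" where
  "dual_relation A N = {(\<beta>, \<alpha>). \<beta> \<in> dual_sections A \<and> \<alpha> \<in> dual_sections A \<and>
     (\<forall>(u, v)\<in>N. pair_sec \<alpha> u = pair_sec \<beta> v)}"

definition nijenhuis_relation ::
  "('m::{t2_space,second_countable_topology}, 'a::real_vector, 'z) lie_algebroid_scheme
    \<Rightarrow> (('m \<Rightarrow> 'a) \<times> ('m \<Rightarrow> 'a)) set \<Rightarrow> bool" where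
  "nijenhuis_relation A N \<longleftrightarrow>
     (\<forall>u1 v1 u2 v2 \<alpha> \<alpha>' \<alpha>''.
        (u1, v1) \<in> N \<longrightarrow> (u2, v2) \<in> N \<longrightarrow>
        (\<alpha>, \<alpha>') \<in> dual_relation A N \<longrightarrow> (\<alpha>', \<alpha>'') \<in> dual_relation A N \<longrightarrow>
        (\<forall>p. pair_sec \<alpha> (brk A v1 v2) p
             - pair_sec \<alpha>' (\<lambda>q. brk A v1 u2 q + brk A u1 v2 q) p
             + pair_sec \<alpha>'' (brk A u1 u2) p = 0))"

definition pair_relation ::
  "('m::{t2_space,second_countable_topology}, 'a::real_vector, 'z) vbundle_scheme
    \<Rightarrow> ('m \<Rightarrow> ('a \<times> ('a \<Rightarrow> real)) set) \<Rightarrow> ('m \<Rightarrow> ('a \<times> ('a \<Rightarrow> real)) set)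
    \<Rightarrow> (('m \<Rightarrow> 'a) \<times> ('m \<Rightarrow> 'a)) set" where
  "pair_relation A L L' = {(x, y). x \<in> sections A \<and> y \<in> sections A \<and>
     (\<exists>\<xi>\<in>dual_sections A. (x, \<xi>) \<in> sections_sum A L' \<and> (y, \<xi>) \<in> sections_sum A L)}"

definition dirac_pair ::
  "('m::{t2_space,second_countable_topology}, 'a::real_vector, 'z) lie_algebroid_scheme
    \<Rightarrow> ('m \<Rightarrow> ('a \<times> ('a \<Rightarrow> real)) set) \<Rightarrow> ('m \<Rightarrow> ('a \<times> ('a \<Rightarrow> real)) set) \<Rightarrow> bool" where
  "dirac_pair A L L' \<longleftrightarrow>
     dirac_structure A L \<and> dirac_structure A L' \<and> nijenhuis_relation A (pair_relation A L L')"

end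

theory Submission
  imports Defs
begin

text \<open>
  Write $\{\xi,\eta\} = \mathcal L_{\pi\xi}\eta - i_{\pi\eta}\mathrm d\xi$. A bivector is Poisson iff
  $[\pi\xi,\pi\eta] = \pi\{\xi,\eta\}$; hence the Nijenhuis torsion of
  $N = \pi\omega$ is $T(X,Y) = \pi(S(X,Y))$ with
  $S(X,Y) = \{\omega X,\omega Y\} - \omega[NX,Y] - \omega[X,NY] + \omega N[X,Y]$, and Koszul's formula gives
  $\langle S(X,Y),Z\rangle = -\mathrm d\omega(NX,Y,Z) - \mathrm d\omega(X,NY,Z) + \mathrm d\omega_N(X,Y,Z)$.
  The relation $\mathbf N$ of the two graphs is the graph of $N$, and it is a Nijenhuis relation when
  $T = 0$. As $\mathrm d\omega = 0$, closedness of $\omega_N$ implies the Nijenhuis property, and the converse holds when $\pi$ is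
  invertible, since then every section is of the form $\pi\alpha$ and $N^*\alpha = \omega\pi\alpha$ is smooth.

  To pass between sections and fibres one needs bump functions. The coordinates of one chart are smooth
  in every other chart by the definition of an atlas, so composition with functions of one real variable
  is all the chain rule that is required.
\<close>

section \<open>Calculus of smooth functions\<close>

text \<open>Two kinds of definite description shape the work. \<open>schouten\<close> is the number
  common to all local decompositions of its arguments, so a formula for it has to be established for
  every pair of decompositions at once. Comparing decompositions directly would require control of
  the relations between them. The expression \<open>sharp_defect\<close> avoids this: it sees a
  decomposition only through the contracted sections, which near the point are \<pi>\<xi> whatever
  the decomposition. It is not symmetric in its two bivectors, and the derivatives of coefficients
  cancel only in the sum over both orders; for two copies of \<pi> the orders agree, whence the
  factor 2 in \<open>schouten_self\<close>. Likewise \<open>lie_deriv\<close> and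
  \<open>int_diff\<close> become usable only after tensoriality has produced the sections that they
  describe. Bracket and anchor act on global sections and functions, whereas frames and
  decompositions are local. Hence constructions with frames need a cut-off, and bracket and anchor
  must be shown to be local operators before the result of such a construction can be
  exploited.\<close>

lemma Euclidean_space_eq: "Euclidean_space n = top_of_set (topspace (Euclidean_space n))"
  by (simp add: topspace_Euclidean_space Euclidean_space_def euclidean_product_topology)

lemma openin_Euclidean_spaceE:
  assumes "openin (Euclidean_space n) U"
  obtains T where "open T" "U = topspace (Euclidean_space n) \<inter> T"
proof -
  have "openin (top_of_set (topspace (Euclidean_space n))) U"
    using assms Euclidean_space_eq[of n] by simp
  then show ?thesis using that unfolding openin_open by blast
qed

text \<open>The function type carries the product topology, so the abstract topology on R^n is a
  subspace topology and the theory of \<open>continuous_on\<close> applies to it.\<close>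

lemma continuous_map_Euclidean_space_sub:
  assumes "U \<subseteq> topspace (Euclidean_space n)"
  shows "continuous_map (subtopology (Euclidean_space n) U) euclideanreal f \<longleftrightarrow> continuous_on U f"
proof -
  have "subtopology (Euclidean_space n) U = top_of_set U"
    using assms by (subst Euclidean_space_eq) (simp add: subtopology_subtopology inf.absorb2)
  then show ?thesis by simp
qed

text \<open>The line in direction i is continuous in t coordinate by coordinate, and as i < n it
  stays among the sequences vanishing from n on. Partial derivatives on an open set thus depend only
  on the values there.\<close>

lemma eventually_fun_upd_in_open:
  assumes U: "openin (Euclidean_space n) U" and x: "x \<in> U" and i: "i < n"
  shows "\<forall>\<^sub>F t in nhds (x i). x(i := t) \<in> U"
proof -
  let ?E = "topspace (Euclidean_space n)"
  obtain T where T: "open T" "U = ?E \<inter> T"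
    using U by (rule openin_Euclidean_spaceE)
  have xE: "x \<in> ?E" using T x by auto
  have "continuous_on UNIV (\<lambda>t j. (x(i := t)) j)"
  proof (rule continuous_on_coordinatewise_then_product)
    show "continuous_on UNIV (\<lambda>t. (x(i := t)) j)" for j
      by (cases "j = i") (auto intro: continuous_intros)
  qed
  then have "open ((\<lambda>t. x(i := t)) -` T)"
    by (rule open_vimage[OF T(1)])
  moreover have "x i \<in> (\<lambda>t. x(i := t)) -` T" using x T by auto
  ultimately have "\<forall>\<^sub>F t in nhds (x i). t \<in> (\<lambda>t. x(i := t)) -` T"
    by (rule eventually_nhds_in_open)
  moreover have "x(i := t) \<in> ?E" for t using xE i by (auto simp: topspace_Euclidean_space)
  ultimately show ?thesis using T by (auto elim: eventually_mono)
qed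

section \<open>Partial derivatives and closure properties of C^k functions\<close>

lemma partial_cong:
  assumes "openin (Euclidean_space n) U" "\<And>y. y \<in> U \<Longrightarrow> f y = g y" "x \<in> U" "i < n"
  shows "partial i f x = partial i g x"
  unfolding partial_def
  by (rule deriv_cong_ev[OF eventually_mono[OF eventually_fun_upd_in_open[OF assms(1,3,4)]]])
     (auto intro: assms(2))

lemma partial_differentiable_cong:
  fixes f g :: "(nat \<Rightarrow> real) \<Rightarrow> real"
  assumes "openin (Euclidean_space n) U" "\<And>y. y \<in> U \<Longrightarrow> f y = g y" "x \<in> U" "i < n"
    and "(\<lambda>t. f (x(i := t))) differentiable (at (x i))"
  shows "(\<lambda>t. g (x(i := t))) differentiable (at (x i))"
proof -
  have ev: "\<forall>\<^sub>F t in nhds (x i). f (x(i := t)) = g (x(i := t))"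
    by (rule eventually_mono[OF eventually_fun_upd_in_open[OF assms(1,3,4)]]) (auto intro: assms(2))
  obtain D where "((\<lambda>t. f (x(i := t))) has_real_derivative D) (at (x i))"
    using assms(5) by (auto simp: real_differentiable_def)
  then have "((\<lambda>t. g (x(i := t))) has_real_derivative D) (at (x i))"
    using DERIV_cong_ev[OF refl ev refl] by blast
  then show ?thesis by (auto simp: real_differentiable_def)
qed

lemma has_derivative_partial:
  assumes "(\<lambda>t. f (x(i := t))) differentiable (at (x i))"
  shows "((\<lambda>t. f (x(i := t))) has_real_derivative partial i f x) (at (x i))"
  using assms unfolding partial_def
  by (metis DERIV_deriv_iff_real_differentiable)

lemma partial_eqI:
  assumes "((\<lambda>t. f (x(i := t))) has_real_derivative D) (at (x i))"
  shows "partial i f x = D"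
  using assms unfolding partial_def by (rule DERIV_imp_deriv)

text \<open>The product and chain rules compute \<open>partial i f\<close> only at points of U, and
  inverse charts are controlled only on the image of the chart. This lemma lets such a formula
  replace the function itself.\<close>

lemma Ck_cong:
  assumes "openin (Euclidean_space n) U" "\<And>x. x \<in> U \<Longrightarrow> f x = g x" "Ck n k U f"
  shows "Ck n k U g"
  using assms(2,3)
proof (induction k arbitrary: f g)
  case 0
  then show ?case using openin_subset[OF assms(1)]
    by (auto simp: continuous_map_Euclidean_space_sub intro: continuous_on_eq)
next
  case (Suc k)
  have U: "U \<subseteq> topspace (Euclidean_space n)" using assms(1) by (rule openin_subset)
  show ?case
    using Suc.prems U Suc.IH[of "partial i f" "partial i g" for i]
      partial_cong[OF assms(1), of f g] partial_differentiable_cong[OF assms(1), of f g]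
    by (auto simp: continuous_map_Euclidean_space_sub intro: continuous_on_eq)
qed

lemma Ck_subset: "Ck n k U f \<Longrightarrow> V \<subseteq> U \<Longrightarrow> Ck n k V f"
  by (induction k arbitrary: f) (auto intro: continuous_map_from_subtopology_mono)

lemma Ck_Suc_imp: "Ck n (Suc k) U f \<Longrightarrow> Ck n k U f"
proof (induction k arbitrary: f)
  case (Suc k)
  then show ?case by (metis Ck.simps(2))
qed auto

text \<open>Differentiability is a pointwise condition and \<open>partial i f\<close> does not
  mention U, so only continuity has to be glued; the induction on k reduces everything to
  it.\<close>

lemma Ck_local:
  assumes "\<And>x. x \<in> U \<Longrightarrow> \<exists>V. openin (Euclidean_space n) V \<and> x \<in> V \<and> V \<subseteq> U \<and> Ck n k V f"
  shows "Ck n k U f"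
  using assms
proof (induction k arbitrary: f)
  case 0
  then obtain V where V: "\<And>x. x \<in> U \<Longrightarrow> openin (Euclidean_space n) (V x) \<and> x \<in> V x \<and> V x \<subseteq> U \<and> Ck n 0 (V x) f"
    by metis
  have "continuous_on U f"
    unfolding continuous_on_eq_continuous_within
  proof
    fix x assume x: "x \<in> U"
    have "continuous_on (V x) f"
      using V[OF x] openin_subset continuous_map_Euclidean_space_sub by (metis Ck.simps(1))
    then have "continuous (at x within V x) f"
      using V[OF x] by (auto simp: continuous_on_eq_continuous_within)
    moreover obtain T where T: "open T" "V x = topspace (Euclidean_space n) \<inter> T"
      using V[OF x] openin_Euclidean_spaceE by metis
    have "U \<subseteq> topspace (Euclidean_space n)" using V openin_subset by blast
    \<comment> \<open>\<open>V x\<close> is the trace of the open T on R^n, so inside T the sets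
      \<open>V x\<close> and U have the same points.\<close>
    then have "at x within V x = at x within U"
      using V[OF x] T by (intro at_within_nhd[of x T]) auto
    ultimately show "continuous (at x within U) f" by simp
  qed
  moreover have "U \<subseteq> topspace (Euclidean_space n)" using V openin_subset by blast
  ultimately show ?case by (simp add: continuous_map_Euclidean_space_sub)
next
  case (Suc k)
  have "Ck n k U f"
  proof (rule Suc.IH)
    fix x assume "x \<in> U"
    then show "\<exists>V. openin (Euclidean_space n) V \<and> x \<in> V \<and> V \<subseteq> U \<and> Ck n k V f"
    proof -
      obtain V where "openin (Euclidean_space n) V" "x \<in> V" "V \<subseteq> U" "Ck n (Suc k) V f"
        using Suc.prems[OF \<open>x \<in> U\<close>] by (elim exE conjE)
      then show ?thesis using Ck_Suc_imp by (intro exI[of _ V] conjI)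
    qed
  qed
  then have "continuous_map (subtopology (Euclidean_space n) U) euclideanreal f"
    by (cases k) auto
  moreover have "Ck n k U (partial i f)" if "i < n" for i
  proof (rule Suc.IH)
    fix x assume "x \<in> U"
    then obtain V where "openin (Euclidean_space n) V" "x \<in> V" "V \<subseteq> U" "Ck n (Suc k) V f"
      using Suc.prems[OF \<open>x \<in> U\<close>] by (elim exE conjE)
    then show "\<exists>V. openin (Euclidean_space n) V \<and> x \<in> V \<and> V \<subseteq> U \<and> Ck n k V (partial i f)"
      using that by (intro exI[of _ V]) simp
  qed
  moreover have "(\<lambda>t. f (x(i := t))) differentiable (at (x i))" if "i < n" "x \<in> U" for i x
  proof -
    obtain V where "x \<in> V" "Ck n (Suc k) V f" using Suc.prems[OF \<open>x \<in> U\<close>] by (elim exE conjE)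
    then show ?thesis using that by simp
  qed
  ultimately show ?case by simp
qed

lemma Ck_const: "Ck n k U (\<lambda>x. c)"
proof (induction k arbitrary: c)
  case (Suc k)
  have "partial i (\<lambda>x. c) = (\<lambda>x. 0)" for i by (auto simp: partial_def)
  then show ?case using Suc by simp
qed simp

lemma Ck_add:
  assumes U: "openin (Euclidean_space n) U" and "Ck n k U f" "Ck n k U g"
  shows "Ck n k U (\<lambda>x. f x + g x)"
  using assms(2,3)
proof (induction k arbitrary: f g)
  case 0
  then show ?case by (auto intro: continuous_map_add)
next
  case (Suc k)
  have D: "((\<lambda>t. f (x(i := t)) + g (x(i := t))) has_real_derivative (partial i f x + partial i g x)) (at (x i))"
    if "i < n" "x \<in> U" for i x
    using Suc.prems that by (intro DERIV_add has_derivative_partial) auto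
  have "Ck n k U (partial i (\<lambda>x. f x + g x))" if "i < n" for i
  proof (rule Ck_cong[OF U])
    show "Ck n k U (\<lambda>x. partial i f x + partial i g x)" using Suc that by simp
    show "x \<in> U \<Longrightarrow> partial i f x + partial i g x = partial i (\<lambda>x. f x + g x) x" for x
      by (rule sym, rule partial_eqI, rule D[OF that])
  qed
  then show ?case using D Suc.prems
    by (auto intro!: continuous_map_add simp: real_differentiable_def)
qed

text \<open>The product rule contains f and g undifferentiated, so the induction also uses that
  C^(k+1) functions are C^k.\<close>

lemma Ck_mult:
  assumes U: "openin (Euclidean_space n) U" and "Ck n k U f" "Ck n k U g"
  shows "Ck n k U (\<lambda>x. f x * g x)"
  using assms(2,3)
proof (induction k arbitrary: f g)
  case 0
  then show ?case by (auto intro: continuous_map_real_mult)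
next
  case (Suc k)
  have D: "((\<lambda>t. f (x(i := t)) * g (x(i := t))) has_real_derivative (partial i f x * g x + partial i g x * f x)) (at (x i))"
    if "i < n" "x \<in> U" for i x
    using DERIV_mult[OF has_derivative_partial[of f x i] has_derivative_partial[of g x i]] Suc.prems that by auto
  have "Ck n k U (partial i (\<lambda>x. f x * g x))" if "i < n" for i
  proof (rule Ck_cong[OF U])
    show "Ck n k U (\<lambda>x. partial i f x * g x + partial i g x * f x)"
      using Suc that Ck_Suc_imp[OF Suc.prems(1)] Ck_Suc_imp[OF Suc.prems(2)]
      by (intro Ck_add[OF U] Suc.IH) auto
    show "x \<in> U \<Longrightarrow> partial i f x * g x + partial i g x * f x = partial i (\<lambda>x. f x * g x) x" for x
      by (rule sym, rule partial_eqI, rule D[OF that])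
  qed
  then show ?case using D Suc.prems
    by (auto intro!: continuous_map_real_mult simp: real_differentiable_def)
qed

text \<open>\<open>G\<close> is the sequence of successive derivatives of \<open>G 0\<close>; composing with all of them at once
  makes the induction on \<open>k\<close> go through.\<close>

lemma Ck_compose:
  assumes U: "openin (Euclidean_space n) U" and "Ck n k U f"
    and S: "open S" "f ` U \<subseteq> S"
    and G: "\<And>m t. t \<in> S \<Longrightarrow> (G m has_real_derivative G (Suc m) t) (at t)"
  shows "Ck n k U (\<lambda>x. G m (f x))"
  using assms(2)
proof (induction k arbitrary: m)
  case (0 m)
  have "continuous_on S (G m)" using G by (meson DERIV_isCont continuous_at_imp_continuous_on)
  then show ?case
    using 0 S(2) openin_subset[OF U]
    by (auto simp: continuous_map_Euclidean_space_sub intro: continuous_on_compose2)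
next
  case (Suc k m)
  have f: "Ck n k U f" using Suc.prems by (rule Ck_Suc_imp)
  have D: "((\<lambda>t. G m (f (x(i := t)))) has_real_derivative (G (Suc m) (f x) * partial i f x)) (at (x i))"
    if "i < n" "x \<in> U" for i x
  proof -
    have "f x \<in> S" using that S by auto
    then have "(G m has_real_derivative G (Suc m) (f (x(i := x i)))) (at (f (x(i := x i))))" using G by simp
    then show ?thesis
      using DERIV_chain2[OF _ has_derivative_partial[of f x i]] Suc.prems that by fastforce
  qed
  have "Ck n k U (partial i (\<lambda>x. G m (f x)))" if "i < n" for i
  proof (rule Ck_cong[OF U])
    show "Ck n k U (\<lambda>x. G (Suc m) (f x) * partial i f x)"
      using Suc.prems that by (intro Ck_mult[OF U] Suc.IH f) auto
    show "x \<in> U \<Longrightarrow> G (Suc m) (f x) * partial i f x = partial i (\<lambda>x. G m (f x)) x" for x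
      by (rule sym, rule partial_eqI, rule D[OF that])
  qed
  moreover have "continuous_map (subtopology (Euclidean_space n) U) euclideanreal (\<lambda>x. G m (f x))"
    using Suc.IH[OF f, of m] by (cases k) auto
  ultimately show ?case using D by (auto simp: real_differentiable_def)
qed

text \<open>For q = 1 this is the classical smooth function exp(-1/t) that is flat at 0. The
  polynomial in 1/t makes the family closed under differentiation.\<close>

definition exp_bump :: "real poly \<Rightarrow> real \<Rightarrow> real" where
  "exp_bump q t = (if t > 0 then poly q (inverse t) * exp (- inverse t) else 0)"

text \<open>With s = 1/t one has ds/dt = -s^2, so q(s) exp(-s) has t-derivative s^2 (q(s) - q'(s))
  exp(-s).\<close>

definition exp_bump_step :: "real poly \<Rightarrow> real poly" where
  "exp_bump_step q = [:0, 0, 1:] * (q - pderiv q)"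

lemma poly_exp_tendsto_0: "((\<lambda>x::real. poly q x * exp (- x)) \<longlongrightarrow> 0) at_top"
proof -
  have eq: "poly q x * exp (- x) = (\<Sum>i\<le>degree q. coeff q i * (x ^ i / exp x))" for x :: real
    by (simp add: poly_altdef sum_distrib_right exp_minus divide_inverse mult.assoc)
  have "((\<lambda>x::real. \<Sum>i\<le>degree q. coeff q i * (x ^ i / exp x)) \<longlongrightarrow> (\<Sum>i\<le>degree q. coeff q i * 0)) at_top"
    by (intro tendsto_sum tendsto_mult tendsto_const tendsto_power_div_exp_0)
  then show ?thesis by (simp add: eq)
qed

lemma exp_bump_tendsto_0: "(exp_bump q \<longlongrightarrow> 0) (at 0)"
proof -
  have "((\<lambda>t::real. poly q (inverse t) * exp (- inverse t)) \<longlongrightarrow> 0) (at_right 0)"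
    by (rule filterlim_compose[OF poly_exp_tendsto_0 filterlim_inverse_at_top_right])
  then have "(exp_bump q \<longlongrightarrow> 0) (at_right 0)"
    by (rule Lim_transform_eventually) (auto simp: eventually_at_right_less exp_bump_def eventually_at_filter)
  moreover have "(exp_bump q \<longlongrightarrow> 0) (at_left 0)"
    by (rule Lim_transform_eventually[OF tendsto_const]) (auto simp: exp_bump_def eventually_at_filter)
  ultimately show ?thesis by (simp add: filterlim_split_at)
qed

lemma exp_bump_has_derivative:
  "(exp_bump q has_real_derivative exp_bump (exp_bump_step q) t) (at t)"
proof -
  consider "t > 0" | "t < 0" | "t = 0" by linarith
  then show ?thesis
  proof cases
    case 1
    have "((\<lambda>t. poly q (inverse t) * exp (- inverse t)) has_real_derivative exp_bump (exp_bump_step q) t) (at t)"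
      using 1 by (auto intro!: derivative_eq_intros DERIV_chain2[OF poly_DERIV] simp: exp_bump_def exp_bump_step_def
        field_simps power2_eq_square)
    moreover have "\<forall>\<^sub>F s in nhds t. poly q (inverse s) * exp (- inverse s) = exp_bump q s"
      using eventually_nhds_in_open[of "{0<..}" t] 1 by (auto simp: exp_bump_def elim!: eventually_mono)
    ultimately show ?thesis by (rule iffD1[OF DERIV_cong_ev[OF refl _ refl], rotated])
  next
    case 2
    have "((\<lambda>t. 0) has_real_derivative exp_bump (exp_bump_step q) t) (at t)"
      using 2 by (auto simp: exp_bump_def)
    moreover have "\<forall>\<^sub>F s in nhds t. 0 = exp_bump q s"
      using eventually_nhds_in_open[of "{..<0}" t] 2 by (auto simp: exp_bump_def elim!: eventually_mono)
    ultimately show ?thesis by (rule iffD1[OF DERIV_cong_ev[OF refl _ refl], rotated])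
  next
    case 3
    \<comment> \<open>Dividing by h multiplies the polynomial by its variable, which stands for 1/h.
      The difference quotient at 0 therefore stays in the family, whose members all tend to 0
      there.\<close>
    have "(exp_bump q h - exp_bump q 0) / (h - 0) = exp_bump ([:0,1:] * q) h" for h
      by (auto simp: exp_bump_def field_simps)
    then have "((\<lambda>h. (exp_bump q h - exp_bump q 0) / (h - 0)) \<longlongrightarrow> 0) (at 0)"
      by (simp only: exp_bump_tendsto_0)
    then show ?thesis using 3 by (simp add: has_field_derivative_iff exp_bump_def)
  qed
qed

section \<open>Smooth functions on manifolds\<close>

locale smooth_mfd =
  fixes M :: "('m::{t2_space,second_countable_topology}, 'z) manifold_scheme"
  assumes smooth_manifold: "smooth_manifold M"
begin

lemma chart_exists: obtains U \<kappa> where "(U, \<kappa>) \<in> charts M" "p \<in> U"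
proof -
  have "p \<in> (\<Union>(U, \<kappa>)\<in>charts M. U)" using smooth_manifold unfolding smooth_manifold_def by simp
  then show ?thesis using that by auto
qed

lemma
  assumes "(U, \<kappa>) \<in> charts M"
  shows chart_open: "open U"
    and chart_image_open: "openin (Euclidean_space (mdim M)) (\<kappa> ` U)"
    and chart_homeo: "homeomorphic_map (top_of_set U) (subtopology (Euclidean_space (mdim M)) (\<kappa> ` U)) \<kappa>"
  using smooth_manifold assms unfolding smooth_manifold_def by auto

lemma chart_inj: "(U, \<kappa>) \<in> charts M \<Longrightarrow> inj_on \<kappa> U"
  using homeomorphic_imp_injective_map[OF chart_homeo] by simp

lemma chart_inv [simp]: "(U, \<kappa>) \<in> charts M \<Longrightarrow> q \<in> U \<Longrightarrow> inv_into U \<kappa> (\<kappa> q) = q"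
  by (simp add: chart_inj)

lemma chart_image_subset: "(U, \<kappa>) \<in> charts M \<Longrightarrow> q \<in> U \<Longrightarrow> \<kappa> q \<in> topspace (Euclidean_space (mdim M))"
  using chart_image_open openin_subset by blast

lemma chart_openin:
  assumes "(U, \<kappa>) \<in> charts M" "open W"
  shows "openin (Euclidean_space (mdim M)) (\<kappa> ` (U \<inter> W))"
proof -
  have "openin (top_of_set U) (U \<inter> W)" using assms by auto
  then have "openin (subtopology (Euclidean_space (mdim M)) (\<kappa> ` U)) (\<kappa> ` (U \<inter> W))"
    using homeomorphic_imp_open_map[OF chart_homeo[OF assms(1)]] by (auto simp: open_map_def)
  then show ?thesis using chart_image_open[OF assms(1)] openin_trans_full by blast
qed

lemma chart_continuous:
  assumes "(U, \<kappa>) \<in> charts M" shows "continuous_on U \<kappa>"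
proof -
  have "subtopology (Euclidean_space (mdim M)) (\<kappa> ` U) = top_of_set (topspace (Euclidean_space (mdim M)) \<inter> \<kappa> ` U)"
    by (subst Euclidean_space_eq) (rule subtopology_subtopology)
  then have "continuous_map (top_of_set U) (top_of_set (topspace (Euclidean_space (mdim M)) \<inter> \<kappa> ` U)) \<kappa>"
    using homeomorphic_imp_continuous_map[OF chart_homeo[OF assms]] by simp
  then show ?thesis by (simp add: continuous_map_in_subtopology)
qed

text \<open>Used to transport compactness: the support of a bump function is the image of a
  coordinate box under the inverse chart.\<close>

lemma chart_inv_continuous:
  assumes "(U, \<kappa>) \<in> charts M" shows "continuous_on (\<kappa> ` U) (inv_into U \<kappa>)"
proof -
  have sub: "\<kappa> ` U \<subseteq> topspace (Euclidean_space (mdim M))"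
    using chart_image_open[OF assms] openin_subset by blast
  have top: "subtopology (Euclidean_space (mdim M)) (\<kappa> ` U) = top_of_set (\<kappa> ` U)"
    using sub by (subst Euclidean_space_eq) (simp add: subtopology_subtopology inf.absorb2)
  obtain g where g: "homeomorphic_maps (top_of_set U) (top_of_set (\<kappa> ` U)) \<kappa> g"
    using chart_homeo[OF assms] top homeomorphic_map_maps by metis
  then have g1: "continuous_on (\<kappa> ` U) g" and g2: "\<And>q. q \<in> U \<Longrightarrow> g (\<kappa> q) = q"
    by (auto simp: homeomorphic_maps_def continuous_map_in_subtopology)
  show ?thesis
    by (rule continuous_on_eq[OF g1]) (auto simp: g2 chart_inv[OF assms])
qed

section \<open>Algebra and gluing of smooth functions on a manifold\<close>

lemma smooth_on_iff: "smooth_on M W f \<longleftrightarrow>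
   (\<forall>U \<kappa> k. (U, \<kappa>) \<in> charts M \<longrightarrow> Ck (mdim M) k (\<kappa> ` (U \<inter> W)) (\<lambda>x. f (inv_into U \<kappa> x)))"
  unfolding smooth_on_def smooth_Rn_def by auto

lemma smooth_on_subset: "smooth_on M W f \<Longrightarrow> V \<subseteq> W \<Longrightarrow> smooth_on M V f"
  unfolding smooth_on_iff by (meson Ck_subset Int_mono image_mono order_refl)

lemma smooth_on_cong:
  assumes "open W" "\<And>q. q \<in> W \<Longrightarrow> f q = g q" "smooth_on M W f"
  shows "smooth_on M W g"
  unfolding smooth_on_iff
proof (intro allI impI)
  fix U \<kappa> k assume c: "(U, \<kappa>) \<in> charts M"
  show "Ck (mdim M) k (\<kappa> ` (U \<inter> W)) (\<lambda>x. g (inv_into U \<kappa> x))"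
    by (rule Ck_cong[OF chart_openin[OF c assms(1)], where f = "\<lambda>x. f (inv_into U \<kappa> x)"])
      (use assms c in \<open>auto simp: smooth_on_iff\<close>)
qed

lemma smooth_on_local:
  assumes "\<And>q. q \<in> W \<Longrightarrow> \<exists>V. open V \<and> q \<in> V \<and> smooth_on M (V \<inter> W) f" "open W"
  shows "smooth_on M W f"
  unfolding smooth_on_iff
proof (intro allI impI)
  fix U \<kappa> k assume c: "(U, \<kappa>) \<in> charts M"
  show "Ck (mdim M) k (\<kappa> ` (U \<inter> W)) (\<lambda>x. f (inv_into U \<kappa> x))"
  proof (rule Ck_local)
    fix x assume "x \<in> \<kappa> ` (U \<inter> W)"
    then obtain q where q: "q \<in> U" "q \<in> W" "x = \<kappa> q" by auto
    obtain V where V: "open V" "q \<in> V" "smooth_on M (V \<inter> W) f" using assms(1) q by blast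
    show "\<exists>V. openin (Euclidean_space (mdim M)) V \<and> x \<in> V \<and> V \<subseteq> \<kappa> ` (U \<inter> W) \<and>
             Ck (mdim M) k V (\<lambda>x. f (inv_into U \<kappa> x))"
      using V q c assms(2)
      by (intro exI[of _ "\<kappa> ` (U \<inter> (V \<inter> W))"] conjI chart_openin) (auto simp: smooth_on_iff)
  qed
qed

lemma smooth_on_const: "smooth_on M W (\<lambda>q. c)"
  unfolding smooth_on_iff by (simp add: Ck_const)

lemma smooth_on_add:
  "open W \<Longrightarrow> smooth_on M W f \<Longrightarrow> smooth_on M W g \<Longrightarrow> smooth_on M W (\<lambda>q. f q + g q)"
  unfolding smooth_on_iff by (auto intro!: Ck_add chart_openin)

lemma smooth_on_mult:
  "open W \<Longrightarrow> smooth_on M W f \<Longrightarrow> smooth_on M W g \<Longrightarrow> smooth_on M W (\<lambda>q. f q * g q)"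
  unfolding smooth_on_iff by (auto intro!: Ck_mult chart_openin)

lemma smooth_on_cmult: "open W \<Longrightarrow> smooth_on M W f \<Longrightarrow> smooth_on M W (\<lambda>q. c * f q)"
  by (intro smooth_on_mult smooth_on_const)

lemma smooth_on_minus: "open W \<Longrightarrow> smooth_on M W f \<Longrightarrow> smooth_on M W (\<lambda>q. - f q)"
  using smooth_on_cmult[of W f "- 1"] by simp

lemma smooth_on_diff:
  "open W \<Longrightarrow> smooth_on M W f \<Longrightarrow> smooth_on M W g \<Longrightarrow> smooth_on M W (\<lambda>q. f q - g q)"
  using smooth_on_add[of W f "\<lambda>q. - g q"] by (simp add: smooth_on_minus)

lemma smooth_on_sum:
  "open W \<Longrightarrow> (\<And>i. i \<in> I \<Longrightarrow> smooth_on M W (f i)) \<Longrightarrow> smooth_on M W (\<lambda>q. \<Sum>i\<in>I. f i q)"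
  by (induction I rule: infinite_finite_induct) (auto intro: smooth_on_const smooth_on_add)

lemma smooth_on_compose:
  assumes "open W" "smooth_on M W f" "open S" "f ` W \<subseteq> S"
    and "\<And>m t. t \<in> S \<Longrightarrow> (G m has_real_derivative G (Suc m) t) (at t)"
  shows "smooth_on M W (\<lambda>q. G m (f q))"
  unfolding smooth_on_iff
proof (intro allI impI)
  fix U \<kappa> k assume c: "(U, \<kappa>) \<in> charts M"
  show "Ck (mdim M) k (\<kappa> ` (U \<inter> W)) (\<lambda>x. G m (f (inv_into U \<kappa> x)))"
    by (rule Ck_compose[where G = G, OF chart_openin[OF c assms(1)] _ assms(3)])
      (use assms(2,4,5) c in \<open>auto simp: smooth_on_iff\<close>)
qed

lemma smooth_on_chart: "(U, \<kappa>) \<in> charts M \<Longrightarrow> i < mdim M \<Longrightarrow> smooth_on M U (\<lambda>q. \<kappa> q i)"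
proof -
  assume c: "(U, \<kappa>) \<in> charts M" "i < mdim M"
  have "smooth_Rn (mdim M) (\<mu> ` (V \<inter> U)) (\<lambda>x. \<kappa> (inv_into V \<mu> x) i)" if "(V, \<mu>) \<in> charts M" for V \<mu>
    using smooth_manifold that c unfolding smooth_manifold_def by blast
  then show ?thesis by (auto simp: smooth_on_def)
qed

lemma smooth_on_inverse:
  assumes "open W" "smooth_on M W f" "\<And>q. q \<in> W \<Longrightarrow> f q > 0"
  shows "smooth_on M W (\<lambda>q. inverse (f q))"
proof -
  \<comment> \<open>The m-th derivative of 1/t is (-1)^m m! / t^(m+1).\<close>
  let ?G = "\<lambda>m t::real. (-1) ^ m * fact m * inverse (t ^ Suc m)"
  have "smooth_on M W (\<lambda>q. ?G 0 (f q))"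
  proof (rule smooth_on_compose[OF assms(1,2), where S = "{0<..}" and G = ?G])
    fix m and t :: real assume "t \<in> {0<..}"
    then show "(?G m has_real_derivative ?G (Suc m) t) (at t)"
      by (auto intro!: derivative_eq_intros simp: field_simps simp del: power_Suc) (simp add: field_simps)
  qed (use assms in auto)
  then show ?thesis by simp
qed

lemma smooth_on_exp_bump:
  assumes "open W" "smooth_on M W f"
  shows "smooth_on M W (\<lambda>q. exp_bump 1 (f q))"
proof -
  \<comment> \<open>Iterating \<open>exp_bump_step\<close> m times on 1 yields the polynomial of the
    m-th derivative.\<close>
  have "smooth_on M W (\<lambda>q. (\<lambda>m. exp_bump ((exp_bump_step ^^ m) 1)) 0 (f q))"
    by (rule smooth_on_compose[OF assms, where S = UNIV]) (auto simp: exp_bump_has_derivative)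
  then show ?thesis by simp
qed

lemma smooth_on_continuous:
  assumes "open W" "smooth_on M W f"
  shows "continuous_on W f"
proof -
  have "continuous_on (\<Union>c\<in>charts M. fst c \<inter> W) f"
  proof (rule continuous_on_open_UN)
    fix c assume c: "c \<in> charts M"
    obtain U \<kappa> where U: "c = (U, \<kappa>)" by force
    then have c: "(U, \<kappa>) \<in> charts M" using c by simp
    show "open (fst c \<inter> W)" using assms chart_open[OF c] U by auto
    have "Ck (mdim M) 0 (\<kappa> ` (U \<inter> W)) (\<lambda>x. f (inv_into U \<kappa> x))"
      using assms c by (simp add: smooth_on_iff del: Ck.simps)
    then have "continuous_on (\<kappa> ` (U \<inter> W)) (\<lambda>x. f (inv_into U \<kappa> x))"
      using openin_subset[OF chart_openin[OF c assms(1)]] by (simp add: continuous_map_Euclidean_space_sub)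
    then have "continuous_on (U \<inter> W) (\<lambda>q. f (inv_into U \<kappa> (\<kappa> q)))"
      by (rule continuous_on_compose2) (auto intro: continuous_on_subset[OF chart_continuous[OF c]])
    then show "continuous_on (fst c \<inter> W) f"
      unfolding U fst_conv by (rule continuous_on_eq) (auto simp: c)
  qed
  moreover have "(\<Union>c\<in>charts M. fst c \<inter> W) = W"
  proof -
    have "q \<in> (\<Union>c\<in>charts M. fst c \<inter> W)" if "q \<in> W" for q
      by (rule chart_exists[of q]) (use that in force)
    then show ?thesis by auto
  qed
  ultimately show ?thesis by simp
qed

text \<open>W and the complement of K are open and cover V: f is smooth on the part in W by
  assumption and identically 0 on the other part. Closedness of K is what makes extension by zero
  legitimate.\<close>

lemma smooth_on_extend:
  assumes "open V" "open W" "closed K" "K \<subseteq> W" "smooth_on M (V \<inter> W) f"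
    and "\<And>q. q \<in> V \<Longrightarrow> q \<notin> K \<Longrightarrow> f q = 0"
  shows "smooth_on M V f"
proof (rule smooth_on_local)
  fix q assume "q \<in> V"
  have "smooth_on M (V - K) f"
    by (rule smooth_on_cong[OF _ _ smooth_on_const[of _ 0]]) (use assms in auto)
  then have K: "smooth_on M (- K \<inter> V) f" by (simp add: Diff_eq Int_commute)
  have W: "smooth_on M (W \<inter> V) f" using assms(5) by (simp add: Int_commute)
  show "\<exists>U. open U \<and> q \<in> U \<and> smooth_on M (U \<inter> V) f"
  proof (cases "q \<in> K")
    case True
    then show ?thesis using assms(2,4) W by (intro exI[of _ W] conjI) (simp_all add: subsetD)
  next
    case False
    then show ?thesis using assms(3) K by (intro exI[of _ "- K"] conjI) (simp_all add: open_Compl)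
  qed
qed fact

section \<open>Existence of smooth bump functions\<close>

lemma box_exists:
  assumes "openin (Euclidean_space n) Q" "x \<in> Q"
  obtains \<epsilon> where "\<epsilon> > 0" "\<And>y. y \<in> topspace (Euclidean_space n) \<Longrightarrow> (\<And>i. i < n \<Longrightarrow> \<bar>y i - x i\<bar> \<le> \<epsilon>) \<Longrightarrow> y \<in> Q"
proof -
  obtain T where T: "open T" "Q = topspace (Euclidean_space n) \<inter> T"
    using assms(1) by (rule openin_Euclidean_spaceE)
  have "openin (powertop_real UNIV) T" using T(1) by (simp add: euclidean_product_topology)
  then obtain X where X: "x \<in> (\<Pi>\<^sub>E i\<in>UNIV. X i)" "\<And>i. open (X i)" "(\<Pi>\<^sub>E i\<in>UNIV. X i) \<subseteq> T"
    using product_topology_open_contains_basis[of "\<lambda>_. euclideanreal" UNIV T x] assms(2) T(2) by auto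
  have "\<exists>e>0. cball (x i) e \<subseteq> X i" for i
    using X(1,2) by (meson PiE_mem UNIV_I open_contains_cball)
  then obtain e where e: "\<And>i. e i > 0" "\<And>i. cball (x i) (e i) \<subseteq> X i" by metis
  \<comment> \<open>Beyond n the coordinates of both points are 0, so only finitely many radii
    count. The extra element 1 keeps the minimum meaningful when n = 0.\<close>
  define \<epsilon> where "\<epsilon> = Min (insert 1 (e ` {..<n}))"
  have "\<epsilon> > 0" using e by (auto simp: \<epsilon>_def)
  moreover have "y \<in> Q" if y: "y \<in> topspace (Euclidean_space n)" and le: "\<And>i. i < n \<Longrightarrow> \<bar>y i - x i\<bar> \<le> \<epsilon>" for y
  proof -
    have "y i \<in> X i" for i
    proof (cases "i < n")
      case True
      then have "\<epsilon> \<le> e i" by (auto simp: \<epsilon>_def)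
      then have "y i \<in> cball (x i) (e i)" using le[OF True] by (auto simp: dist_real_def)
      then show ?thesis using e(2)[of i] by blast
    next
      case False
      then have "y i = x i" using y assms(2) T(2) by (auto simp: topspace_Euclidean_space)
      then show ?thesis using X(1) by auto
    qed
    then show ?thesis using X(3) y T(2) by auto
  qed
  ultimately show ?thesis using that by blast
qed

text \<open>A function H supported in a small coordinate box and positive at p is extended by zero
  from the chart domain. Its values near p are then flattened to exactly 1 by a quotient a / (a + b)
  of two functions of H. The box is compact, so its preimage K is closed because the manifold is
  Hausdorff.\<close>

lemma bump_exists:
  assumes W: "open W" "p \<in> W"
  obtains h V K where "smooth_fun M h" "open V" "p \<in> V" "V \<subseteq> K" "closed K" "K \<subseteq> W"
    "\<And>q. q \<in> V \<Longrightarrow> h q = 1" "\<And>q. q \<notin> K \<Longrightarrow> h q = 0"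
proof -
  obtain U \<kappa> where c: "(U, \<kappa>) \<in> charts M" and p: "p \<in> U" by (rule chart_exists)
  let ?n = "mdim M" and ?E = "topspace (Euclidean_space (mdim M))"
  have "\<kappa> p \<in> \<kappa> ` (U \<inter> W)" using p W by auto
  then obtain \<epsilon> where \<epsilon>: "\<epsilon> > 0"
    and box: "\<And>y. y \<in> ?E \<Longrightarrow> (\<And>i. i < ?n \<Longrightarrow> \<bar>y i - \<kappa> p i\<bar> \<le> \<epsilon>) \<Longrightarrow> y \<in> \<kappa> ` (U \<inter> W)"
    using box_exists[OF chart_openin[OF c W(1)]] by metis
  \<comment> \<open>The singleton in the coordinates from n on keeps the infinite product inside
    R^n, and Tychonoff's theorem makes it compact.\<close>
  define S where "S = (\<lambda>i. if i < ?n then {\<kappa> p i - \<epsilon> .. \<kappa> p i + \<epsilon>} else {0::real})"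
  have "compactin (powertop_real UNIV) (\<Pi>\<^sub>E i\<in>UNIV. S i)"
    by (subst compactin_PiE) (auto simp: S_def)
  then have B: "compact (\<Pi>\<^sub>E i\<in>UNIV. S i)" by (simp add: euclidean_product_topology)
  have BW: "(\<Pi>\<^sub>E i\<in>UNIV. S i) \<subseteq> \<kappa> ` (U \<inter> W)"
  proof
    fix y assume y: "y \<in> (\<Pi>\<^sub>E i\<in>UNIV. S i)"
    have y': "y i \<in> S i" for i using y by (auto simp: PiE_iff)
    show "y \<in> \<kappa> ` (U \<inter> W)"
    proof (rule box)
      have "y i = 0" if "i \<ge> ?n" for i using y'[of i] that by (simp add: S_def)
      then show "y \<in> ?E" by (simp add: topspace_Euclidean_space)
      show "\<bar>y i - \<kappa> p i\<bar> \<le> \<epsilon>" if "i < ?n" for i using y'[of i] that by (auto simp: S_def abs_le_iff)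
    qed
  qed
  define K where "K = inv_into U \<kappa> ` (\<Pi>\<^sub>E i\<in>UNIV. S i)"
  have "compact K" unfolding K_def
    by (rule compact_continuous_image[OF continuous_on_subset[OF chart_inv_continuous[OF c]] B]) (use BW in auto)
  then have clK: "closed K" by (rule compact_imp_closed)
  have "K \<subseteq> inv_into U \<kappa> ` \<kappa> ` (U \<inter> W)" using BW unfolding K_def by (rule image_mono)
  then have KW: "K \<subseteq> U \<inter> W" using chart_inv[OF c] by auto
  define r where "r = (\<lambda>q. \<Sum>i<?n. (\<kappa> q i - \<kappa> p i) * (\<kappa> q i - \<kappa> p i))"
  have rs: "smooth_on M U r" unfolding r_def
    by (intro smooth_on_sum smooth_on_mult smooth_on_diff smooth_on_chart[OF c] smooth_on_const chart_open[OF c]) auto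
  define H where "H = (\<lambda>q. if q \<in> U then exp_bump 1 (\<epsilon> * \<epsilon> - r q) else 0)"
  have "smooth_on M U (\<lambda>q. exp_bump 1 (\<epsilon> * \<epsilon> - r q))"
    by (intro smooth_on_exp_bump smooth_on_diff smooth_on_const rs chart_open[OF c])
  then have HU: "smooth_on M U H"
    by (rule smooth_on_cong[OF chart_open[OF c], rotated]) (simp add: H_def)
  have HK: "H q = 0" if "q \<notin> K" for q
  proof (cases "q \<in> U")
    case True
    \<comment> \<open>Some coordinate of q violates the box, and its index is below n since later
      coordinates are 0. That coordinate alone pushes the squared distance r above \<epsilon>^2,
      where \<open>exp_bump\<close> vanishes.\<close>
    have "\<kappa> q \<notin> (\<Pi>\<^sub>E i\<in>UNIV. S i)"
      using that True chart_inv[OF c True] unfolding K_def by force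
    then obtain i where i: "\<kappa> q i \<notin> S i" by auto
    have "i < ?n" using i chart_image_subset[OF c True] by (auto simp: S_def topspace_Euclidean_space split: if_splits)
    then have "\<epsilon> < \<bar>\<kappa> q i - \<kappa> p i\<bar>" using i by (auto simp: S_def)
    then have "\<epsilon> * \<epsilon> < \<bar>\<kappa> q i - \<kappa> p i\<bar> * \<bar>\<kappa> q i - \<kappa> p i\<bar>" using \<epsilon> by (intro mult_strict_mono) auto
    also have "\<dots> = (\<kappa> q i - \<kappa> p i) * (\<kappa> q i - \<kappa> p i)" by simp
    also have "\<dots> \<le> r q" unfolding r_def
      using \<open>i < ?n\<close> by (intro member_le_sum) auto
    finally show ?thesis by (simp add: H_def exp_bump_def)
  qed (simp add: H_def)
  have H: "smooth_fun M H" by (rule smooth_on_extend[OF open_UNIV chart_open[OF c] clK _ _ HK]) (use KW HU in auto)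
  have Hp: "H p > 0" using p \<epsilon> by (simp add: H_def r_def exp_bump_def)
  \<comment> \<open>a vanishes where H is at most a third of \<open>H p\<close>, b where H is at
    least two thirds. They never vanish together, so the quotient is smooth; it is 1 where b = 0,
    and 0 outside K, where H = 0.\<close>
  define a b where "a = (\<lambda>q. exp_bump 1 (H q - H p / 3))" and "b = (\<lambda>q. exp_bump 1 (2 * H p / 3 - H q))"
  have ab: "a q \<ge> 0" "b q \<ge> 0" "a q + b q > 0" for q
    using Hp by (auto simp: a_def b_def exp_bump_def add_pos_pos)
  have ss: "smooth_fun M a" "smooth_fun M b"
    unfolding a_def b_def by (intro smooth_on_exp_bump smooth_on_diff smooth_on_const H open_UNIV)+
  define h where "h = (\<lambda>q. a q * inverse (a q + b q))"
  have "smooth_fun M h" unfolding h_def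
    by (intro smooth_on_mult smooth_on_inverse smooth_on_add ss ab open_UNIV)
  moreover define V where "V = {q. H q > 2 * H p / 3}"
  moreover have "open V" unfolding V_def
    by (intro open_Collect_less continuous_on_const smooth_on_continuous H open_UNIV)
  moreover have "p \<in> V" using Hp by (simp add: V_def)
  moreover have "V \<subseteq> K" using HK Hp unfolding V_def by fastforce
  moreover have "h q = 1" if "q \<in> V" for q
  proof -
    have "b q = 0" using that by (simp add: V_def b_def exp_bump_def)
    then show ?thesis using ab(3)[of q] by (simp add: h_def)
  qed
  moreover have "h q = 0" if "q \<notin> K" for q
    using HK[OF that] Hp by (simp add: h_def a_def exp_bump_def)
  ultimately show ?thesis using that clK KW by blast
qed

end

section \<open>Vector bundles\<close>

lemma linear_fun_onI:
  "(\<And>v w. v \<in> S \<Longrightarrow> w \<in> S \<Longrightarrow> h (v + w) = h v + h w) \<Longrightarrow>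
   (\<And>c v. v \<in> S \<Longrightarrow> h (c *\<^sub>R v) = c * h v) \<Longrightarrow> linear_fun_on S h"
  by (simp add: linear_fun_on_def)

lemma
  assumes "linear_fun_on S h"
  shows linear_fun_on_add: "v \<in> S \<Longrightarrow> w \<in> S \<Longrightarrow> h (v + w) = h v + h w"
    and linear_fun_on_scale: "v \<in> S \<Longrightarrow> h (c *\<^sub>R v) = c * h v"
  using assms by (auto simp: linear_fun_on_def)

lemma linear_fun_on_zero: "linear_fun_on S h \<Longrightarrow> 0 \<in> S \<Longrightarrow> h 0 = 0"
  using linear_fun_on_scale[of S h 0 0] by simp

lemma linear_fun_on_minus: "linear_fun_on S h \<Longrightarrow> v \<in> S \<Longrightarrow> h (- v) = - h v"
  using linear_fun_on_scale[of S h v "- 1"] by simp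

lemma linear_fun_on_sum:
  assumes "linear_fun_on S h" "subspace S" "\<And>i. i \<in> I \<Longrightarrow> v i \<in> S"
  shows "h (\<Sum>i\<in>I. c i *\<^sub>R v i) = (\<Sum>i\<in>I. c i * h (v i))"
  using assms(3)
proof (induction I rule: infinite_finite_induct)
  case (insert i I)
  have "(\<Sum>i\<in>I. c i *\<^sub>R v i) \<in> S" "c i *\<^sub>R v i \<in> S"
    using insert.prems assms(2) by (auto intro!: subspace_sum subspace_scale)
  then show ?case
    using insert linear_fun_on_add[OF assms(1)] linear_fun_on_scale[OF assms(1)] by simp
qed (use linear_fun_on_zero[OF assms(1) subspace_0[OF assms(2)]] in auto)

locale vbdl =
  fixes A :: "('m::{t2_space,second_countable_topology}, 'a::real_vector, 'z) vbundle_scheme"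
  assumes vector_bundle: "vector_bundle A"
begin

sublocale smooth_mfd A
  using vector_bundle by unfold_locales (simp add: vector_bundle_def)

lemma fib_subspace: "subspace (fib A p)"
  using vector_bundle by (simp add: vector_bundle_def)

lemma
  shows fib_0 [simp]: "0 \<in> fib A p"
    and fib_add: "v \<in> fib A p \<Longrightarrow> w \<in> fib A p \<Longrightarrow> v + w \<in> fib A p"
    and fib_scale: "v \<in> fib A p \<Longrightarrow> c *\<^sub>R v \<in> fib A p"
    and fib_minus: "v \<in> fib A p \<Longrightarrow> - v \<in> fib A p"
    and fib_sum: "(\<And>i. i \<in> I \<Longrightarrow> f i \<in> fib A p) \<Longrightarrow> sum f I \<in> fib A p"
  using fib_subspace[of p]
  by (auto intro: subspace_0 subspace_add subspace_scale subspace_neg subspace_sum)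

section \<open>Fibres, frames and coframes\<close>

lemma triv_exists: obtains T where "T \<in> trivs A" "p \<in> fst T"
proof -
  have "p \<in> (\<Union>(U, \<phi>)\<in>trivs A. U)" using vector_bundle unfolding vector_bundle_def by simp
  then show ?thesis using that by force
qed

lemma triv_open: "T \<in> trivs A \<Longrightarrow> open (fst T)"
  using vector_bundle unfolding vector_bundle_def by force

lemma triv_linear: "T \<in> trivs A \<Longrightarrow> p \<in> fst T \<Longrightarrow> linear_fun_on (fib A p) (\<lambda>v. snd T p v i)"
  using vector_bundle unfolding vector_bundle_def by force

lemma triv_bij:
  "T \<in> trivs A \<Longrightarrow> p \<in> fst T \<Longrightarrow> bij_betw (snd T p) (fib A p) (topspace (Euclidean_space (vrank A)))"
  using vector_bundle unfolding vector_bundle_def by force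

lemma
  assumes T: "T \<in> trivs A" "p \<in> fst T" and j: "j < vrank A"
  shows frame_fib: "frame A T j p \<in> fib A p"
    and coframe_frame: "coframe A T i p (frame A T j p) = (if i = j then 1 else 0)"
proof -
  have "(\<lambda>i. if i = j then 1 else 0) \<in> snd T p ` fib A p"
    using triv_bij[OF T] j by (auto simp: bij_betw_def topspace_Euclidean_space)
  then show 1: "frame A T j p \<in> fib A p"
    unfolding frame_def by (rule inv_into_into)
  have "snd T p (frame A T j p) = (\<lambda>i. if i = j then 1 else 0)"
    unfolding frame_def by (rule f_inv_into_f) fact
  then show "coframe A T i p (frame A T j p) = (if i = j then 1 else 0)"
    using 1 by (simp add: coframe_def)
qed

lemma dual_fibI:
  "linear_fun_on (fib A p) \<xi> \<Longrightarrow> (\<And>v. v \<notin> fib A p \<Longrightarrow> \<xi> v = 0) \<Longrightarrow> \<xi> \<in> dual_fib A p"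
  by (simp add: dual_fib_def)

lemma dual_fib_linear: "\<xi> \<in> dual_fib A p \<Longrightarrow> linear_fun_on (fib A p) \<xi>"
  by (simp add: dual_fib_def)

lemma coframe_dual:
  assumes "T \<in> trivs A" "p \<in> fst T"
  shows "coframe A T i p \<in> dual_fib A p"
  using triv_linear[OF assms, of i]
  by (intro dual_fibI linear_fun_onI) (auto simp: coframe_def linear_fun_on_def fib_add fib_scale)

text \<open>Both sides lie in the fibre and have the same coordinates, and the trivialisation is
  injective on the fibre.\<close>

lemma fib_expand:
  assumes T: "T \<in> trivs A" "p \<in> fst T" and v: "v \<in> fib A p"
  shows "v = (\<Sum>i<vrank A. coframe A T i p v *\<^sub>R frame A T i p)" (is "v = ?w")
proof -
  have w: "?w \<in> fib A p" by (intro fib_sum fib_scale frame_fib T) auto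
  have "snd T p v i = snd T p ?w i" for i
  proof -
    have "snd T p ?w i = (\<Sum>j<vrank A. coframe A T j p v * snd T p (frame A T j p) i)"
      by (rule linear_fun_on_sum[OF triv_linear[OF T] fib_subspace]) (auto intro: frame_fib[OF T])
    also have "\<dots> = (\<Sum>j<vrank A. if i = j then snd T p v i else 0)"
    proof (rule sum.cong[OF refl])
      fix j assume "j \<in> {..<vrank A}"
      then show "coframe A T j p v * snd T p (frame A T j p) i = (if i = j then snd T p v i else 0)"
        using coframe_frame[OF T, of j i] frame_fib[OF T, of j] v by (auto simp: coframe_def)
    qed
    \<comment> \<open>For i at or beyond the rank the sum is empty of nonzero terms, and the
      coordinate of v is 0 because the trivialisation lands in R^k.\<close>
    also have "\<dots> = snd T p v i"
      using bij_betw_apply[OF triv_bij[OF T] v] by (auto simp: topspace_Euclidean_space)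
    finally show ?thesis by simp
  qed
  then have "snd T p v = snd T p ?w" by (rule ext)
  then show ?thesis
    using bij_betw_imp_inj_on[OF triv_bij[OF T]] v w by (simp only: inj_on_eq_iff)
qed

lemma dual_expand:
  assumes T: "T \<in> trivs A" "p \<in> fst T" and v: "v \<in> fib A p" and \<xi>: "\<xi> \<in> dual_fib A p"
  shows "\<xi> v = (\<Sum>i<vrank A. coframe A T i p v * \<xi> (frame A T i p))"
proof -
  have "\<xi> v = \<xi> (\<Sum>i<vrank A. coframe A T i p v *\<^sub>R frame A T i p)"
    using fib_expand[OF T v] by simp
  also have "\<dots> = (\<Sum>i<vrank A. coframe A T i p v * \<xi> (frame A T i p))"
    by (rule linear_fun_on_sum[OF dual_fib_linear[OF \<xi>] fib_subspace]) (auto intro: frame_fib[OF T])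
  finally show ?thesis .
qed

lemma dual_fib_0: "(\<lambda>v. 0) \<in> dual_fib A p"
  by (intro dual_fibI linear_fun_onI) auto

lemma dual_fib_add: "\<xi> \<in> dual_fib A p \<Longrightarrow> \<eta> \<in> dual_fib A p \<Longrightarrow> (\<lambda>v. \<xi> v + \<eta> v) \<in> dual_fib A p"
  by (auto simp: dual_fib_def linear_fun_on_def algebra_simps)

lemma dual_fib_scale: "\<xi> \<in> dual_fib A p \<Longrightarrow> (\<lambda>v. c * \<xi> v) \<in> dual_fib A p"
  by (auto simp: dual_fib_def linear_fun_on_def algebra_simps)

lemma dual_fib_sum:
  "(\<And>i. i \<in> I \<Longrightarrow> \<xi> i \<in> dual_fib A p) \<Longrightarrow> (\<lambda>v. \<Sum>i\<in>I. c i * \<xi> i v) \<in> dual_fib A p"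
  by (induction I rule: infinite_finite_induct) (auto intro!: dual_fib_0 dual_fib_add dual_fib_scale)

lemma dual_fib_eqI:
  "\<xi> \<in> dual_fib A p \<Longrightarrow> \<eta> \<in> dual_fib A p \<Longrightarrow> (\<And>v. v \<in> fib A p \<Longrightarrow> \<xi> v = \<eta> v) \<Longrightarrow> \<xi> = \<eta>"
proof
  fix v
  assume "\<xi> \<in> dual_fib A p" "\<eta> \<in> dual_fib A p" "\<And>v. v \<in> fib A p \<Longrightarrow> \<xi> v = \<eta> v"
  then show "\<xi> v = \<eta> v" by (cases "v \<in> fib A p") (auto simp: dual_fib_def)
qed

text \<open>The coframe already separates the points of a fibre. Equalities of vectors are from here
  on tested on covectors, which is the form in which \<pi> supplies its information.\<close>

lemma fib_eqI:
  assumes "v \<in> fib A p" "w \<in> fib A p" "\<And>\<xi>. \<xi> \<in> dual_fib A p \<Longrightarrow> \<xi> v = \<xi> w"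
  shows "v = w"
proof -
  obtain T where T: "T \<in> trivs A" "p \<in> fst T" by (rule triv_exists)
  show ?thesis
    using fib_expand[OF T assms(1)] fib_expand[OF T assms(2)] assms(3)[OF coframe_dual[OF T]] by simp
qed

lemma dual_fib_expand:
  assumes T: "T \<in> trivs A" "p \<in> fst T" and \<xi>: "\<xi> \<in> dual_fib A p"
  shows "\<xi> = (\<lambda>v. \<Sum>i<vrank A. \<xi> (frame A T i p) * coframe A T i p v)"
  using dual_expand[OF T _ \<xi>]
  by (intro dual_fib_eqI[OF \<xi>] dual_fib_sum coframe_dual[OF T]) (simp add: mult.commute)

subsection \<open>Sections\<close>

lemma smooth_section_onI:
  "(\<And>p. p \<in> W \<Longrightarrow> X p \<in> fib A p) \<Longrightarrow>
   (\<And>T i. T \<in> trivs A \<Longrightarrow> i < vrank A \<Longrightarrow> smooth_on A (fst T \<inter> W) (\<lambda>p. coframe A T i p (X p))) \<Longrightarrow>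
   smooth_section_on A W X"
  by (simp add: smooth_section_on_def)

lemma
  assumes "smooth_section_on A W X"
  shows smooth_section_on_fib: "p \<in> W \<Longrightarrow> X p \<in> fib A p"
    and smooth_section_on_coframe:
      "T \<in> trivs A \<Longrightarrow> i < vrank A \<Longrightarrow> smooth_on A (fst T \<inter> W) (\<lambda>p. coframe A T i p (X p))"
  using assms by (auto simp: smooth_section_on_def)

lemma smooth_dual_section_onI:
  "(\<And>p. p \<in> W \<Longrightarrow> \<xi> p \<in> dual_fib A p) \<Longrightarrow>
   (\<And>T j. T \<in> trivs A \<Longrightarrow> j < vrank A \<Longrightarrow> smooth_on A (fst T \<inter> W) (\<lambda>p. \<xi> p (frame A T j p))) \<Longrightarrow>
   smooth_dual_section_on A W \<xi>"
  by (simp add: smooth_dual_section_on_def)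

lemma
  assumes "smooth_dual_section_on A W \<xi>"
  shows smooth_dual_section_on_fib: "p \<in> W \<Longrightarrow> \<xi> p \<in> dual_fib A p"
    and smooth_dual_section_on_frame:
      "T \<in> trivs A \<Longrightarrow> j < vrank A \<Longrightarrow> smooth_on A (fst T \<inter> W) (\<lambda>p. \<xi> p (frame A T j p))"
  using assms by (auto simp: smooth_dual_section_on_def)

lemma smooth_section_on_subset: "smooth_section_on A W X \<Longrightarrow> V \<subseteq> W \<Longrightarrow> smooth_section_on A V X"
  by (rule smooth_section_onI) (auto dest: smooth_section_on_fib smooth_section_on_coframe intro: smooth_on_subset)

lemma smooth_dual_section_on_subset:
  "smooth_dual_section_on A W \<xi> \<Longrightarrow> V \<subseteq> W \<Longrightarrow> smooth_dual_section_on A V \<xi>"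
  by (rule smooth_dual_section_onI) (auto dest: smooth_dual_section_on_fib smooth_dual_section_on_frame intro: smooth_on_subset)

lemma transition_smooth:
  "S \<in> trivs A \<Longrightarrow> T \<in> trivs A \<Longrightarrow> i < vrank A \<Longrightarrow> j < vrank A \<Longrightarrow>
   smooth_on A (fst S \<inter> fst T) (\<lambda>p. coframe A S i p (frame A T j p))"
  using vector_bundle unfolding vector_bundle_def by blast

lemma frame_section: "T \<in> trivs A \<Longrightarrow> j < vrank A \<Longrightarrow> smooth_section_on A (fst T) (frame A T j)"
  by (intro smooth_section_onI frame_fib transition_smooth)

lemma coframe_section: "T \<in> trivs A \<Longrightarrow> i < vrank A \<Longrightarrow> smooth_dual_section_on A (fst T) (coframe A T i)"
  using transition_smooth[of T _ i] by (intro smooth_dual_section_onI coframe_dual) (auto simp: Int_commute)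

text \<open>Over a trivialisation the pairing is the sum of products of the components, which are
  smooth by definition.\<close>

lemma smooth_pairing:
  assumes W: "open W" and X: "smooth_section_on A W X" and \<xi>: "smooth_dual_section_on A W \<xi>"
  shows "smooth_on A W (\<lambda>p. \<xi> p (X p))"
proof (rule smooth_on_local[OF _ W])
  fix q assume "q \<in> W"
  obtain T where T: "T \<in> trivs A" "q \<in> fst T" by (rule triv_exists)
  have oW: "open (fst T \<inter> W)" using triv_open[OF T(1)] W by auto
  have "smooth_on A (fst T \<inter> W) (\<lambda>p. \<Sum>i<vrank A. coframe A T i p (X p) * \<xi> p (frame A T i p))"
    by (intro smooth_on_sum smooth_on_mult oW smooth_section_on_coframe[OF X] smooth_dual_section_on_frame[OF \<xi>] T) auto
  then have "smooth_on A (fst T \<inter> W) (\<lambda>p. \<xi> p (X p))"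
    by (rule smooth_on_cong[OF oW, rotated])
       (use dual_expand[OF T(1)] smooth_section_on_fib[OF X] smooth_dual_section_on_fib[OF \<xi>] in simp)
  then show "\<exists>V. open V \<and> q \<in> V \<and> smooth_on A (V \<inter> W) (\<lambda>p. \<xi> p (X p))"
    using T triv_open by blast
qed

lemma section_fib: "X \<in> sections A \<Longrightarrow> X p \<in> fib A p"
  by (simp add: sections_def smooth_section_on_def)

lemma dual_section_fib: "\<xi> \<in> dual_sections A \<Longrightarrow> \<xi> p \<in> dual_fib A p"
  by (simp add: dual_sections_def smooth_dual_section_on_def)

lemma section_smooth_on: "X \<in> sections A \<Longrightarrow> smooth_section_on A W X"
  by (auto simp: sections_def intro: smooth_section_on_subset)

lemma dual_section_smooth_on: "\<xi> \<in> dual_sections A \<Longrightarrow> smooth_dual_section_on A W \<xi>"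
  by (auto simp: dual_sections_def intro: smooth_dual_section_on_subset)

lemma pair_sec_smooth: "\<xi> \<in> dual_sections A \<Longrightarrow> X \<in> sections A \<Longrightarrow> smooth_fun A (pair_sec \<xi> X)"
  unfolding pair_sec_def by (intro smooth_pairing section_smooth_on dual_section_smooth_on open_UNIV)

lemma smooth_section_on_add:
  assumes "open W" "smooth_section_on A W X" "smooth_section_on A W Y"
  shows "smooth_section_on A W (\<lambda>p. X p + Y p)"
proof (rule smooth_section_onI)
  fix T i assume T: "T \<in> trivs A" "i < vrank A"
  have "smooth_on A (fst T \<inter> W) (\<lambda>p. coframe A T i p (X p) + coframe A T i p (Y p))"
    using assms T triv_open[OF T(1)] by (intro smooth_on_add smooth_section_on_coframe) auto
  then show "smooth_on A (fst T \<inter> W) (\<lambda>p. coframe A T i p (X p + Y p))"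
    by (rule smooth_on_cong[rotated 2])
      (use assms T open_Int[OF triv_open[OF T(1)]] linear_fun_on_add[OF dual_fib_linear[OF coframe_dual]] smooth_section_on_fib in auto)
qed (use assms fib_add smooth_section_on_fib in auto)

lemma smooth_section_on_scale:
  assumes "open W" "smooth_on A W f" "smooth_section_on A W X"
  shows "smooth_section_on A W (\<lambda>p. f p *\<^sub>R X p)"
proof (rule smooth_section_onI)
  fix T i assume T: "T \<in> trivs A" "i < vrank A"
  have "smooth_on A (fst T \<inter> W) (\<lambda>p. f p * coframe A T i p (X p))"
    using assms T triv_open[OF T(1)] by (intro smooth_on_mult smooth_section_on_coframe) (auto intro: smooth_on_subset)
  then show "smooth_on A (fst T \<inter> W) (\<lambda>p. coframe A T i p (f p *\<^sub>R X p))"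
    by (rule smooth_on_cong[rotated 2])
      (use assms T open_Int[OF triv_open[OF T(1)]] linear_fun_on_scale[OF dual_fib_linear[OF coframe_dual]] smooth_section_on_fib in auto)
qed (use assms fib_scale smooth_section_on_fib in auto)

lemma smooth_section_on_zero: "open W \<Longrightarrow> smooth_section_on A W (\<lambda>p. 0)"
proof (rule smooth_section_onI)
  fix T i assume W: "open W" and T: "T \<in> trivs A" "i < vrank A"
  show "smooth_on A (fst T \<inter> W) (\<lambda>p. coframe A T i p 0)"
    by (rule smooth_on_cong[OF _ _ smooth_on_const[of _ 0]])
      (use W T open_Int[OF triv_open[OF T(1)]] linear_fun_on_zero[OF dual_fib_linear[OF coframe_dual]] in auto)
qed simp

lemma smooth_section_on_sum:
  "open W \<Longrightarrow> (\<And>i. i \<in> I \<Longrightarrow> smooth_section_on A W (X i)) \<Longrightarrow> smooth_section_on A W (\<lambda>p. \<Sum>i\<in>I. X i p)"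
  by (induction I rule: infinite_finite_induct) (auto intro: smooth_section_on_zero smooth_section_on_add)

lemma smooth_dual_section_on_add:
  "open W \<Longrightarrow> smooth_dual_section_on A W \<xi> \<Longrightarrow> smooth_dual_section_on A W \<eta> \<Longrightarrow>
   smooth_dual_section_on A W (\<lambda>p v. \<xi> p v + \<eta> p v)"
  by (rule smooth_dual_section_onI)
     (simp_all add: dual_fib_add smooth_dual_section_on_fib smooth_on_add smooth_dual_section_on_frame
       open_Int triv_open)

lemma smooth_dual_section_on_scale:
  "open W \<Longrightarrow> smooth_on A W f \<Longrightarrow> smooth_dual_section_on A W \<xi> \<Longrightarrow>
   smooth_dual_section_on A W (\<lambda>p v. f p * \<xi> p v)"
  by (rule smooth_dual_section_onI)
     (simp_all add: dual_fib_scale smooth_dual_section_on_fib smooth_on_mult smooth_dual_section_on_frame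
       open_Int triv_open smooth_on_subset[of W f])

lemma smooth_dual_section_on_zero: "smooth_dual_section_on A W (\<lambda>p v. 0)"
  by (auto intro!: smooth_dual_section_onI dual_fib_0 smooth_on_const)

lemma smooth_dual_section_on_sum:
  "open W \<Longrightarrow> (\<And>i. i \<in> I \<Longrightarrow> smooth_dual_section_on A W (\<xi> i)) \<Longrightarrow>
   smooth_dual_section_on A W (\<lambda>p v. \<Sum>i\<in>I. \<xi> i p v)"
  by (induction I rule: infinite_finite_induct) (auto intro: smooth_dual_section_on_zero smooth_dual_section_on_add)

lemma sections_zero: "(\<lambda>p. 0) \<in> sections A"
  unfolding sections_def by (simp add: smooth_section_on_zero)

lemma sections_add: "X \<in> sections A \<Longrightarrow> Y \<in> sections A \<Longrightarrow> (\<lambda>p. X p + Y p) \<in> sections A"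
  unfolding sections_def by (simp add: smooth_section_on_add)

lemma sections_scale: "smooth_fun A f \<Longrightarrow> X \<in> sections A \<Longrightarrow> (\<lambda>p. f p *\<^sub>R X p) \<in> sections A"
  unfolding sections_def by (simp add: smooth_section_on_scale)

lemma sections_cscale: "X \<in> sections A \<Longrightarrow> (\<lambda>p. c *\<^sub>R X p) \<in> sections A"
  by (rule sections_scale[OF smooth_on_const])

lemma sections_diff: "X \<in> sections A \<Longrightarrow> Y \<in> sections A \<Longrightarrow> (\<lambda>p. X p - Y p) \<in> sections A"
  using sections_add[OF _ sections_cscale[of Y "- 1"], of X] by simp

lemma sections_sum: "(\<And>i. i \<in> I \<Longrightarrow> X i \<in> sections A) \<Longrightarrow> (\<lambda>p. \<Sum>i\<in>I. X i p) \<in> sections A"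
  unfolding sections_def by (simp add: smooth_section_on_sum)

lemma dual_sections_diff:
  assumes "\<xi> \<in> dual_sections A" "\<eta> \<in> dual_sections A"
  shows "(\<lambda>p v. \<xi> p v - \<eta> p v) \<in> dual_sections A"
  using smooth_dual_section_on_add[OF open_UNIV, of \<xi> "\<lambda>p v. (- 1) * \<eta> p v"]
    smooth_dual_section_on_scale[OF open_UNIV smooth_on_const, of \<eta> "- 1"] assms
  by (simp add: dual_sections_def)

text \<open>Outside W the values of X are arbitrary, but h is 0 there; each component of the product
  is smooth on the part over W and 0 off K.\<close>

lemma section_extend:
  assumes "open W" "smooth_section_on A W X" "smooth_fun A h" "closed K" "K \<subseteq> W" "\<And>q. q \<notin> K \<Longrightarrow> h q = 0"
  shows "(\<lambda>p. h p *\<^sub>R X p) \<in> sections A"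
  unfolding sections_def mem_Collect_eq
proof (rule smooth_section_onI)
  show fib: "h p *\<^sub>R X p \<in> fib A p" for p
    by (cases "p \<in> K") (use assms smooth_section_on_fib[OF assms(2)] in \<open>auto intro: fib_scale\<close>)
  fix T i assume T: "T \<in> trivs A" "i < vrank A"
  have "smooth_section_on A W (\<lambda>p. h p *\<^sub>R X p)"
    using assms by (intro smooth_section_on_scale) (auto intro: smooth_on_subset)
  then have W: "smooth_on A (fst T \<inter> W) (\<lambda>p. coframe A T i p (h p *\<^sub>R X p))"
    by (rule smooth_section_on_coframe[OF _ T])
  have "smooth_on A (fst T) (\<lambda>p. coframe A T i p (h p *\<^sub>R X p))"
    by (rule smooth_on_extend[OF triv_open[OF T(1)] assms(1,4,5) W])
      (simp add: assms(6) linear_fun_on_zero[OF dual_fib_linear[OF coframe_dual[OF T(1)]]])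
  then show "smooth_on A (fst T \<inter> UNIV) (\<lambda>p. coframe A T i p (h p *\<^sub>R X p))" by simp
qed

lemma dual_section_extend:
  assumes "open W" "smooth_dual_section_on A W \<xi>" "smooth_fun A h" "closed K" "K \<subseteq> W" "\<And>q. q \<notin> K \<Longrightarrow> h q = 0"
  shows "(\<lambda>p v. h p * \<xi> p v) \<in> dual_sections A"
  unfolding dual_sections_def mem_Collect_eq
proof (rule smooth_dual_section_onI)
  show "(\<lambda>v. h p * \<xi> p v) \<in> dual_fib A p" for p
    by (cases "p \<in> K")
      (use assms smooth_dual_section_on_fib[OF assms(2)] in \<open>auto intro: dual_fib_scale dual_fib_0\<close>)
  fix T i assume T: "T \<in> trivs A" "i < vrank A"
  have "smooth_dual_section_on A W (\<lambda>p v. h p * \<xi> p v)"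
    using assms by (intro smooth_dual_section_on_scale) (auto intro: smooth_on_subset)
  then have W: "smooth_on A (fst T \<inter> W) (\<lambda>p. h p * \<xi> p (frame A T i p))"
    by (rule smooth_dual_section_on_frame[OF _ T])
  have "smooth_on A (fst T) (\<lambda>p. h p * \<xi> p (frame A T i p))"
    by (rule smooth_on_extend[OF triv_open[OF T(1)] assms(1,4,5) W]) (simp add: assms(6))
  then show "smooth_on A (fst T \<inter> UNIV) (\<lambda>p. h p * \<xi> p (frame A T i p))" by simp
qed

text \<open>A local section such as a frame field cannot be inserted into the bracket. Cutting it
  off gives a global section with the same germ at p.\<close>

lemma section_germ:
  assumes "open W" "p \<in> W" "smooth_section_on A W X"
  obtains X' V where "X' \<in> sections A" "open V" "p \<in> V" "V \<subseteq> W" "\<And>q. q \<in> V \<Longrightarrow> X' q = X q"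
proof -
  obtain h V K where h: "smooth_fun A h" "open V" "p \<in> V" "V \<subseteq> K" "closed K" "K \<subseteq> W"
    "\<And>q. q \<in> V \<Longrightarrow> h q = 1" "\<And>q. q \<notin> K \<Longrightarrow> h q = 0" by (rule bump_exists[OF assms(1,2)]) blast
  show ?thesis
    by (rule that[of "\<lambda>p. h p *\<^sub>R X p" V]) (use h section_extend[OF assms(1,3) h(1,5,6,8)] in auto)
qed

lemma dual_section_germ:
  assumes "open W" "p \<in> W" "smooth_dual_section_on A W \<xi>"
  obtains \<xi>' V where "\<xi>' \<in> dual_sections A" "open V" "p \<in> V" "V \<subseteq> W" "\<And>q. q \<in> V \<Longrightarrow> \<xi>' q = \<xi> q"
proof -
  obtain h V K where h: "smooth_fun A h" "open V" "p \<in> V" "V \<subseteq> K" "closed K" "K \<subseteq> W"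
    "\<And>q. q \<in> V \<Longrightarrow> h q = 1" "\<And>q. q \<notin> K \<Longrightarrow> h q = 0" by (rule bump_exists[OF assms(1,2)]) blast
  show ?thesis
    by (rule that[of "\<lambda>p v. h p * \<xi> p v" V]) (use h dual_section_extend[OF assms(1,3) h(1,5,6,8)] in auto)
qed

text \<open>Constant coefficients in a frame, cut off near p, prescribe the value at p. Identities
  between sections thereby become identities in each fibre, and conversely.\<close>

lemma section_through:
  assumes "v \<in> fib A p"
  obtains X where "X \<in> sections A" "X p = v"
proof -
  obtain T where T: "T \<in> trivs A" "p \<in> fst T" by (rule triv_exists)
  have "smooth_section_on A (fst T) (\<lambda>q. \<Sum>i<vrank A. coframe A T i p v *\<^sub>R frame A T i q)"
    by (intro smooth_section_on_sum smooth_section_on_scale smooth_on_const frame_section triv_open T) auto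
  then obtain X V where X: "X \<in> sections A" "p \<in> V"
    "\<And>q. q \<in> V \<Longrightarrow> X q = (\<Sum>i<vrank A. coframe A T i p v *\<^sub>R frame A T i q)"
    by (rule section_germ[OF triv_open[OF T(1)] T(2)]) blast
  show ?thesis by (rule that[OF X(1)]) (subst X(3)[OF X(2)], rule fib_expand[OF T assms, symmetric])
qed

lemma dual_section_through:
  assumes "\<xi> \<in> dual_fib A p"
  obtains \<eta> where "\<eta> \<in> dual_sections A" "\<eta> p = \<xi>"
proof -
  obtain T where T: "T \<in> trivs A" "p \<in> fst T" by (rule triv_exists)
  have "smooth_dual_section_on A (fst T) (\<lambda>q v. \<Sum>i<vrank A. \<xi> (frame A T i p) * coframe A T i q v)"
    by (intro smooth_dual_section_on_sum smooth_dual_section_on_scale smooth_on_const coframe_section triv_open T) auto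
  then obtain \<eta> V where \<eta>: "\<eta> \<in> dual_sections A" "p \<in> V"
    "\<And>q. q \<in> V \<Longrightarrow> \<eta> q = (\<lambda>v. \<Sum>i<vrank A. \<xi> (frame A T i p) * coframe A T i q v)"
    by (rule dual_section_germ[OF triv_open[OF T(1)] T(2)]) blast
  show ?thesis by (rule that[OF \<eta>(1)]) (subst \<eta>(3)[OF \<eta>(2)], rule dual_fib_expand[OF T assms, symmetric])
qed

lemma dual_section_eqI:
  assumes "\<xi> \<in> dual_sections A" "\<eta> \<in> dual_sections A" "\<And>Z. Z \<in> sections A \<Longrightarrow> pair_sec \<xi> Z = pair_sec \<eta> Z"
  shows "\<xi> = \<eta>"
proof
  fix p
  show "\<xi> p = \<eta> p"
  proof (rule dual_fib_eqI)
    fix v assume "v \<in> fib A p"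
    then obtain Z where Z: "Z \<in> sections A" "Z p = v" by (rule section_through)
    show "\<xi> p v = \<eta> p v" using fun_cong[OF assms(3)[OF Z(1)], of p] Z(2) by (simp add: pair_sec_def)
  qed (use assms dual_section_fib in auto)
qed

section \<open>Bivectors and the induced map from covectors to vectors\<close>

lemma
  assumes "bivector A \<pi>" "\<xi> \<in> dual_fib A p" "\<eta> \<in> dual_fib A p" "\<zeta> \<in> dual_fib A p"
  shows bivector_add: "\<pi> p (\<lambda>v. \<xi> v + \<eta> v) \<zeta> = \<pi> p \<xi> \<zeta> + \<pi> p \<eta> \<zeta>"
    and bivector_scale: "\<pi> p (\<lambda>v. c * \<xi> v) \<zeta> = c * \<pi> p \<xi> \<zeta>"
    and bivector_skew: "\<pi> p \<xi> \<eta> = - \<pi> p \<eta> \<xi>"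
  using assms unfolding bivector_def by blast+

lemma bivector_zero: "bivector A \<pi> \<Longrightarrow> \<zeta> \<in> dual_fib A p \<Longrightarrow> \<pi> p (\<lambda>v. 0) \<zeta> = 0"
  using bivector_scale[of \<pi> "\<lambda>v. 0" p "\<lambda>v. 0" \<zeta> 0] dual_fib_0 by simp

lemma bivector_sum:
  assumes "bivector A \<pi>" "\<zeta> \<in> dual_fib A p" "\<And>i. i \<in> I \<Longrightarrow> \<xi> i \<in> dual_fib A p"
  shows "\<pi> p (\<lambda>v. \<Sum>i\<in>I. c i * \<xi> i v) \<zeta> = (\<Sum>i\<in>I. c i * \<pi> p (\<xi> i) \<zeta>)"
  using assms(3)
proof (induction I rule: infinite_finite_induct)
  case (insert i I)
  have "(\<lambda>v. c i * \<xi> i v) \<in> dual_fib A p" using insert.prems by (simp add: dual_fib_scale)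
  moreover have "(\<lambda>v. \<Sum>i\<in>I. c i * \<xi> i v) \<in> dual_fib A p" using insert.prems by (simp add: dual_fib_sum)
  ultimately have "\<pi> p (\<lambda>v. c i * \<xi> i v + (\<Sum>i\<in>I. c i * \<xi> i v)) \<zeta>
      = \<pi> p (\<lambda>v. c i * \<xi> i v) \<zeta> + \<pi> p (\<lambda>v. \<Sum>i\<in>I. c i * \<xi> i v) \<zeta>"
    using bivector_add[OF assms(1) _ _ assms(2)] by blast
  moreover have "\<pi> p (\<lambda>v. c i * \<xi> i v) \<zeta> = c i * \<pi> p (\<xi> i) \<zeta>"
    using insert.prems bivector_scale[OF assms(1) _ assms(2,2)] by simp
  ultimately show ?case using insert by simp
qed (use assms bivector_zero in simp_all)

text \<open>\<open>sharp\<close> is a definite description. The vector with components \<pi>(\<xi>,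
  e^i) in the frame has the required pairings, by expanding \<eta> in the coframe; it is unique
  since covectors separate points. This is where finite rank identifies a fibre with its
  bidual.\<close>

lemma
  assumes \<pi>: "bivector A \<pi>" and \<xi>: "\<xi> \<in> dual_fib A p"
  shows sharp_fib: "sharp A \<pi> p \<xi> \<in> fib A p"
    and pair_sharp: "\<eta> \<in> dual_fib A p \<Longrightarrow> \<eta> (sharp A \<pi> p \<xi>) = \<pi> p \<xi> \<eta>"
proof -
  obtain T where T: "T \<in> trivs A" "p \<in> fst T" by (rule triv_exists)
  define v where "v = (\<Sum>i<vrank A. \<pi> p \<xi> (coframe A T i p) *\<^sub>R frame A T i p)"
  have v: "v \<in> fib A p" unfolding v_def by (intro fib_sum fib_scale frame_fib T) auto
  have *: "\<eta> v = \<pi> p \<xi> \<eta>" if \<eta>: "\<eta> \<in> dual_fib A p" for \<eta>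
  proof -
    have "\<eta> v = (\<Sum>i<vrank A. \<pi> p \<xi> (coframe A T i p) * \<eta> (frame A T i p))"
      unfolding v_def by (rule linear_fun_on_sum[OF dual_fib_linear[OF \<eta>] fib_subspace]) (auto intro: frame_fib T)
    also have "\<dots> = - (\<Sum>i<vrank A. \<eta> (frame A T i p) * \<pi> p (coframe A T i p) \<xi>)"
      unfolding sum_negf[symmetric]
      using bivector_skew[OF \<pi> \<xi> coframe_dual[OF T] \<xi>] by (intro sum.cong) auto
    also have "\<dots> = - \<pi> p (\<lambda>v. \<Sum>i<vrank A. \<eta> (frame A T i p) * coframe A T i p v) \<xi>"
      by (subst bivector_sum[OF \<pi> \<xi>]) (auto intro: coframe_dual T)
    also have "\<dots> = \<pi> p \<xi> \<eta>"
      using dual_fib_expand[OF T \<eta>] bivector_skew[OF \<pi> \<xi> \<eta> \<eta>] by simp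
    finally show ?thesis .
  qed
  have "sharp A \<pi> p \<xi> = v"
    unfolding sharp_def
  proof (rule the_equality)
    show "v \<in> fib A p \<and> (\<forall>\<eta>\<in>dual_fib A p. \<eta> v = \<pi> p \<xi> \<eta>)" using v * by simp
    show "w = v" if "w \<in> fib A p \<and> (\<forall>\<eta>\<in>dual_fib A p. \<eta> w = \<pi> p \<xi> \<eta>)" for w
      using that v * by (intro fib_eqI[of w p v]) auto
  qed
  then show "sharp A \<pi> p \<xi> \<in> fib A p" "\<eta> \<in> dual_fib A p \<Longrightarrow> \<eta> (sharp A \<pi> p \<xi>) = \<pi> p \<xi> \<eta>"
    using v * by auto
qed

lemma sharp_skew:
  assumes "bivector A \<pi>" "\<xi> \<in> dual_fib A p" "\<eta> \<in> dual_fib A p"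
  shows "\<eta> (sharp A \<pi> p \<xi>) = - \<xi> (sharp A \<pi> p \<eta>)"
  using assms by (simp add: pair_sharp bivector_skew[of \<pi> \<xi> p \<eta> \<eta>])

lemma sharp_add:
  assumes "bivector A \<pi>" "\<xi> \<in> dual_fib A p" "\<eta> \<in> dual_fib A p"
  shows "sharp A \<pi> p (\<lambda>v. \<xi> v + \<eta> v) = sharp A \<pi> p \<xi> + sharp A \<pi> p \<eta>"
  by (rule fib_eqI[of _ p])
    (use assms in \<open>auto intro!: sharp_fib dual_fib_add fib_add
       simp: pair_sharp dual_fib_add bivector_add linear_fun_on_add[OF dual_fib_linear] sharp_fib\<close>)

lemma sharp_scale:
  assumes "bivector A \<pi>" "\<xi> \<in> dual_fib A p"
  shows "sharp A \<pi> p (\<lambda>v. c * \<xi> v) = c *\<^sub>R sharp A \<pi> p \<xi>"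
  by (rule fib_eqI[of _ p])
    (use assms bivector_scale[OF assms(1,2,2)] in \<open>auto intro!: sharp_fib dual_fib_scale fib_scale
       simp: pair_sharp dual_fib_scale linear_fun_on_scale[OF dual_fib_linear] sharp_fib\<close>)

lemma sharp_sum:
  assumes "bivector A \<pi>" "\<And>i. i \<in> I \<Longrightarrow> \<xi> i \<in> dual_fib A p"
  shows "sharp A \<pi> p (\<lambda>v. \<Sum>i\<in>I. c i * \<xi> i v) = (\<Sum>i\<in>I. c i *\<^sub>R sharp A \<pi> p (\<xi> i))"
proof (rule fib_eqI[of _ p])
  show "sharp A \<pi> p (\<lambda>v. \<Sum>i\<in>I. c i * \<xi> i v) \<in> fib A p"
    by (intro sharp_fib dual_fib_sum assms)
  show "(\<Sum>i\<in>I. c i *\<^sub>R sharp A \<pi> p (\<xi> i)) \<in> fib A p"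
    by (intro fib_sum fib_scale sharp_fib assms)
  fix \<eta> assume \<eta>: "\<eta> \<in> dual_fib A p"
  have "\<eta> (\<Sum>i\<in>I. c i *\<^sub>R sharp A \<pi> p (\<xi> i)) = (\<Sum>i\<in>I. c i * \<eta> (sharp A \<pi> p (\<xi> i)))"
    by (rule linear_fun_on_sum[OF dual_fib_linear[OF \<eta>] fib_subspace]) (intro sharp_fib assms)
  also have "\<dots> = (\<Sum>i\<in>I. c i * \<pi> p (\<xi> i) \<eta>)"
    using pair_sharp[OF assms(1) assms(2) \<eta>] by (intro sum.cong) auto
  also have "\<dots> = \<eta> (sharp A \<pi> p (\<lambda>v. \<Sum>i\<in>I. c i * \<xi> i v))"
    by (subst pair_sharp[OF assms(1) dual_fib_sum \<eta>])
      (auto simp: assms(2) bivector_sum[OF assms(1) \<eta>])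
  finally show "\<eta> (sharp A \<pi> p (\<lambda>v. \<Sum>i\<in>I. c i * \<xi> i v)) = \<eta> (\<Sum>i\<in>I. c i *\<^sub>R sharp A \<pi> p (\<xi> i))" ..
qed

lemma sharp_zero: "bivector A \<pi> \<Longrightarrow> sharp A \<pi> p (\<lambda>v. 0) = 0"
  using sharp_scale[of \<pi> "\<lambda>v. 0" p 0] dual_fib_0 by simp

lemma sharp_smooth:
  assumes \<pi>: "bivector A \<pi>" and W: "open W" and \<xi>: "smooth_dual_section_on A W \<xi>"
  shows "smooth_section_on A W (\<lambda>p. sharp A \<pi> p (\<xi> p))"
proof (rule smooth_section_onI)
  fix p assume "p \<in> W"
  then show "sharp A \<pi> p (\<xi> p) \<in> fib A p" using sharp_fib[OF \<pi>] smooth_dual_section_on_fib[OF \<xi>] by blast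
next
  fix T i assume T: "T \<in> trivs A" and i: "i < vrank A"
  have oW: "open (fst T \<inter> W)" using triv_open[OF T] W by auto
  have \<pi>T: "smooth_on A (fst T \<inter> W) (\<lambda>p. \<pi> p (coframe A T j p) (coframe A T i p))" if "j < vrank A" for j
    by (rule smooth_on_subset[of "fst T"]) (use \<pi> T i that in \<open>auto simp: bivector_def\<close>)
  have "smooth_on A (fst T \<inter> W)
      (\<lambda>p. \<Sum>j<vrank A. \<xi> p (frame A T j p) * \<pi> p (coframe A T j p) (coframe A T i p))"
    by (intro smooth_on_sum smooth_on_mult oW smooth_dual_section_on_frame[OF \<xi> T] \<pi>T) auto
  then show "smooth_on A (fst T \<inter> W) (\<lambda>p. coframe A T i p (sharp A \<pi> p (\<xi> p)))"
  proof (rule smooth_on_cong[OF oW, rotated])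
    fix p assume p: "p \<in> fst T \<inter> W"
    have \<xi>p: "\<xi> p \<in> dual_fib A p" using smooth_dual_section_on_fib[OF \<xi>] p by blast
    have "coframe A T i p (sharp A \<pi> p (\<xi> p)) = \<pi> p (\<xi> p) (coframe A T i p)"
      using p T by (intro pair_sharp[OF \<pi> \<xi>p] coframe_dual) auto
    also have "\<dots> = \<pi> p (\<lambda>v. \<Sum>j<vrank A. \<xi> p (frame A T j p) * coframe A T j p v) (coframe A T i p)"
      using dual_fib_expand[OF T _ \<xi>p] p by simp
    also have "\<dots> = (\<Sum>j<vrank A. \<xi> p (frame A T j p) * \<pi> p (coframe A T j p) (coframe A T i p))"
      using p T by (intro bivector_sum[OF \<pi>] coframe_dual) auto
    finally show "(\<Sum>j<vrank A. \<xi> p (frame A T j p) * \<pi> p (coframe A T j p) (coframe A T i p))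
      = coframe A T i p (sharp A \<pi> p (\<xi> p))" ..
  qed
qed

lemma sharp_sections:
  "bivector A \<pi> \<Longrightarrow> \<xi> \<in> dual_sections A \<Longrightarrow> (\<lambda>p. sharp A \<pi> p (\<xi> p)) \<in> sections A"
  using sharp_smooth[OF _ open_UNIV] by (simp add: sections_def dual_sections_def)

section \<open>Two-forms and bundle maps into the dual\<close>

lemma
  assumes "form2 A \<omega>" "x \<in> fib A p" "y \<in> fib A p"
  shows form2_linear: "linear_fun_on (fib A p) (\<lambda>v. \<omega> p v y)"
    and form2_skew: "\<omega> p x y = - \<omega> p y x"
  using assms unfolding form2_def by blast+

lemma flat_apply: "y \<in> fib A p \<Longrightarrow> flat A \<omega> p x y = - \<omega> p x y"
  by (simp add: flat_def)

lemma form2_linear_right: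
  assumes "form2 A \<omega>" "x \<in> fib A p"
  shows "linear_fun_on (fib A p) (\<omega> p x)"
proof -
  have "linear_fun_on (fib A p) (\<lambda>v. \<omega> p v x)" using form2_linear[OF assms assms(2)] .
  then show ?thesis
    using form2_skew[OF assms] by (auto simp: linear_fun_on_def fib_add fib_scale)
qed

lemma flat_dual: "form2 A \<omega> \<Longrightarrow> x \<in> fib A p \<Longrightarrow> flat A \<omega> p x \<in> dual_fib A p"
  using form2_linear_right[of \<omega> x p]
  by (intro dual_fibI) (auto simp: flat_def linear_fun_on_def fib_add fib_scale)

lemma flat_skew: "form2 A \<omega> \<Longrightarrow> x \<in> fib A p \<Longrightarrow> y \<in> fib A p \<Longrightarrow> flat A \<omega> p x y = - flat A \<omega> p y x"
  using form2_skew[of \<omega> x p y] by (simp add: flat_apply)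

lemma flat_linear:
  assumes "form2 A \<omega>" "y \<in> fib A p"
  shows "linear_fun_on (fib A p) (\<lambda>x. flat A \<omega> p x y)"
  using form2_linear[OF assms assms(2)] assms(2) by (simp add: flat_def linear_fun_on_def)

lemma flat_add:
  assumes "form2 A \<omega>" "x \<in> fib A p" "y \<in> fib A p"
  shows "flat A \<omega> p (x + y) = (\<lambda>v. flat A \<omega> p x v + flat A \<omega> p y v)"
  by (rule dual_fib_eqI[of _ p])
    (use assms linear_fun_on_add[OF flat_linear] in \<open>auto intro!: flat_dual dual_fib_add fib_add\<close>)

lemma flat_scale:
  assumes "form2 A \<omega>" "x \<in> fib A p"
  shows "flat A \<omega> p (c *\<^sub>R x) = (\<lambda>v. c * flat A \<omega> p x v)"
  by (rule dual_fib_eqI[of _ p])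
    (use assms linear_fun_on_scale[OF flat_linear] in \<open>auto intro!: flat_dual dual_fib_scale fib_scale\<close>)

text \<open>Stated for general bundle maps because it serves twice: for \<open>flat\<close> of a
  2-form and for the inverse of a non-degenerate bivector.\<close>

lemma bundle_map_smooth:
  assumes F: "smooth_bundle_map_to_dual A F" and W: "open W" and X: "smooth_section_on A W X"
  shows "smooth_dual_section_on A W (\<lambda>p. F p (X p))"
proof (rule smooth_dual_section_onI)
  fix p assume "p \<in> W"
  then show "F p (X p) \<in> dual_fib A p"
    using F smooth_section_on_fib[OF X] by (simp add: smooth_bundle_map_to_dual_def)
next
  fix T j assume T: "T \<in> trivs A" and j: "j < vrank A"
  have oW: "open (fst T \<inter> W)" using triv_open[OF T] W by auto
  have FT: "smooth_on A (fst T \<inter> W) (\<lambda>p. F p (frame A T i p) (frame A T j p))" if "i < vrank A" for i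
    by (rule smooth_on_subset[of "fst T"]) (use F T j that in \<open>auto simp: smooth_bundle_map_to_dual_def\<close>)
  have "smooth_on A (fst T \<inter> W)
      (\<lambda>p. \<Sum>i<vrank A. coframe A T i p (X p) * F p (frame A T i p) (frame A T j p))"
    by (intro smooth_on_sum smooth_on_mult oW smooth_section_on_coframe[OF X T] FT) auto
  then show "smooth_on A (fst T \<inter> W) (\<lambda>p. F p (X p) (frame A T j p))"
  proof (rule smooth_on_cong[OF oW, rotated])
    fix p assume p: "p \<in> fst T \<inter> W"
    then have T': "p \<in> fst T" by simp
    have Xp: "X p \<in> fib A p" using smooth_section_on_fib[OF X] p by blast
    have ej: "frame A T j p \<in> fib A p" by (rule frame_fib[OF T T' j])
    have l: "linear_fun_on (fib A p) (\<lambda>x. F p x (frame A T j p))"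
      using F ej by (simp add: smooth_bundle_map_to_dual_def)
    have "F p (X p) (frame A T j p) = F p (\<Sum>i<vrank A. coframe A T i p (X p) *\<^sub>R frame A T i p) (frame A T j p)"
      using fib_expand[OF T T' Xp] by simp
    also have "\<dots> = (\<Sum>i<vrank A. coframe A T i p (X p) * F p (frame A T i p) (frame A T j p))"
      by (subst linear_fun_on_sum[OF l fib_subspace]) (auto intro: frame_fib T T')
    finally show "(\<Sum>i<vrank A. coframe A T i p (X p) * F p (frame A T i p) (frame A T j p))
      = F p (X p) (frame A T j p)" ..
  qed
qed

lemma bundle_map_sections:
  "smooth_bundle_map_to_dual A F \<Longrightarrow> X \<in> sections A \<Longrightarrow> (\<lambda>p. F p (X p)) \<in> dual_sections A"
  using bundle_map_smooth[OF _ open_UNIV] by (simp add: sections_def dual_sections_def)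

lemma flat_bundle_map:
  assumes "form2 A \<omega>"
  shows "smooth_bundle_map_to_dual A (flat A \<omega>)"
  unfolding smooth_bundle_map_to_dual_def
proof (intro conjI ballI allI impI)
  fix T i j assume T: "T \<in> trivs A" and ij: "i < vrank A" "j < vrank A"
  have "smooth_on A (fst T) (\<lambda>p. - \<omega> p (frame A T i p) (frame A T j p))"
    using assms T ij by (intro smooth_on_minus triv_open) (auto simp: form2_def)
  then show "smooth_on A (fst T) (\<lambda>p. flat A \<omega> p (frame A T i p) (frame A T j p))"
    by (rule smooth_on_cong[OF triv_open[OF T], rotated]) (simp add: flat_apply frame_fib T ij)
qed (use assms in \<open>simp_all add: flat_dual flat_linear\<close>)

lemma flat_smooth:
  "form2 A \<omega> \<Longrightarrow> open W \<Longrightarrow> smooth_section_on A W X \<Longrightarrow> smooth_dual_section_on A W (\<lambda>p. flat A \<omega> p (X p))"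
  by (rule bundle_map_smooth[OF flat_bundle_map])

lemma flat_sections:
  "form2 A \<omega> \<Longrightarrow> X \<in> sections A \<Longrightarrow> (\<lambda>p. flat A \<omega> p (X p)) \<in> dual_sections A"
  by (rule bundle_map_sections[OF flat_bundle_map])

lemma flat_sum:
  assumes "form2 A \<omega>" "\<And>i. i \<in> I \<Longrightarrow> x i \<in> fib A p"
  shows "flat A \<omega> p (\<Sum>i\<in>I. c i *\<^sub>R x i) = (\<lambda>v. \<Sum>i\<in>I. c i * flat A \<omega> p (x i) v)"
proof (rule dual_fib_eqI[of _ p])
  show "flat A \<omega> p (\<Sum>i\<in>I. c i *\<^sub>R x i) \<in> dual_fib A p"
    by (intro flat_dual fib_sum fib_scale assms)
  show "(\<lambda>v. \<Sum>i\<in>I. c i * flat A \<omega> p (x i) v) \<in> dual_fib A p"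
    by (intro dual_fib_sum flat_dual assms)
  fix v assume "v \<in> fib A p"
  then show "flat A \<omega> p (\<Sum>i\<in>I. c i *\<^sub>R x i) v = (\<Sum>i\<in>I. c i * flat A \<omega> p (x i) v)"
    using linear_fun_on_sum[OF flat_linear[OF assms(1)] fib_subspace] assms(2) by blast
qed

subsection \<open>Tensorial functionals\<close>

context
  fixes F :: "('m \<Rightarrow> 'a) \<Rightarrow> 'm \<Rightarrow> real"
  assumes F_smooth: "\<And>Z. Z \<in> sections A \<Longrightarrow> smooth_fun A (F Z)"
    and F_add: "\<And>Y Z. Y \<in> sections A \<Longrightarrow> Z \<in> sections A \<Longrightarrow> F (\<lambda>p. Y p + Z p) = (\<lambda>p. F Y p + F Z p)"
    and F_scale: "\<And>f Z. smooth_fun A f \<Longrightarrow> Z \<in> sections A \<Longrightarrow> F (\<lambda>p. f p *\<^sub>R Z p) = (\<lambda>p. f p * F Z p)"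
begin

lemma tensorial_zero: "F (\<lambda>p. 0) = (\<lambda>p. 0)"
  using F_scale[OF smooth_on_const[of _ 0] sections_zero] by simp

lemma tensorial_sum:
  assumes "\<And>i. i \<in> I \<Longrightarrow> Z i \<in> sections A"
  shows "F (\<lambda>p. \<Sum>i\<in>I. Z i p) = (\<lambda>p. \<Sum>i\<in>I. F (Z i) p)"
  using assms
proof (induction I rule: infinite_finite_induct)
  case (insert i I)
  then have "F (\<lambda>p. Z i p + (\<Sum>i\<in>I. Z i p)) = (\<lambda>p. F (Z i) p + F (\<lambda>p. \<Sum>i\<in>I. Z i p) p)"
    by (intro F_add sections_sum) auto
  then show ?case using insert by simp
qed (simp_all add: tensorial_zero)

text \<open>Near p, Z is a combination of frame fields whose coefficients vanish at p. After cutting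
  off, linearity over smooth functions gives F of this combination the value 0 at p, while the
  cut-off factor is 1 there.\<close>

lemma tensorial_pointwise_zero:
  assumes Z: "Z \<in> sections A" and "Z p = 0"
  shows "F Z p = 0"
proof -
  obtain T where T: "T \<in> trivs A" "p \<in> fst T" by (rule triv_exists)
  obtain h V K where h: "smooth_fun A h" "open V" "p \<in> V" "V \<subseteq> K" "closed K" "K \<subseteq> fst T"
    "\<And>q. q \<in> V \<Longrightarrow> h q = 1" "\<And>q. q \<notin> K \<Longrightarrow> h q = 0" by (rule bump_exists[OF triv_open[OF T(1)] T(2)]) blast
  define E where "E = (\<lambda>i q. h q *\<^sub>R frame A T i q)"
  define z where "z = (\<lambda>i q. h q * coframe A T i q (Z q))"
  have E: "E i \<in> sections A" if "i < vrank A" for i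
    unfolding E_def using section_extend[OF triv_open[OF T(1)] frame_section[OF T(1) that] h(1,5,6,8)] .
  have z: "smooth_fun A (z i)" if "i < vrank A" for i
  proof (rule smooth_on_extend[OF open_UNIV triv_open[OF T(1)] h(5,6)])
    have "smooth_on A (fst T \<inter> UNIV) (\<lambda>q. coframe A T i q (Z q))"
      by (rule smooth_section_on_coframe[OF section_smooth_on[OF Z] T(1) that])
    then show "smooth_on A (UNIV \<inter> fst T) (z i)"
      unfolding z_def using triv_open[OF T(1)] smooth_on_subset[OF h(1)] by (simp add: smooth_on_mult)
    show "z i q = 0" if "q \<notin> K" for q using h(8)[OF that] by (simp add: z_def)
  qed
  \<comment> \<open>One factor h extends the coefficient to a global function and one extends the
    frame field to a global section, hence the square.\<close>
  have eq: "(\<lambda>q. (h q * h q) *\<^sub>R Z q) = (\<lambda>q. \<Sum>i<vrank A. z i q *\<^sub>R E i q)"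
  proof
    fix q
    show "(h q * h q) *\<^sub>R Z q = (\<Sum>i<vrank A. z i q *\<^sub>R E i q)"
    proof (cases "q \<in> K")
      case True
      then have q: "q \<in> fst T" using h by auto
      have "(h q * h q) *\<^sub>R Z q = (h q * h q) *\<^sub>R (\<Sum>i<vrank A. coframe A T i q (Z q) *\<^sub>R frame A T i q)"
        using fib_expand[OF T(1) q section_fib[OF Z]] by simp
      then show ?thesis by (simp add: scaleR_sum_right z_def E_def mult_ac)
    qed (simp add: h z_def)
  qed
  have "F (\<lambda>q. (h q * h q) *\<^sub>R Z q) p = h p * h p * F Z p"
    using F_scale[OF smooth_on_mult[OF open_UNIV h(1) h(1)] Z] by simp
  moreover have "F (\<lambda>q. \<Sum>i<vrank A. z i q *\<^sub>R E i q) p = (\<Sum>i<vrank A. z i p * F (E i) p)"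
    by (subst tensorial_sum) (auto simp: sections_scale z E F_scale)
  moreover have "z i p = 0" for i
    using \<open>Z p = 0\<close> linear_fun_on_zero[OF dual_fib_linear[OF coframe_dual[OF T]]] by (simp add: z_def)
  ultimately show ?thesis using eq h(3,7) by simp
qed

lemma tensorial_pointwise:
  assumes "Y \<in> sections A" "Z \<in> sections A" "Y p = Z p"
  shows "F Y p = F Z p"
proof -
  have "F (\<lambda>q. Y q + (- 1) *\<^sub>R Z q) p = 0"
    using assms sections_diff[OF assms(1,2)] by (intro tensorial_pointwise_zero) auto
  then show ?thesis
    using F_add[OF assms(1) sections_cscale[OF assms(2)], of "- 1"] F_scale[OF smooth_on_const assms(2), of "- 1"]
    by simp
qed

lemma dual_section_of_exists:
  "\<exists>\<zeta>. \<zeta> \<in> dual_sections A \<and> (\<forall>Z\<in>sections A. pair_sec \<zeta> Z = F Z)"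
proof -
  \<comment> \<open>Any section through v may be chosen: \<open>tensorial_pointwise\<close> makes
    the value at p independent of it. The value 0 off the fibre is the convention of
    \<open>dual_fib\<close>.\<close>
  define \<zeta> where "\<zeta> = (\<lambda>p v. if v \<in> fib A p then F (SOME Z. Z \<in> sections A \<and> Z p = v) p else 0)"
  have \<zeta>: "\<zeta> p v = F Z p" if "Z \<in> sections A" "Z p = v" for Z p v
  proof -
    define Y where "Y = (SOME Z. Z \<in> sections A \<and> Z p = v)"
    have "Y \<in> sections A \<and> Y p = v"
      unfolding Y_def by (rule someI[where P = "\<lambda>Z. Z \<in> sections A \<and> Z p = v" and x = Z]) (use that in simp)
    then have "F Y p = F Z p" using that by (intro tensorial_pointwise) auto
    moreover have "v \<in> fib A p" using section_fib[OF that(1), of p] that(2) by simp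
    ultimately show ?thesis by (simp add: \<zeta>_def Y_def)
  qed
  have "\<zeta> p \<in> dual_fib A p" for p
  proof (intro dual_fibI linear_fun_onI)
    fix v w assume vw: "v \<in> fib A p" "w \<in> fib A p"
    obtain Y where Y: "Y \<in> sections A" "Y p = v" using section_through[OF vw(1)] .
    obtain Z where Z: "Z \<in> sections A" "Z p = w" using section_through[OF vw(2)] .
    show "\<zeta> p (v + w) = \<zeta> p v + \<zeta> p w"
      using \<zeta>[OF sections_add[OF Y(1) Z(1)], of p "v + w"] \<zeta>[OF Y] \<zeta>[OF Z] F_add[OF Y(1) Z(1)] Y Z by simp
  next
    fix c v assume v: "v \<in> fib A p"
    obtain Y where Y: "Y \<in> sections A" "Y p = v" using section_through[OF v] .
    show "\<zeta> p (c *\<^sub>R v) = c * \<zeta> p v"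
      using \<zeta>[OF sections_cscale[OF Y(1), of c], of p "c *\<^sub>R v"] \<zeta>[OF Y] F_scale[OF smooth_on_const Y(1)] Y by simp
  qed (simp add: \<zeta>_def)
  moreover have "smooth_on A (fst T \<inter> UNIV) (\<lambda>p. \<zeta> p (frame A T j p))" if T: "T \<in> trivs A" and j: "j < vrank A" for T j
  proof (rule smooth_on_local)
    fix q assume "q \<in> fst T \<inter> UNIV"
    then have "q \<in> fst T" by simp
    \<comment> \<open>The frame field is replaced near q by a global section Z with the same values,
      so that the component of \<zeta> becomes the smooth function \<open>F Z\<close>.\<close>
    then obtain Z V where Z: "Z \<in> sections A" "open V" "q \<in> V" "V \<subseteq> fst T" "\<And>p. p \<in> V \<Longrightarrow> Z p = frame A T j p"
      by (rule section_germ[OF triv_open[OF T] _ frame_section[OF T j]]) blast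
    have "smooth_on A V (\<lambda>p. \<zeta> p (frame A T j p))"
      by (rule smooth_on_cong[OF Z(2) _ smooth_on_subset[OF F_smooth[OF Z(1)]]]) (simp_all add: \<zeta>[OF Z(1) Z(5)])
    then show "\<exists>V. open V \<and> q \<in> V \<and> smooth_on A (V \<inter> (fst T \<inter> UNIV)) (\<lambda>p. \<zeta> p (frame A T j p))"
      using Z(2,3) by (intro exI[of _ V]) (auto intro: smooth_on_subset)
  qed (use triv_open[OF T] in simp)
  ultimately have "\<zeta> \<in> dual_sections A"
    unfolding dual_sections_def mem_Collect_eq by (intro smooth_dual_section_onI) auto
  moreover have "pair_sec \<zeta> Z = F Z" if "Z \<in> sections A" for Z
    using \<zeta>[OF that] by (auto simp: pair_sec_def)
  ultimately show ?thesis by blast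
qed

lemma
  shows dual_section_of_sections: "dual_section_of A F \<in> dual_sections A"
    and pair_dual_section_of: "Z \<in> sections A \<Longrightarrow> pair_sec (dual_section_of A F) Z = F Z"
proof -
  have "\<exists>!\<zeta>. \<zeta> \<in> dual_sections A \<and> (\<forall>Z\<in>sections A. pair_sec \<zeta> Z = F Z)"
  proof (rule ex_ex1I[OF dual_section_of_exists])
    show "\<xi> = \<zeta>" if "\<xi> \<in> dual_sections A \<and> (\<forall>Z\<in>sections A. pair_sec \<xi> Z = F Z)"
      "\<zeta> \<in> dual_sections A \<and> (\<forall>Z\<in>sections A. pair_sec \<zeta> Z = F Z)" for \<xi> \<zeta>
      using that by (intro dual_section_eqI) auto
  qed
  then have "dual_section_of A F \<in> dual_sections A \<and> (\<forall>Z\<in>sections A. pair_sec (dual_section_of A F) Z = F Z)"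
    unfolding dual_section_of_def by (rule theI')
  then show "dual_section_of A F \<in> dual_sections A"
    "Z \<in> sections A \<Longrightarrow> pair_sec (dual_section_of A F) Z = F Z" by auto
qed

end

end

section \<open>Lie algebroids\<close>

locale lalgd =
  fixes A :: "('m::{t2_space,second_countable_topology}, 'a::real_vector, 'z) lie_algebroid_scheme"
  assumes lie_algebroid: "lie_algebroid A"
begin

sublocale vbdl A
  using lie_algebroid by unfold_locales (simp add: lie_algebroid_def)

section \<open>Algebraic rules and locality of bracket and anchor\<close>

lemma brk_sections: "X \<in> sections A \<Longrightarrow> Y \<in> sections A \<Longrightarrow> brk A X Y \<in> sections A"
  using lie_algebroid unfolding lie_algebroid_def by blast

lemma brk_skew: "X \<in> sections A \<Longrightarrow> Y \<in> sections A \<Longrightarrow> brk A X Y p = - brk A Y X p"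
  by (rule fun_cong[of "brk A X Y"]) (use lie_algebroid in \<open>unfold lie_algebroid_def, blast\<close>)

lemma brk_add_left:
  "X \<in> sections A \<Longrightarrow> Y \<in> sections A \<Longrightarrow> Z \<in> sections A \<Longrightarrow>
   brk A (\<lambda>p. X p + Y p) Z p = brk A X Z p + brk A Y Z p"
  by (rule fun_cong[of "brk A (\<lambda>p. X p + Y p) Z"]) (use lie_algebroid in \<open>unfold lie_algebroid_def, blast\<close>)

lemma brk_add_right:
  "X \<in> sections A \<Longrightarrow> Y \<in> sections A \<Longrightarrow> Z \<in> sections A \<Longrightarrow>
   brk A Z (\<lambda>p. X p + Y p) p = brk A Z X p + brk A Z Y p"
  using brk_add_left[of X Y Z p] brk_skew[of Z X p] brk_skew[of Z Y p] brk_skew[of Z "\<lambda>p. X p + Y p" p]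
  by (simp add: sections_add)

lemma brk_scale_right:
  "X \<in> sections A \<Longrightarrow> Y \<in> sections A \<Longrightarrow> smooth_fun A f \<Longrightarrow>
   brk A X (\<lambda>p. f p *\<^sub>R Y p) p = f p *\<^sub>R brk A X Y p + anchor_sec A X f p *\<^sub>R Y p"
  by (rule fun_cong[of "brk A X (\<lambda>p. f p *\<^sub>R Y p)"]) (use lie_algebroid in \<open>unfold lie_algebroid_def, blast\<close>)

lemma brk_scale_left:
  "X \<in> sections A \<Longrightarrow> Y \<in> sections A \<Longrightarrow> smooth_fun A f \<Longrightarrow>
   brk A (\<lambda>p. f p *\<^sub>R X p) Y p = f p *\<^sub>R brk A X Y p - anchor_sec A Y f p *\<^sub>R X p"
proof -
  assume a: "X \<in> sections A" "Y \<in> sections A" "smooth_fun A f"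
  have "- brk A (\<lambda>p. f p *\<^sub>R X p) Y p = - (f p *\<^sub>R brk A X Y p - anchor_sec A Y f p *\<^sub>R X p)"
    using brk_scale_right[OF a(2,1,3), of p] brk_skew[OF a(2,1), of p]
      brk_skew[OF a(2) sections_scale[OF a(3,1)], of p] by simp
  then show ?thesis by (simp only: neg_equal_iff_equal)
qed

lemma
  shows anchor_tangent: "v \<in> fib A p \<Longrightarrow> anchor A p v \<in> tangent_space A p"
    and anchor_linear: "smooth_fun A f \<Longrightarrow> linear_fun_on (fib A p) (\<lambda>v. anchor A p v f)"
    and anchor_sec_smooth: "X \<in> sections A \<Longrightarrow> smooth_fun A f \<Longrightarrow> smooth_fun A (anchor_sec A X f)"
proof -
  have "(\<forall>p. \<forall>v\<in>fib A p. anchor A p v \<in> tangent_space A p) \<and>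
    (\<forall>p f. smooth_fun A f \<longrightarrow> linear_fun_on (fib A p) (\<lambda>v. anchor A p v f)) \<and>
    (\<forall>X\<in>sections A. \<forall>f. smooth_fun A f \<longrightarrow> smooth_fun A (anchor_sec A X f))"
    using lie_algebroid unfolding lie_algebroid_def by (elim conjE) (intro conjI)
  then show "v \<in> fib A p \<Longrightarrow> anchor A p v \<in> tangent_space A p"
    "smooth_fun A f \<Longrightarrow> linear_fun_on (fib A p) (\<lambda>v. anchor A p v f)"
    "X \<in> sections A \<Longrightarrow> smooth_fun A f \<Longrightarrow> smooth_fun A (anchor_sec A X f)" by simp_all
qed

lemma
  assumes "X \<in> sections A" "smooth_fun A f" "smooth_fun A g"
  shows anchor_sec_add_fun: "anchor_sec A X (\<lambda>q. f q + g q) p = anchor_sec A X f p + anchor_sec A X g p"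
    and anchor_sec_mult_fun: "anchor_sec A X (\<lambda>q. f q * g q) p = f p * anchor_sec A X g p + g p * anchor_sec A X f p"
    and anchor_sec_cmult_fun: "anchor_sec A X (\<lambda>q. c * f q) p = c * anchor_sec A X f p"
  using anchor_tangent[OF section_fib[OF assms(1)], of p] assms unfolding anchor_sec_def tangent_space_def by auto

lemma anchor_sec_minus_fun:
  "X \<in> sections A \<Longrightarrow> smooth_fun A f \<Longrightarrow> anchor_sec A X (\<lambda>q. - f q) p = - anchor_sec A X f p"
  using anchor_sec_cmult_fun[of X f f "- 1" p] by simp

lemma anchor_sec_zero_fun: "X \<in> sections A \<Longrightarrow> anchor_sec A X (\<lambda>q. 0) p = 0"
  using anchor_sec_cmult_fun[of X "\<lambda>q. 0" "\<lambda>q. 0" 0 p] by (simp add: smooth_on_const)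

lemma anchor_sec_diff_fun:
  assumes "X \<in> sections A" "smooth_fun A f" "smooth_fun A g"
  shows "anchor_sec A X (\<lambda>q. f q - g q) p = anchor_sec A X f p - anchor_sec A X g p"
  using anchor_sec_add_fun[of X f "\<lambda>q. - g q" p] anchor_sec_minus_fun[of X g p] assms
  by (simp add: smooth_on_minus)

lemma
  assumes "X \<in> sections A" "smooth_fun A f"
  shows anchor_sec_add: "Y \<in> sections A \<Longrightarrow> anchor_sec A (\<lambda>p. X p + Y p) f p = anchor_sec A X f p + anchor_sec A Y f p"
    and anchor_sec_scale: "anchor_sec A (\<lambda>p. g p *\<^sub>R X p) f p = g p * anchor_sec A X f p"
    and anchor_sec_diff: "Y \<in> sections A \<Longrightarrow> anchor_sec A (\<lambda>p. X p - Y p) f p = anchor_sec A X f p - anchor_sec A Y f p"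
proof -
  note l = anchor_linear[OF assms(2), of p]
  show 1: "anchor_sec A (\<lambda>p. X p + Y p) f p = anchor_sec A X f p + anchor_sec A Y f p" if "Y \<in> sections A" for Y
    using linear_fun_on_add[OF l section_fib[OF assms(1)] section_fib[OF that]] by (simp add: anchor_sec_def)
  show "anchor_sec A (\<lambda>p. g p *\<^sub>R X p) f p = g p * anchor_sec A X f p"
    using linear_fun_on_scale[OF l section_fib[OF assms(1)]] by (simp add: anchor_sec_def)
  show "anchor_sec A (\<lambda>p. X p - Y p) f p = anchor_sec A X f p - anchor_sec A Y f p" if "Y \<in> sections A"
    using linear_fun_on_add[OF l section_fib[OF assms(1)] fib_minus[OF section_fib[OF that]]]
      linear_fun_on_minus[OF l section_fib[OF that]] by (simp add: anchor_sec_def)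
qed

text \<open>Let d = f - g and let h be 1 near p and 0 outside W, where W is a set on which d
  vanishes. Then h d = 0 everywhere, and the Leibniz rule at p, with h(p) = 1 and d(p) = 0, leaves
  the derivative of d, which must be 0.\<close>

lemma anchor_sec_local:
  assumes "open W" "p \<in> W" "\<And>q. q \<in> W \<Longrightarrow> f q = g q" "smooth_fun A f" "smooth_fun A g" "X \<in> sections A"
  shows "anchor_sec A X f p = anchor_sec A X g p"
proof -
  obtain h V K where h: "smooth_fun A h" "open V" "p \<in> V" "V \<subseteq> K" "closed K" "K \<subseteq> W"
    "\<And>q. q \<in> V \<Longrightarrow> h q = 1" "\<And>q. q \<notin> K \<Longrightarrow> h q = 0" by (rule bump_exists[OF assms(1,2)]) blast
  define d where "d = (\<lambda>q. f q - g q)"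
  have d: "smooth_fun A d" unfolding d_def using assms by (simp add: smooth_on_diff)
  have "h q * d q = 0" for q
    using h(6) h(8)[of q] assms(3)[of q] by (cases "q \<in> K") (auto simp: d_def)
  then have "(\<lambda>q. h q * d q) = (\<lambda>q. 0)" by (rule ext)
  then have "anchor_sec A X (\<lambda>q. h q * d q) p = 0"
    using anchor_sec_zero_fun[OF assms(6)] by simp
  then have "anchor_sec A X d p = 0"
    using anchor_sec_mult_fun[OF assms(6) h(1) d, of p] h(3,7) assms(2,3) by (simp add: d_def)
  then show ?thesis using anchor_sec_diff_fun[OF assms(6,4,5), of p] by (simp add: d_def)
qed

text \<open>The same cut-off argument as for functions, with the Leibniz rule of the bracket: h Z =
  0 everywhere, and Z(p) = 0 removes the anchor term.\<close>

lemma brk_local_zero: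
  assumes "open W" "p \<in> W" "\<And>q. q \<in> W \<Longrightarrow> Z q = 0" "Z \<in> sections A" "X \<in> sections A"
  shows "brk A X Z p = 0"
proof -
  obtain h V K where h: "smooth_fun A h" "open V" "p \<in> V" "V \<subseteq> K" "closed K" "K \<subseteq> W"
    "\<And>q. q \<in> V \<Longrightarrow> h q = 1" "\<And>q. q \<notin> K \<Longrightarrow> h q = 0" by (rule bump_exists[OF assms(1,2)]) blast
  \<comment> \<open>The zero section is written as 0 times Z, so that its bracket can be evaluated
    by the Leibniz rule with the constant function 0.\<close>
  have eq: "(\<lambda>q. h q *\<^sub>R Z q) = (\<lambda>q. 0 *\<^sub>R Z q)"
  proof
    show "h q *\<^sub>R Z q = 0 *\<^sub>R Z q" for q
      using h(6) h(8)[of q] assms(3)[of q] by (cases "q \<in> K") auto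
  qed
  have "brk A X (\<lambda>q. 0 *\<^sub>R Z q) p = 0"
    using brk_scale_right[OF assms(5,4) smooth_on_const[of _ 0], of p] anchor_sec_zero_fun[OF assms(5)] by simp
  then have "brk A X (\<lambda>q. h q *\<^sub>R Z q) p = 0" by (simp only: eq)
  then show ?thesis
    using brk_scale_right[OF assms(5,4) h(1), of p] h(3,7) assms(2,3) by simp
qed

lemma brk_local_right:
  assumes "open W" "p \<in> W" "\<And>q. q \<in> W \<Longrightarrow> Y q = Z q" "Y \<in> sections A" "Z \<in> sections A" "X \<in> sections A"
  shows "brk A X Y p = brk A X Z p"
proof -
  have "brk A X (\<lambda>q. Y q - Z q) p = 0"
    using assms by (intro brk_local_zero[of W]) (auto simp: sections_diff)
  moreover have "brk A X (\<lambda>q. (Y q - Z q) + Z q) p = brk A X (\<lambda>q. Y q - Z q) p + brk A X Z p"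
    using assms by (intro brk_add_right sections_diff)
  ultimately show ?thesis by simp
qed

lemma brk_local:
  assumes "open W" "p \<in> W" "\<And>q. q \<in> W \<Longrightarrow> X q = X' q" "\<And>q. q \<in> W \<Longrightarrow> Y q = Y' q"
    and "X \<in> sections A" "X' \<in> sections A" "Y \<in> sections A" "Y' \<in> sections A"
  shows "brk A X Y p = brk A X' Y' p"
  using brk_local_right[OF assms(1,2,4,7,8,5)] brk_local_right[OF assms(1,2,3,5,6,8)]
    brk_skew[OF assms(5,8)] brk_skew[OF assms(6,8)] by simp

section \<open>Pairings, Lie derivative and contraction of the differential\<close>

lemma
  assumes "\<xi> \<in> dual_sections A"
  shows pair_add: "X \<in> sections A \<Longrightarrow> Y \<in> sections A \<Longrightarrow> pair_sec \<xi> (\<lambda>p. X p + Y p) p = pair_sec \<xi> X p + pair_sec \<xi> Y p"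
    and pair_scale: "X \<in> sections A \<Longrightarrow> pair_sec \<xi> (\<lambda>p. f p *\<^sub>R X p) p = f p * pair_sec \<xi> X p"
    and pair_diff: "X \<in> sections A \<Longrightarrow> Y \<in> sections A \<Longrightarrow> pair_sec \<xi> (\<lambda>p. X p - Y p) p = pair_sec \<xi> X p - pair_sec \<xi> Y p"
    and pair_minus: "X \<in> sections A \<Longrightarrow> pair_sec \<xi> (\<lambda>p. - X p) p = - pair_sec \<xi> X p"
proof -
  note l = dual_fib_linear[OF dual_section_fib[OF assms], of p]
  show "pair_sec \<xi> (\<lambda>p. X p + Y p) p = pair_sec \<xi> X p + pair_sec \<xi> Y p" if "X \<in> sections A" "Y \<in> sections A"
    using linear_fun_on_add[OF l section_fib section_fib] that by (simp add: pair_sec_def)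
  show "pair_sec \<xi> (\<lambda>p. f p *\<^sub>R X p) p = f p * pair_sec \<xi> X p" if "X \<in> sections A"
    using linear_fun_on_scale[OF l section_fib] that by (simp add: pair_sec_def)
  show "pair_sec \<xi> (\<lambda>p. - X p) p = - pair_sec \<xi> X p" if "X \<in> sections A"
    using linear_fun_on_minus[OF l section_fib] that by (simp add: pair_sec_def)
  show "pair_sec \<xi> (\<lambda>p. X p - Y p) p = pair_sec \<xi> X p - pair_sec \<xi> Y p" if "X \<in> sections A" "Y \<in> sections A"
    using linear_fun_on_add[OF l section_fib fib_minus[OF section_fib]] linear_fun_on_minus[OF l section_fib] that
    by (simp add: pair_sec_def)
qed

text \<open>The defining expression is tensorial in Z: replacing Z by f Z produces (Xf)\<eta>(Z)
  once from the derivative of the pairing and once from the bracket, and these cancel. So the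
  described section exists.\<close>

lemma
  assumes X: "X \<in> sections A" and \<eta>: "\<eta> \<in> dual_sections A"
  shows lie_deriv_sections: "lie_deriv A X \<eta> \<in> dual_sections A"
    and pair_lie_deriv: "Z \<in> sections A \<Longrightarrow> pair_sec (lie_deriv A X \<eta>) Z p =
      anchor_sec A X (pair_sec \<eta> Z) p - pair_sec \<eta> (brk A X Z) p"
proof -
  let ?F = "\<lambda>Z p. anchor_sec A X (pair_sec \<eta> Z) p - pair_sec \<eta> (brk A X Z) p"
  have 1: "smooth_fun A (?F Z)" if "Z \<in> sections A" for Z
    using that assms by (intro smooth_on_diff open_UNIV anchor_sec_smooth pair_sec_smooth brk_sections)
  have 2: "?F (\<lambda>p. Y p + Z p) = (\<lambda>p. ?F Y p + ?F Z p)" if Y: "Y \<in> sections A" and Z: "Z \<in> sections A" for Y Z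
  proof
    fix p
    have e: "pair_sec \<eta> (\<lambda>p. Y p + Z p) = (\<lambda>p. pair_sec \<eta> Y p + pair_sec \<eta> Z p)"
      using pair_add[OF \<eta> Y Z] by auto
    have b: "brk A X (\<lambda>p. Y p + Z p) = (\<lambda>p. brk A X Y p + brk A X Z p)"
      using brk_add_right[OF Y Z X] by auto
    show "?F (\<lambda>p. Y p + Z p) p = ?F Y p + ?F Z p"
      unfolding e b using pair_add[OF \<eta> brk_sections[OF X Y] brk_sections[OF X Z], of p]
        anchor_sec_add_fun[OF X pair_sec_smooth[OF \<eta> Y] pair_sec_smooth[OF \<eta> Z], of p] by simp
  qed
  have 3: "?F (\<lambda>p. f p *\<^sub>R Z p) = (\<lambda>p. f p * ?F Z p)" if f: "smooth_fun A f" and Z: "Z \<in> sections A" for f Z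
  proof
    fix p
    have e: "pair_sec \<eta> (\<lambda>p. f p *\<^sub>R Z p) = (\<lambda>p. f p * pair_sec \<eta> Z p)"
      using pair_scale[OF \<eta> Z] by auto
    have b: "brk A X (\<lambda>p. f p *\<^sub>R Z p) = (\<lambda>p. f p *\<^sub>R brk A X Z p + anchor_sec A X f p *\<^sub>R Z p)"
      using brk_scale_right[OF X Z f] by auto
    show "?F (\<lambda>p. f p *\<^sub>R Z p) p = f p * ?F Z p"
      unfolding e b using pair_add[OF \<eta> sections_scale[OF f brk_sections[OF X Z]] sections_scale[OF anchor_sec_smooth[OF X f] Z], of p]
        pair_scale[OF \<eta> brk_sections[OF X Z], of f p] pair_scale[OF \<eta> Z, of "anchor_sec A X f" p]
        anchor_sec_mult_fun[OF X f pair_sec_smooth[OF \<eta> Z], of p] by (simp add: algebra_simps)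
  qed
  note F = 1 2 3
  show "lie_deriv A X \<eta> \<in> dual_sections A"
    unfolding lie_deriv_def by (rule dual_section_of_sections[of ?F, OF F])
  show "Z \<in> sections A \<Longrightarrow> pair_sec (lie_deriv A X \<eta>) Z p =
      anchor_sec A X (pair_sec \<eta> Z) p - pair_sec \<eta> (brk A X Z) p"
    unfolding lie_deriv_def by (subst pair_dual_section_of[of ?F, OF F]) auto
qed

lemma
  assumes Y: "Y \<in> sections A" and \<xi>: "\<xi> \<in> dual_sections A"
  shows int_diff_sections: "int_diff A Y \<xi> \<in> dual_sections A"
    and pair_int_diff: "Z \<in> sections A \<Longrightarrow> pair_sec (int_diff A Y \<xi>) Z p = diff1 A \<xi> Y Z p"
proof -
  \<comment> \<open>Cartan's formula: contracting d\<xi> with Y gives the Lie derivative of \<xi>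
    minus the differential of \<xi>(Y). Both terms are visibly tensorial in Z, so nothing about
    \<open>diff1\<close> is computed directly.\<close>
  let ?L = "\<lambda>Z p. pair_sec (lie_deriv A Y \<xi>) Z p - anchor_sec A Z (pair_sec \<xi> Y) p"
  have L: "diff1 A \<xi> Y Z = ?L Z" if "Z \<in> sections A" for Z
    using pair_lie_deriv[OF Y \<xi> that] by (auto simp: diff1_def)
  note ld = lie_deriv_sections[OF Y \<xi>] and sm = pair_sec_smooth[OF \<xi> Y]
  have 1: "smooth_fun A (diff1 A \<xi> Y Z)" if "Z \<in> sections A" for Z
    unfolding L[OF that] using that by (intro smooth_on_diff open_UNIV anchor_sec_smooth pair_sec_smooth ld sm)
  have 2: "diff1 A \<xi> Y (\<lambda>p. X p + Z p) = (\<lambda>p. diff1 A \<xi> Y X p + diff1 A \<xi> Y Z p)"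
    if "X \<in> sections A" "Z \<in> sections A" for X Z
    unfolding L[OF that(1)] L[OF that(2)] L[OF sections_add[OF that]]
    using pair_add[OF ld that] anchor_sec_add[OF that(1) sm that(2)] by auto
  have 3: "diff1 A \<xi> Y (\<lambda>p. f p *\<^sub>R Z p) = (\<lambda>p. f p * diff1 A \<xi> Y Z p)"
    if "smooth_fun A f" "Z \<in> sections A" for f Z
    unfolding L[OF that(2)] L[OF sections_scale[OF that]]
    using pair_scale[OF ld that(2)] anchor_sec_scale[OF that(2) sm] by (auto simp: algebra_simps)
  note F = 1 2 3
  show "int_diff A Y \<xi> \<in> dual_sections A"
    unfolding int_diff_def by (rule dual_section_of_sections[of "diff1 A \<xi> Y", OF F])
  show "Z \<in> sections A \<Longrightarrow> pair_sec (int_diff A Y \<xi>) Z p = diff1 A \<xi> Y Z p"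
    unfolding int_diff_def by (subst pair_dual_section_of[of "diff1 A \<xi> Y", OF F]) auto
qed

end

section \<open>The Schouten bracket of a bivector with itself\<close>

text \<open>For \<open>a = P\<xi>\<close>, \<open>c = P\<zeta>\<close>, \<open>b = Q\<xi>\<close>, \<open>d = Q\<eta>\<close> this is the polarisation
  $\langle\zeta, [P\xi,Q\eta]\rangle + \langle \mathcal L_{Q\xi}\eta - i_{Q\eta}\mathrm d\xi, P\zeta\rangle$
  of the obstruction to $\pi\{\xi,\eta\}_\pi = [\pi\xi,\pi\eta]$; it is biadditive in \<open>P\<close> and \<open>Q\<close>.\<close>

definition sharp_defect ::
  "('m, 'a, 'z) lie_algebroid_scheme \<Rightarrow> ('m \<Rightarrow> 'a \<Rightarrow> real) \<Rightarrow> ('m \<Rightarrow> 'a \<Rightarrow> real) \<Rightarrow> ('m \<Rightarrow> 'a \<Rightarrow> real)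
    \<Rightarrow> ('m \<Rightarrow> 'a) \<Rightarrow> ('m \<Rightarrow> 'a) \<Rightarrow> ('m \<Rightarrow> 'a) \<Rightarrow> ('m \<Rightarrow> 'a) \<Rightarrow> 'm \<Rightarrow> real" where
  "sharp_defect A \<xi> \<eta> \<zeta> a c b d p =
     pair_sec \<zeta> (brk A a d) p + anchor_sec A b (pair_sec \<eta> c) p - pair_sec \<eta> (brk A b c) p
     - anchor_sec A d (pair_sec \<xi> c) p + anchor_sec A c (pair_sec \<xi> d) p + pair_sec \<xi> (brk A d c) p"

text \<open>The contraction of \<xi> with the decomposable bivector of X1 and X2. Unlike
  \<open>sharp\<close>, it is an explicit combination of sections, so the Leibniz rules
  apply.\<close>

definition wedge_sharp :: "('m \<Rightarrow> 'a::real_vector) \<Rightarrow> ('m \<Rightarrow> 'a) \<Rightarrow> ('m \<Rightarrow> 'a \<Rightarrow> real) \<Rightarrow> 'm \<Rightarrow> 'a" where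
  "wedge_sharp X1 X2 \<xi> = (\<lambda>p. pair_sec \<xi> X1 p *\<^sub>R X2 p - pair_sec \<xi> X2 p *\<^sub>R X1 p)"

definition list_sharp :: "(('m \<Rightarrow> 'a::real_vector) \<times> ('m \<Rightarrow> 'a)) list \<Rightarrow> ('m \<Rightarrow> 'a \<Rightarrow> real) \<Rightarrow> 'm \<Rightarrow> 'a" where
  "list_sharp xs \<xi> = (\<lambda>p. \<Sum>(X1, X2)\<leftarrow>xs. wedge_sharp X1 X2 \<xi> p)"

context lalgd begin

section \<open>Bracket and anchor terms of contracted decomposable bivectors\<close>

lemma pair_brk_add_left:
  assumes "\<theta> \<in> dual_sections A" "X \<in> sections A" "Y \<in> sections A" "Z \<in> sections A"
  shows "pair_sec \<theta> (brk A (\<lambda>p. X p + Y p) Z) p = pair_sec \<theta> (brk A X Z) p + pair_sec \<theta> (brk A Y Z) p"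
proof -
  have "brk A (\<lambda>p. X p + Y p) Z = (\<lambda>p. brk A X Z p + brk A Y Z p)"
    using brk_add_left[OF assms(2-4)] by auto
  then show ?thesis using pair_add[OF assms(1)] brk_sections assms by simp
qed

lemma pair_brk_add_right:
  assumes "\<theta> \<in> dual_sections A" "X \<in> sections A" "Y \<in> sections A" "Z \<in> sections A"
  shows "pair_sec \<theta> (brk A Z (\<lambda>p. X p + Y p)) p = pair_sec \<theta> (brk A Z X) p + pair_sec \<theta> (brk A Z Y) p"
proof -
  have "brk A Z (\<lambda>p. X p + Y p) = (\<lambda>p. brk A Z X p + brk A Z Y p)"
    using brk_add_right[OF assms(2-4)] by auto
  then show ?thesis using pair_add[OF assms(1)] brk_sections assms by simp
qed

lemma pair_brk_diff_left:
  assumes "\<theta> \<in> dual_sections A" "X \<in> sections A" "Y \<in> sections A" "Z \<in> sections A"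
  shows "pair_sec \<theta> (brk A (\<lambda>p. X p - Y p) Z) p = pair_sec \<theta> (brk A X Z) p - pair_sec \<theta> (brk A Y Z) p"
  using pair_brk_add_left[OF assms(1) sections_diff[OF assms(2,3)] assms(3,4), of p] by simp

lemma pair_brk_diff_right:
  assumes "\<theta> \<in> dual_sections A" "X \<in> sections A" "Y \<in> sections A" "Z \<in> sections A"
  shows "pair_sec \<theta> (brk A Z (\<lambda>p. X p - Y p)) p = pair_sec \<theta> (brk A Z X) p - pair_sec \<theta> (brk A Z Y) p"
  using pair_brk_add_right[OF assms(1) sections_diff[OF assms(2,3)] assms(3,4), of p] by simp

lemma pair_brk_scale:
  assumes "\<theta> \<in> dual_sections A" "X \<in> sections A" "Y \<in> sections A" "smooth_fun A f" "smooth_fun A g"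
  shows "pair_sec \<theta> (brk A (\<lambda>p. f p *\<^sub>R X p) (\<lambda>p. g p *\<^sub>R Y p)) p =
    f p * g p * pair_sec \<theta> (brk A X Y) p + f p * anchor_sec A X g p * pair_sec \<theta> Y p
    - g p * anchor_sec A Y f p * pair_sec \<theta> X p"
proof -
  note fX = sections_scale[OF assms(4,2)]
  have "brk A (\<lambda>p. f p *\<^sub>R X p) (\<lambda>p. g p *\<^sub>R Y p) p =
     (f p * g p) *\<^sub>R brk A X Y p + (f p * anchor_sec A X g p) *\<^sub>R Y p + (- (g p * anchor_sec A Y f p)) *\<^sub>R X p"
    using brk_scale_right[OF fX assms(3,5), of p] brk_scale_left[OF assms(2,3,4), of p]
      anchor_sec_scale[OF assms(2,5), of f p] by (simp add: algebra_simps)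
  moreover note l = dual_fib_linear[OF dual_section_fib[OF assms(1)], of p]
  have "brk A X Y p \<in> fib A p" "X p \<in> fib A p" "Y p \<in> fib A p"
    using assms brk_sections section_fib by auto
  ultimately show ?thesis
    by (simp add: pair_sec_def linear_fun_on_add[OF l] linear_fun_on_scale[OF l] fib_add fib_scale del: scaleR_minus_left)
qed

lemma pair_brk_skew:
  assumes "\<theta> \<in> dual_sections A" "X \<in> sections A" "Y \<in> sections A"
  shows "pair_sec \<theta> (brk A X Y) p = - pair_sec \<theta> (brk A Y X) p"
proof -
  have "brk A X Y = (\<lambda>p. - brk A Y X p)" using brk_skew[OF assms(2,3)] by auto
  then show ?thesis using pair_minus[OF assms(1) brk_sections[OF assms(3,2)]] by simp
qed

lemma wedge_sharp_sections:
  "X1 \<in> sections A \<Longrightarrow> X2 \<in> sections A \<Longrightarrow> \<xi> \<in> dual_sections A \<Longrightarrow> wedge_sharp X1 X2 \<xi> \<in> sections A"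
  unfolding wedge_sharp_def by (intro sections_diff sections_scale pair_sec_smooth)

lemma pair_wedge_sharp:
  assumes "X1 \<in> sections A" "X2 \<in> sections A" "\<xi> \<in> dual_sections A" "\<eta> \<in> dual_sections A"
  shows "pair_sec \<eta> (wedge_sharp X1 X2 \<xi>) =
     (\<lambda>p. pair_sec \<xi> X1 p * pair_sec \<eta> X2 p - pair_sec \<xi> X2 p * pair_sec \<eta> X1 p)"
proof
  fix p
  note s = sections_scale[OF pair_sec_smooth]
  show "pair_sec \<eta> (wedge_sharp X1 X2 \<xi>) p = pair_sec \<xi> X1 p * pair_sec \<eta> X2 p - pair_sec \<xi> X2 p * pair_sec \<eta> X1 p"
    unfolding wedge_sharp_def
    using pair_diff[OF assms(4) s[OF assms(3,1,2)] s[OF assms(3,2,1)], of p]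
      pair_scale[OF assms(4,2)] pair_scale[OF assms(4,1)] by simp
qed

lemma anchor_wedge_sharp:
  assumes "X1 \<in> sections A" "X2 \<in> sections A" "\<xi> \<in> dual_sections A" "smooth_fun A f"
  shows "anchor_sec A (wedge_sharp X1 X2 \<xi>) f p =
     pair_sec \<xi> X1 p * anchor_sec A X2 f p - pair_sec \<xi> X2 p * anchor_sec A X1 f p"
proof -
  note s = sections_scale[OF pair_sec_smooth]
  show ?thesis unfolding wedge_sharp_def
    using anchor_sec_diff[OF s[OF assms(3,1,2)] assms(4) s[OF assms(3,2,1)], of p]
      anchor_sec_scale[OF assms(2,4)] anchor_sec_scale[OF assms(1,4)] by simp
qed

lemma anchor_pair_wedge_sharp:
  assumes "X1 \<in> sections A" "X2 \<in> sections A" "\<xi> \<in> dual_sections A" "\<eta> \<in> dual_sections A" "Z \<in> sections A"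
  shows "anchor_sec A Z (pair_sec \<eta> (wedge_sharp X1 X2 \<xi>)) p =
     pair_sec \<xi> X1 p * anchor_sec A Z (pair_sec \<eta> X2) p + anchor_sec A Z (pair_sec \<xi> X1) p * pair_sec \<eta> X2 p
     - pair_sec \<xi> X2 p * anchor_sec A Z (pair_sec \<eta> X1) p - anchor_sec A Z (pair_sec \<xi> X2) p * pair_sec \<eta> X1 p"
proof -
  note sm = pair_sec_smooth[OF assms(3,1)] pair_sec_smooth[OF assms(3,2)]
    pair_sec_smooth[OF assms(4,1)] pair_sec_smooth[OF assms(4,2)]
  show ?thesis
    unfolding pair_wedge_sharp[OF assms(1-4)]
    using anchor_sec_diff_fun[OF assms(5) smooth_on_mult[OF open_UNIV sm(1,4)] smooth_on_mult[OF open_UNIV sm(2,3)], of p]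
      anchor_sec_mult_fun[OF assms(5) sm(1,4)] anchor_sec_mult_fun[OF assms(5) sm(2,3)] by simp
qed

text \<open>The Leibniz rule in both slots for the four products of summands, one parenthesis per
  product. In each, the bracket term is kept in the Schouten bracket, and the two anchor terms are
  those to be cancelled later.\<close>

lemma pair_brk_wedge_sharp:
  assumes "X1 \<in> sections A" "X2 \<in> sections A" "Y1 \<in> sections A" "Y2 \<in> sections A"
    and "\<xi> \<in> dual_sections A" "\<eta> \<in> dual_sections A" "\<theta> \<in> dual_sections A"
  shows "pair_sec \<theta> (brk A (wedge_sharp X1 X2 \<xi>) (wedge_sharp Y1 Y2 \<eta>)) p =
     (pair_sec \<xi> X1 p * pair_sec \<eta> Y1 p * pair_sec \<theta> (brk A X2 Y2) p
       + pair_sec \<xi> X1 p * anchor_sec A X2 (pair_sec \<eta> Y1) p * pair_sec \<theta> Y2 p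
       - pair_sec \<eta> Y1 p * anchor_sec A Y2 (pair_sec \<xi> X1) p * pair_sec \<theta> X2 p)
   - (pair_sec \<xi> X1 p * pair_sec \<eta> Y2 p * pair_sec \<theta> (brk A X2 Y1) p
       + pair_sec \<xi> X1 p * anchor_sec A X2 (pair_sec \<eta> Y2) p * pair_sec \<theta> Y1 p
       - pair_sec \<eta> Y2 p * anchor_sec A Y1 (pair_sec \<xi> X1) p * pair_sec \<theta> X2 p)
   - (pair_sec \<xi> X2 p * pair_sec \<eta> Y1 p * pair_sec \<theta> (brk A X1 Y2) p
       + pair_sec \<xi> X2 p * anchor_sec A X1 (pair_sec \<eta> Y1) p * pair_sec \<theta> Y2 p
       - pair_sec \<eta> Y1 p * anchor_sec A Y2 (pair_sec \<xi> X2) p * pair_sec \<theta> X1 p)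
   + (pair_sec \<xi> X2 p * pair_sec \<eta> Y2 p * pair_sec \<theta> (brk A X1 Y1) p
       + pair_sec \<xi> X2 p * anchor_sec A X1 (pair_sec \<eta> Y2) p * pair_sec \<theta> Y1 p
       - pair_sec \<eta> Y2 p * anchor_sec A Y1 (pair_sec \<xi> X2) p * pair_sec \<theta> X1 p)"
proof -
  note s = sections_scale[OF pair_sec_smooth]
  note X12 = s[OF assms(5,1,2)] and X21 = s[OF assms(5,2,1)] and Y12 = s[OF assms(6,3,4)] and Y21 = s[OF assms(6,4,3)]
  note x1 = pair_sec_smooth[OF assms(5,1)] and x2 = pair_sec_smooth[OF assms(5,2)]
    and y1 = pair_sec_smooth[OF assms(6,3)] and y2 = pair_sec_smooth[OF assms(6,4)]
  show ?thesis unfolding wedge_sharp_def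
    using pair_brk_diff_left[OF assms(7) X12 X21 sections_diff[OF Y12 Y21], of p]
      pair_brk_diff_right[OF assms(7) Y12 Y21 X12, of p] pair_brk_diff_right[OF assms(7) Y12 Y21 X21, of p]
      pair_brk_scale[OF assms(7,2,4) x1 y1, of p] pair_brk_scale[OF assms(7,2,3) x1 y2, of p]
      pair_brk_scale[OF assms(7,1,4) x2 y1, of p] pair_brk_scale[OF assms(7,1,3) x2 y2, of p]
    by linarith
qed

text \<open>A term such as \<xi>(X1) \<zeta>(Y2) times the derivative of \<eta>(Y1) along X2 occurs
  in the first defect through its bracket. Its negative occurs only in the second, through the
  derivative of \<eta> paired with the contraction of \<zeta>. Over both orders all anchor terms
  cancel in this way and the brackets assemble into the Schouten bracket.\<close>

lemma sharp_defect_wedge: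
  assumes X: "X1 \<in> sections A" "X2 \<in> sections A" and Y: "Y1 \<in> sections A" "Y2 \<in> sections A"
    and d: "\<xi> \<in> dual_sections A" "\<eta> \<in> dual_sections A" "\<zeta> \<in> dual_sections A"
  shows "sharp_defect A \<xi> \<eta> \<zeta> (wedge_sharp X1 X2 \<xi>) (wedge_sharp X1 X2 \<zeta>) (wedge_sharp Y1 Y2 \<xi>) (wedge_sharp Y1 Y2 \<eta>) p
    + sharp_defect A \<xi> \<eta> \<zeta> (wedge_sharp Y1 Y2 \<xi>) (wedge_sharp Y1 Y2 \<zeta>) (wedge_sharp X1 X2 \<xi>) (wedge_sharp X1 X2 \<eta>) p
    = schouten_decomposable A X1 X2 Y1 Y2 p (\<xi> p) (\<eta> p) (\<zeta> p)"
proof -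
  note wX = wedge_sharp_sections[OF X] and wY = wedge_sharp_sections[OF Y]
  \<comment> \<open>All brackets are brought to the order X before Y. Then both sides are
    polynomials in the same real quantities and agree as such.\<close>
  have sk: "pair_sec \<theta> (brk A Y1 X1) p = - pair_sec \<theta> (brk A X1 Y1) p"
    "pair_sec \<theta> (brk A Y1 X2) p = - pair_sec \<theta> (brk A X2 Y1) p"
    "pair_sec \<theta> (brk A Y2 X1) p = - pair_sec \<theta> (brk A X1 Y2) p"
    "pair_sec \<theta> (brk A Y2 X2) p = - pair_sec \<theta> (brk A X2 Y2) p" if "\<theta> \<in> dual_sections A" for \<theta>
    by (rule pair_brk_skew[OF that], rule Y, rule X)+
  have ps: "\<theta> p (Z p) = pair_sec \<theta> Z p" for \<theta> :: "'m \<Rightarrow> 'a \<Rightarrow> real" and Z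
    by (simp add: pair_sec_def)
  show ?thesis
    unfolding sharp_defect_def schouten_decomposable_def wedge3_def wedge2_def ps
    by (simp only: pair_brk_wedge_sharp X Y d anchor_pair_wedge_sharp wX wY anchor_wedge_sharp pair_sec_smooth sk)
      algebra
qed

text \<open>Every term of the defect contains exactly one of a, c and exactly one of b, d. It is
  therefore additive when a and c, the contractions of the first bivector, are changed
  together.\<close>

lemma sharp_defect_add_left:
  assumes "\<xi> \<in> dual_sections A" "\<eta> \<in> dual_sections A" "\<zeta> \<in> dual_sections A"
    and "a \<in> sections A" "a' \<in> sections A" "c \<in> sections A" "c' \<in> sections A" "b \<in> sections A" "d \<in> sections A"
  shows "sharp_defect A \<xi> \<eta> \<zeta> (\<lambda>p. a p + a' p) (\<lambda>p. c p + c' p) b d p =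
    sharp_defect A \<xi> \<eta> \<zeta> a c b d p + sharp_defect A \<xi> \<eta> \<zeta> a' c' b d p"
proof -
  have p: "pair_sec \<theta> (\<lambda>p. c p + c' p) = (\<lambda>p. pair_sec \<theta> c p + pair_sec \<theta> c' p)"
    if "\<theta> \<in> dual_sections A" for \<theta>
    using pair_add[OF that assms(6,7)] by auto
  show ?thesis
    unfolding sharp_defect_def
    using assms by (simp add: p pair_brk_add_left pair_brk_add_right anchor_sec_add_fun anchor_sec_add pair_sec_smooth)
qed

lemma sharp_defect_add_right:
  assumes "\<xi> \<in> dual_sections A" "\<eta> \<in> dual_sections A" "\<zeta> \<in> dual_sections A"
    and "a \<in> sections A" "c \<in> sections A" "b \<in> sections A" "b' \<in> sections A" "d \<in> sections A" "d' \<in> sections A"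
  shows "sharp_defect A \<xi> \<eta> \<zeta> a c (\<lambda>p. b p + b' p) (\<lambda>p. d p + d' p) p =
    sharp_defect A \<xi> \<eta> \<zeta> a c b d p + sharp_defect A \<xi> \<eta> \<zeta> a c b' d' p"
proof -
  have p: "pair_sec \<theta> (\<lambda>p. d p + d' p) = (\<lambda>p. pair_sec \<theta> d p + pair_sec \<theta> d' p)"
    if "\<theta> \<in> dual_sections A" for \<theta>
    using pair_add[OF that assms(8,9)] by auto
  show ?thesis
    unfolding sharp_defect_def
    using assms by (simp add: p pair_brk_add_left pair_brk_add_right anchor_sec_add_fun anchor_sec_add pair_sec_smooth)
qed

lemma list_sharp_sections:
  assumes "set xs \<subseteq> sections A \<times> sections A" "\<xi> \<in> dual_sections A"
  shows "list_sharp xs \<xi> \<in> sections A"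
  using assms(1)
proof (induction xs)
  case Nil
  then show ?case by (simp add: list_sharp_def sections_zero)
next
  case (Cons X xs)
  obtain X1 X2 where X: "X = (X1, X2)" by force
  have "(\<lambda>p. wedge_sharp X1 X2 \<xi> p + list_sharp xs \<xi> p) \<in> sections A"
    using Cons X assms(2) by (intro sections_add wedge_sharp_sections) auto
  then show ?case by (simp add: X list_sharp_def)
qed

lemma sharp_defect_list_left:
  assumes d: "\<xi> \<in> dual_sections A" "\<eta> \<in> dual_sections A" "\<zeta> \<in> dual_sections A"
    and bd: "b \<in> sections A" "d \<in> sections A" and xs: "set xs \<subseteq> sections A \<times> sections A"
  shows "sharp_defect A \<xi> \<eta> \<zeta> (list_sharp xs \<xi>) (list_sharp xs \<zeta>) b d p =
    (\<Sum>(X1, X2)\<leftarrow>xs. sharp_defect A \<xi> \<eta> \<zeta> (wedge_sharp X1 X2 \<xi>) (wedge_sharp X1 X2 \<zeta>) b d p)"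
  using xs
proof (induction xs)
  case Nil
  \<comment> \<open>The empty list contracts to the zero section; since 0 + 0 = 0, additivity forces
    the defect to equal its double, so it is 0.\<close>
  show ?case
    using sharp_defect_add_left[OF d sections_zero sections_zero sections_zero sections_zero bd, of p]
    by (simp add: list_sharp_def)
next
  case (Cons X xs)
  obtain X1 X2 where X: "X = (X1, X2)" by force
  have e: "list_sharp (X # xs) \<theta> = (\<lambda>p. wedge_sharp X1 X2 \<theta> p + list_sharp xs \<theta> p)" for \<theta>
    by (simp add: X list_sharp_def)
  show ?case
    unfolding e using Cons X d bd
    by (subst sharp_defect_add_left) (auto intro: wedge_sharp_sections list_sharp_sections)
qed

lemma sharp_defect_list_right:
  assumes d: "\<xi> \<in> dual_sections A" "\<eta> \<in> dual_sections A" "\<zeta> \<in> dual_sections A"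
    and ac: "a \<in> sections A" "c \<in> sections A" and ys: "set ys \<subseteq> sections A \<times> sections A"
  shows "sharp_defect A \<xi> \<eta> \<zeta> a c (list_sharp ys \<xi>) (list_sharp ys \<eta>) p =
    (\<Sum>(Y1, Y2)\<leftarrow>ys. sharp_defect A \<xi> \<eta> \<zeta> a c (wedge_sharp Y1 Y2 \<xi>) (wedge_sharp Y1 Y2 \<eta>) p)"
  using ys
proof (induction ys)
  case Nil
  show ?case
    using sharp_defect_add_right[OF d ac sections_zero sections_zero sections_zero sections_zero, of p]
    by (simp add: list_sharp_def)
next
  case (Cons Y ys)
  obtain Y1 Y2 where Y: "Y = (Y1, Y2)" by force
  have e: "list_sharp (Y # ys) \<theta> = (\<lambda>p. wedge_sharp Y1 Y2 \<theta> p + list_sharp ys \<theta> p)" for \<theta>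
    by (simp add: Y list_sharp_def)
  show ?case
    unfolding e using Cons Y d ac
    by (subst sharp_defect_add_right) (auto intro: wedge_sharp_sections list_sharp_sections)
qed

text \<open>A decomposition represents \<pi> only on W, so \<open>list_sharp\<close> and
  \<open>sharp\<close> agree only there. Locality of bracket and anchor makes this enough at
  p.\<close>

lemma sharp_defect_local:
  assumes W: "open W" "p \<in> W"
    and eq: "\<And>q. q \<in> W \<Longrightarrow> a q = a' q" "\<And>q. q \<in> W \<Longrightarrow> c q = c' q" "\<And>q. q \<in> W \<Longrightarrow> b q = b' q" "\<And>q. q \<in> W \<Longrightarrow> d q = d' q"
    and s: "\<xi> \<in> dual_sections A" "\<eta> \<in> dual_sections A" "\<zeta> \<in> dual_sections A"
      "a \<in> sections A" "a' \<in> sections A" "c \<in> sections A" "c' \<in> sections A"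
      "b \<in> sections A" "b' \<in> sections A" "d \<in> sections A" "d' \<in> sections A"
  shows "sharp_defect A \<xi> \<eta> \<zeta> a c b d p = sharp_defect A \<xi> \<eta> \<zeta> a' c' b' d' p"
proof -
  have br: "pair_sec \<theta> (brk A X Y) p = pair_sec \<theta> (brk A X' Y') p"
    if "\<And>q. q \<in> W \<Longrightarrow> X q = X' q" "\<And>q. q \<in> W \<Longrightarrow> Y q = Y' q"
      "X \<in> sections A" "X' \<in> sections A" "Y \<in> sections A" "Y' \<in> sections A" for \<theta> :: "'m \<Rightarrow> 'a \<Rightarrow> real" and X X' Y Y'
    using brk_local[OF W that] by (simp add: pair_sec_def)
  have an: "anchor_sec A X (pair_sec \<theta> Y) p = anchor_sec A X' (pair_sec \<theta> Y') p"
    if "\<And>q. q \<in> W \<Longrightarrow> X q = X' q" "\<And>q. q \<in> W \<Longrightarrow> Y q = Y' q" "\<theta> \<in> dual_sections A"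
      "X \<in> sections A" "Y \<in> sections A" "Y' \<in> sections A" for \<theta> :: "'m \<Rightarrow> 'a \<Rightarrow> real" and X X' Y Y'
  proof -
    have "anchor_sec A X (pair_sec \<theta> Y) p = anchor_sec A X (pair_sec \<theta> Y') p"
      using that by (intro anchor_sec_local[OF W]) (auto simp: pair_sec_def intro: pair_sec_smooth[unfolded pair_sec_def])
    then show ?thesis using that(1)[OF W(2)] by (simp add: anchor_sec_def)
  qed
  show ?thesis
    unfolding sharp_defect_def
    using br[OF eq(1,4) s(4,5,10,11)] an[OF eq(3,2) s(2,8,6,7)] br[OF eq(3,2) s(8,9,6,7)]
      an[OF eq(4,2) s(1,10,6,7)] an[OF eq(2,4) s(1,6,10,11)] br[OF eq(4,2) s(10,11,6,7)] by simp
qed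

text \<open>Both vectors are tested on a covector \<alpha>. Extending \<alpha> to a section \<eta>
  makes the rules for pairings of sections available for the induction over the list.\<close>

lemma decomposition_sharp:
  assumes \<pi>: "bivector A \<pi>" and dec: "decomposition_on A W \<pi> xs" and q: "q \<in> W" and \<xi>: "\<xi> \<in> dual_sections A"
  shows "sharp A \<pi> q (\<xi> q) = list_sharp xs \<xi> q"
proof (rule fib_eqI[of _ q])
  have xs: "set xs \<subseteq> sections A \<times> sections A" using dec by (simp add: decomposition_on_def)
  show "sharp A \<pi> q (\<xi> q) \<in> fib A q" using sharp_fib[OF \<pi>] dual_section_fib[OF \<xi>] by blast
  show "list_sharp xs \<xi> q \<in> fib A q" using section_fib list_sharp_sections[OF xs \<xi>] by blast
  fix \<alpha> assume \<alpha>: "\<alpha> \<in> dual_fib A q"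
  then obtain \<eta> where \<eta>: "\<eta> \<in> dual_sections A" "\<eta> q = \<alpha>" by (rule dual_section_through)
  have "pair_sec \<eta> (list_sharp xs \<xi>) q = (\<Sum>(X, Y)\<leftarrow>xs. wedge2 (X q) (Y q) (\<xi> q) (\<eta> q))"
    using xs
  proof (induction xs)
    case Nil
    then show ?case
      using linear_fun_on_zero[OF dual_fib_linear[OF dual_section_fib[OF \<eta>(1)]]]
      by (simp add: list_sharp_def pair_sec_def)
  next
    case (Cons X xs)
    obtain X1 X2 where X: "X = (X1, X2)" by force
    have e: "list_sharp (X # xs) \<xi> = (\<lambda>p. wedge_sharp X1 X2 \<xi> p + list_sharp xs \<xi> p)"
      by (simp add: X list_sharp_def)
    have "pair_sec \<eta> (list_sharp (X # xs) \<xi>) q = pair_sec \<eta> (wedge_sharp X1 X2 \<xi>) q + pair_sec \<eta> (list_sharp xs \<xi>) q"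
      unfolding e using Cons.prems X \<xi>
      by (intro pair_add[OF \<eta>(1)] wedge_sharp_sections list_sharp_sections) auto
    moreover have "pair_sec \<eta> (wedge_sharp X1 X2 \<xi>) q = wedge2 (X1 q) (X2 q) (\<xi> q) (\<eta> q)"
      using Cons.prems X \<xi> \<eta> by (simp add: pair_wedge_sharp) (simp add: wedge2_def pair_sec_def)
    ultimately show ?case using Cons X by simp
  qed
  also have "\<dots> = \<pi> q (\<xi> q) (\<eta> q)"
    using dec q dual_section_fib \<xi> \<eta> unfolding decomposition_on_def by metis
  also have "\<dots> = \<alpha> (sharp A \<pi> q (\<xi> q))"
    using pair_sharp[OF \<pi> dual_section_fib[OF \<xi>] \<alpha>] \<eta>(2) by simp
  finally show "\<alpha> (sharp A \<pi> q (\<xi> q)) = \<alpha> (list_sharp xs \<xi> q)"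
    using \<eta>(2) by (simp add: pair_sec_def)
qed

text \<open>Locally $2\pi = \sum_i e_i\wedge\pi e^i$.\<close>

lemma decomposition_exists:
  assumes \<pi>: "bivector A \<pi>"
  obtains W xs where "open W" "p \<in> W" "decomposition_on A W \<pi> xs"
proof -
  obtain T where T: "T \<in> trivs A" "p \<in> fst T" by (rule triv_exists)
  obtain h V K where h: "smooth_fun A h" "open V" "p \<in> V" "V \<subseteq> K" "closed K" "K \<subseteq> fst T"
    "\<And>q. q \<in> V \<Longrightarrow> h q = 1" "\<And>q. q \<notin> K \<Longrightarrow> h q = 0" by (rule bump_exists[OF triv_open[OF T(1)] T(2)]) blast
  note ext = section_extend[OF triv_open[OF T(1)] _ h(1,5,6,8)]
  \<comment> \<open>Half a frame field and the image of a coframe field under \<pi>, both made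
    global by h. They have the intended values only where h = 1, so the decomposition is claimed on
    V.\<close>
  define E where "E = (\<lambda>i q. h q *\<^sub>R ((1 / 2) *\<^sub>R frame A T i q))"
  define P where "P = (\<lambda>i q. h q *\<^sub>R sharp A \<pi> q (coframe A T i q))"
  have E: "E i \<in> sections A" if "i < vrank A" for i
    unfolding E_def
    by (intro ext smooth_section_on_scale smooth_on_const frame_section triv_open T that)
  have P: "P i \<in> sections A" if "i < vrank A" for i
    unfolding P_def by (intro ext sharp_smooth[OF \<pi>] coframe_section triv_open T that)
  define xs where "xs = map (\<lambda>i. (E i, P i)) [0..<vrank A]"
  have "decomposition_on A V \<pi> xs"
    unfolding decomposition_on_def
  proof (intro conjI ballI)
    show "set xs \<subseteq> sections A \<times> sections A" using E P by (auto simp: xs_def)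
    fix q \<alpha> \<beta> assume q: "q \<in> V" and \<alpha>: "\<alpha> \<in> dual_fib A q" and \<beta>: "\<beta> \<in> dual_fib A q"
    have qT: "q \<in> fst T" using q h by auto
    note cf = coframe_dual[OF T(1) qT]
    have *: "(\<Sum>i<vrank A. \<alpha> (frame A T i q) * \<beta> (sharp A \<pi> q (coframe A T i q))) = \<pi> q \<alpha> \<beta>"
      if \<alpha>: "\<alpha> \<in> dual_fib A q" and \<beta>: "\<beta> \<in> dual_fib A q" for \<alpha> \<beta>
    proof -
      have "(\<Sum>i<vrank A. \<alpha> (frame A T i q) * \<beta> (sharp A \<pi> q (coframe A T i q)))
        = \<pi> q (\<lambda>v. \<Sum>i<vrank A. \<alpha> (frame A T i q) * coframe A T i q v) \<beta>"
        by (subst bivector_sum[OF \<pi> \<beta>]) (auto simp: cf pair_sharp[OF \<pi> cf \<beta>])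
      then show ?thesis using dual_fib_expand[OF T(1) qT \<alpha>] by simp
    qed
    have "(\<Sum>(X, Y)\<leftarrow>xs. wedge2 (X q) (Y q) \<alpha> \<beta>) = (\<Sum>i<vrank A. wedge2 (E i q) (P i q) \<alpha> \<beta>)"
      by (simp add: xs_def comp_def interv_sum_list_conv_sum_set_nat atLeast0LessThan)
    also have "\<dots> = (\<Sum>i<vrank A. (1/2) * (\<alpha> (frame A T i q) * \<beta> (sharp A \<pi> q (coframe A T i q)))
        - (1/2) * (\<beta> (frame A T i q) * \<alpha> (sharp A \<pi> q (coframe A T i q))))"
    proof (rule sum.cong[OF refl])
      fix i assume "i \<in> {..<vrank A}"
      then have f: "frame A T i q \<in> fib A q" using frame_fib[OF T(1) qT] by simp
      show "wedge2 (E i q) (P i q) \<alpha> \<beta> = (1/2) * (\<alpha> (frame A T i q) * \<beta> (sharp A \<pi> q (coframe A T i q)))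
        - (1/2) * (\<beta> (frame A T i q) * \<alpha> (sharp A \<pi> q (coframe A T i q)))"
        by (simp add: E_def P_def h(7)[OF q] wedge2_def linear_fun_on_scale[OF dual_fib_linear[OF \<alpha>] f]
          linear_fun_on_scale[OF dual_fib_linear[OF \<beta>] f])
    qed
    also have "\<dots> = (1/2) * \<pi> q \<alpha> \<beta> - (1/2) * \<pi> q \<beta> \<alpha>"
      unfolding sum_subtractf sum_distrib_left[symmetric] *[OF \<alpha> \<beta>] *[OF \<beta> \<alpha>] ..
    also have "\<dots> = \<pi> q \<alpha> \<beta>" using bivector_skew[OF \<pi> \<beta> \<alpha> \<alpha>] by simp
    finally show "\<pi> q \<alpha> \<beta> = (\<Sum>(X, Y)\<leftarrow>xs. wedge2 (X q) (Y q) \<alpha> \<beta>)" ..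
  qed
  then show ?thesis using that h by blast
qed

text \<open>The two arguments may be decomposed by different lists. Whatever the lists, the double
  sum equals twice the defect of \<pi>, an expression in which no list occurs. This gives at once
  the uniqueness required by the description \<open>schouten\<close> and its value.\<close>

lemma schouten_self:
  assumes \<pi>: "bivector A \<pi>" and d: "\<xi> \<in> dual_sections A" "\<eta> \<in> dual_sections A" "\<zeta> \<in> dual_sections A"
  shows "schouten A \<pi> \<pi> p (\<xi> p) (\<eta> p) (\<zeta> p) =
    2 * sharp_defect A \<xi> \<eta> \<zeta> (\<lambda>q. sharp A \<pi> q (\<xi> q)) (\<lambda>q. sharp A \<pi> q (\<zeta> q))
      (\<lambda>q. sharp A \<pi> q (\<xi> q)) (\<lambda>q. sharp A \<pi> q (\<eta> q)) p" (is "_ = ?r")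
proof -
  note sh = sharp_sections[OF \<pi>]
  have *: "(\<Sum>(X1, X2)\<leftarrow>xs. \<Sum>(Y1, Y2)\<leftarrow>ys. schouten_decomposable A X1 X2 Y1 Y2 p (\<xi> p) (\<eta> p) (\<zeta> p)) = ?r"
    if W: "open W" "p \<in> W" and xs: "decomposition_on A W \<pi> xs" and ys: "decomposition_on A W \<pi> ys" for W xs ys
  proof -
    have sx: "set xs \<subseteq> sections A \<times> sections A" and sy: "set ys \<subseteq> sections A \<times> sections A"
      using xs ys by (auto simp: decomposition_on_def)
    note ls = list_sharp_sections[OF sx] and lt = list_sharp_sections[OF sy]
    let ?J = "sharp_defect A \<xi> \<eta> \<zeta>"
    let ?w = "\<lambda>X. wedge_sharp (fst X) (snd X)"
    \<comment> \<open>Each list represents \<pi> near p, so the defect of \<pi> may be computed with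
      xs in the first role and ys in the second, or the other way round. One copy of each makes up
      the factor 2.\<close>
    have "?r = ?J (list_sharp xs \<xi>) (list_sharp xs \<zeta>) (list_sharp ys \<xi>) (list_sharp ys \<eta>) p
             + ?J (list_sharp ys \<xi>) (list_sharp ys \<zeta>) (list_sharp xs \<xi>) (list_sharp xs \<eta>) p"
    proof -
      have "?r / 2 = ?J (list_sharp xs \<xi>) (list_sharp xs \<zeta>) (list_sharp ys \<xi>) (list_sharp ys \<eta>) p"
        using decomposition_sharp[OF \<pi> xs] decomposition_sharp[OF \<pi> ys] d ls lt sh
        by (simp, intro sharp_defect_local[OF W]) auto
      moreover have "?r / 2 = ?J (list_sharp ys \<xi>) (list_sharp ys \<zeta>) (list_sharp xs \<xi>) (list_sharp xs \<eta>) p"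
        using decomposition_sharp[OF \<pi> xs] decomposition_sharp[OF \<pi> ys] d ls lt sh
        by (simp, intro sharp_defect_local[OF W]) auto
      ultimately show ?thesis by linarith
    qed
    also have "?J (list_sharp xs \<xi>) (list_sharp xs \<zeta>) (list_sharp ys \<xi>) (list_sharp ys \<eta>) p
      = (\<Sum>X\<leftarrow>xs. \<Sum>Y\<leftarrow>ys. ?J (?w X \<xi>) (?w X \<zeta>) (?w Y \<xi>) (?w Y \<eta>) p)"
    proof -
      have "?J (?w X \<xi>) (?w X \<zeta>) (list_sharp ys \<xi>) (list_sharp ys \<eta>) p
        = (\<Sum>Y\<leftarrow>ys. ?J (?w X \<xi>) (?w X \<zeta>) (?w Y \<xi>) (?w Y \<eta>) p)" if "X \<in> set xs" for X
        using that sx d sy by (subst sharp_defect_list_right) (auto intro!: wedge_sharp_sections simp: case_prod_unfold)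
      then show ?thesis
        by (simp add: sharp_defect_list_left[OF d lt lt sx] d case_prod_unfold cong: map_cong)
    qed
    \<comment> \<open>Expanding the slots filled from xs before those filled from ys keeps xs in the
      outer sum, so the two double sums can be added term by term without an interchange.\<close>
    also have "?J (list_sharp ys \<xi>) (list_sharp ys \<zeta>) (list_sharp xs \<xi>) (list_sharp xs \<eta>) p
      = (\<Sum>X\<leftarrow>xs. \<Sum>Y\<leftarrow>ys. ?J (?w Y \<xi>) (?w Y \<zeta>) (?w X \<xi>) (?w X \<eta>) p)"
    proof -
      have "?J (list_sharp ys \<xi>) (list_sharp ys \<zeta>) (?w X \<xi>) (?w X \<eta>) p
        = (\<Sum>Y\<leftarrow>ys. ?J (?w Y \<xi>) (?w Y \<zeta>) (?w X \<xi>) (?w X \<eta>) p)" if "X \<in> set xs" for X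
        using that sx d sy by (subst sharp_defect_list_left) (auto intro!: wedge_sharp_sections simp: case_prod_unfold)
      then show ?thesis
        by (simp add: sharp_defect_list_right[OF d lt lt sx] d case_prod_unfold cong: map_cong)
    qed
    also have "(\<Sum>X\<leftarrow>xs. \<Sum>Y\<leftarrow>ys. ?J (?w X \<xi>) (?w X \<zeta>) (?w Y \<xi>) (?w Y \<eta>) p)
       + (\<Sum>X\<leftarrow>xs. \<Sum>Y\<leftarrow>ys. ?J (?w Y \<xi>) (?w Y \<zeta>) (?w X \<xi>) (?w X \<eta>) p)
      = (\<Sum>X\<leftarrow>xs. \<Sum>Y\<leftarrow>ys. ?J (?w X \<xi>) (?w X \<zeta>) (?w Y \<xi>) (?w Y \<eta>) p + ?J (?w Y \<xi>) (?w Y \<zeta>) (?w X \<xi>) (?w X \<eta>) p)"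
      by (simp add: sum_list_addf)
    also have "\<dots> = (\<Sum>X\<leftarrow>xs. \<Sum>Y\<leftarrow>ys. schouten_decomposable A (fst X) (snd X) (fst Y) (snd Y) p (\<xi> p) (\<eta> p) (\<zeta> p))"
      using sx sy d
      by (intro arg_cong[where f = sum_list] map_cong refl sharp_defect_wedge) auto
    finally show ?thesis by (simp add: case_prod_unfold)
  qed
  obtain W xs where W: "open W" "p \<in> W" "decomposition_on A W \<pi> xs" using decomposition_exists[OF \<pi>] .
  show ?thesis
    unfolding schouten_def
  proof (rule the_equality)
    show "\<exists>W xs ys. open W \<and> p \<in> W \<and> decomposition_on A W \<pi> xs \<and> decomposition_on A W \<pi> ys \<and>
     ?r = (\<Sum>(X1, X2)\<leftarrow>xs. \<Sum>(Y1, Y2)\<leftarrow>ys. schouten_decomposable A X1 X2 Y1 Y2 p (\<xi> p) (\<eta> p) (\<zeta> p))"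
      using W *[OF W W(3)] by (intro exI[of _ W] exI[of _ xs]) simp
  qed (use * in blast)
qed

text \<open>Paired with \<zeta>, the claim says that the defect of \<pi> vanishes, and the defect is
  half the Schouten bracket. Skewness of \<pi> turns k(\<pi>\<zeta>) into -\<zeta>(\<pi>k), where k
  is the bracket of the two forms.\<close>

lemma poisson_brk_sharp:
  assumes "poisson A \<pi>" and \<xi>: "\<xi> \<in> dual_sections A" and \<eta>: "\<eta> \<in> dual_sections A"
  shows "brk A (\<lambda>q. sharp A \<pi> q (\<xi> q)) (\<lambda>q. sharp A \<pi> q (\<eta> q)) p =
    sharp A \<pi> p (\<lambda>v. lie_deriv A (\<lambda>q. sharp A \<pi> q (\<xi> q)) \<eta> p v - int_diff A (\<lambda>q. sharp A \<pi> q (\<eta> q)) \<xi> p v)"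
proof (rule fib_eqI[of _ p])
  have \<pi>: "bivector A \<pi>" using assms(1) by (simp add: poisson_def)
  note sh = sharp_sections[OF \<pi>]
  let ?X = "\<lambda>q. sharp A \<pi> q (\<xi> q)" and ?Y = "\<lambda>q. sharp A \<pi> q (\<eta> q)"
  let ?k = "\<lambda>p v. lie_deriv A ?X \<eta> p v - int_diff A ?Y \<xi> p v"
  have k: "?k \<in> dual_sections A"
    by (intro dual_sections_diff lie_deriv_sections int_diff_sections sh \<xi> \<eta>)
  show "brk A ?X ?Y p \<in> fib A p" by (intro section_fib brk_sections sh \<xi> \<eta>)
  show "sharp A \<pi> p (?k p) \<in> fib A p" by (intro sharp_fib \<pi> dual_section_fib[OF k])
  fix \<alpha> assume "\<alpha> \<in> dual_fib A p"
  then obtain \<zeta> where \<zeta>: "\<zeta> \<in> dual_sections A" "\<zeta> p = \<alpha>" by (rule dual_section_through)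
  let ?Z = "\<lambda>q. sharp A \<pi> q (\<zeta> q)"
  have "schouten A \<pi> \<pi> p (\<xi> p) (\<eta> p) (\<zeta> p) = 0"
    using assms(1) dual_section_fib \<xi> \<eta> \<zeta>(1) by (simp add: poisson_def)
  then have "sharp_defect A \<xi> \<eta> \<zeta> ?X ?Z ?X ?Y p = 0"
    using schouten_self[OF \<pi> \<xi> \<eta> \<zeta>(1), of p] by simp
  moreover have "pair_sec ?k ?Z p = pair_sec (lie_deriv A ?X \<eta>) ?Z p - pair_sec (int_diff A ?Y \<xi>) ?Z p"
    by (simp add: pair_sec_def)
  moreover have "\<dots> = anchor_sec A ?X (pair_sec \<eta> ?Z) p - pair_sec \<eta> (brk A ?X ?Z) p - diff1 A \<xi> ?Y ?Z p"
    using pair_lie_deriv[OF sh[OF \<xi>] \<eta> sh[OF \<zeta>(1)]] pair_int_diff[OF sh[OF \<eta>] \<xi> sh[OF \<zeta>(1)]] by simp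
  ultimately have "pair_sec \<zeta> (brk A ?X ?Y) p = - pair_sec ?k ?Z p"
    by (simp add: sharp_defect_def diff1_def)
  also have "\<dots> = \<zeta> p (sharp A \<pi> p (?k p))"
    using sharp_skew[OF \<pi> dual_section_fib[OF k] dual_section_fib[OF \<zeta>(1)]] by (simp add: pair_sec_def)
  finally show "\<alpha> (brk A ?X ?Y p) = \<alpha> (sharp A \<pi> p (?k p))"
    using \<zeta>(2) by (simp add: pair_sec_def)
qed

section \<open>Dirac structures\<close>

lemma linear_subspace_graph_bivector:
  assumes \<pi>: "bivector A \<pi>"
  shows "linear_subspace_sum A p (graph_bivector A \<pi> p)"
  unfolding linear_subspace_sum_def
proof (intro conjI)
  show "graph_bivector A \<pi> p \<subseteq> fib A p \<times> dual_fib A p"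
    using sharp_fib[OF \<pi>] by (auto simp: graph_bivector_def)
  show "(0, \<lambda>v. 0) \<in> graph_bivector A \<pi> p"
    using sharp_zero[OF \<pi>, of p] dual_fib_0 by (auto simp: graph_bivector_def)
  show "\<forall>(x, \<xi>)\<in>graph_bivector A \<pi> p. \<forall>(y, \<eta>)\<in>graph_bivector A \<pi> p. (x + y, \<lambda>v. \<xi> v + \<eta> v) \<in> graph_bivector A \<pi> p"
    using sharp_add[OF \<pi>] dual_fib_add by (auto simp: graph_bivector_def)
  show "\<forall>c. \<forall>(x, \<xi>)\<in>graph_bivector A \<pi> p. (c *\<^sub>R x, \<lambda>v. c * \<xi> v) \<in> graph_bivector A \<pi> p"
    using sharp_scale[OF \<pi>] dual_fib_scale by (auto simp: graph_bivector_def)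
qed

lemma linear_subspace_graph_form:
  assumes \<omega>: "form2 A \<omega>"
  shows "linear_subspace_sum A p (graph_form A \<omega> p)"
  unfolding linear_subspace_sum_def
proof (intro conjI)
  show "graph_form A \<omega> p \<subseteq> fib A p \<times> dual_fib A p"
    using flat_dual[OF \<omega>] by (auto simp: graph_form_def)
  show "(0, \<lambda>v. 0) \<in> graph_form A \<omega> p"
    using flat_scale[OF \<omega> fib_0, of p 0] by (auto simp: graph_form_def)
  show "\<forall>(x, \<xi>)\<in>graph_form A \<omega> p. \<forall>(y, \<eta>)\<in>graph_form A \<omega> p. (x + y, \<lambda>v. \<xi> v + \<eta> v) \<in> graph_form A \<omega> p"
    using flat_add[OF \<omega>] fib_add by (auto simp: graph_form_def)
  show "\<forall>c. \<forall>(x, \<xi>)\<in>graph_form A \<omega> p. (c *\<^sub>R x, \<lambda>v. c * \<xi> v) \<in> graph_form A \<omega> p"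
    using flat_scale[OF \<omega>] fib_scale by (auto simp: graph_form_def)
qed

text \<open>Isotropy is skewness of \<pi>. For maximality, being orthogonal to all pairs
  (\<pi>\<eta>, \<eta>) determines every pairing \<eta>(x) and hence forces x = \<pi>\<xi>.\<close>

lemma maximally_isotropic_graph_bivector:
  assumes \<pi>: "bivector A \<pi>"
  shows "maximally_isotropic A p (graph_bivector A \<pi> p)"
  unfolding maximally_isotropic_def
proof (intro conjI allI impI linear_subspace_graph_bivector[OF \<pi>])
  show "isotropic (graph_bivector A \<pi> p)"
    unfolding isotropic_def
  proof clarify
    fix x \<xi> y \<eta> assume "(x, \<xi>) \<in> graph_bivector A \<pi> p" "(y, \<eta>) \<in> graph_bivector A \<pi> p"
    then show "\<xi> y + \<eta> x = 0"
      using sharp_skew[OF \<pi>, of \<xi> p \<eta>] by (auto simp: graph_bivector_def)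
  qed
  fix S assume S: "linear_subspace_sum A p S \<and> isotropic S \<and> graph_bivector A \<pi> p \<subseteq> S"
  have "(x, \<xi>) \<in> graph_bivector A \<pi> p" if x\<xi>: "(x, \<xi>) \<in> S" for x \<xi>
  proof -
    have x: "x \<in> fib A p" and \<xi>: "\<xi> \<in> dual_fib A p" using S x\<xi> by (auto simp: linear_subspace_sum_def)
    have "x = sharp A \<pi> p \<xi>"
    proof (rule fib_eqI[OF x sharp_fib[OF \<pi> \<xi>]])
      fix \<eta> assume \<eta>: "\<eta> \<in> dual_fib A p"
      then have "(sharp A \<pi> p \<eta>, \<eta>) \<in> S" using S by (auto simp: graph_bivector_def)
      then have "\<xi> (sharp A \<pi> p \<eta>) + \<eta> x = 0" using S x\<xi> by (auto simp: isotropic_def)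
      then show "\<eta> x = \<eta> (sharp A \<pi> p \<xi>)" using sharp_skew[OF \<pi> \<xi> \<eta>] by simp
    qed
    then show ?thesis using \<xi> by (auto simp: graph_bivector_def)
  qed
  then show "S = graph_bivector A \<pi> p" using S by auto
qed

text \<open>As for bivectors with the roles of vectors and covectors exchanged: orthogonality to the
  graph determines \<xi> on every vector y.\<close>

lemma maximally_isotropic_graph_form:
  assumes \<omega>: "form2 A \<omega>"
  shows "maximally_isotropic A p (graph_form A \<omega> p)"
  unfolding maximally_isotropic_def
proof (intro conjI allI impI linear_subspace_graph_form[OF \<omega>])
  show "isotropic (graph_form A \<omega> p)"
    unfolding isotropic_def
  proof clarify
    fix x \<xi> y \<eta> assume "(x, \<xi>) \<in> graph_form A \<omega> p" "(y, \<eta>) \<in> graph_form A \<omega> p"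
    then show "\<xi> y + \<eta> x = 0"
      using flat_skew[OF \<omega>, of x p y] by (auto simp: graph_form_def)
  qed
  fix S assume S: "linear_subspace_sum A p S \<and> isotropic S \<and> graph_form A \<omega> p \<subseteq> S"
  have "(x, \<xi>) \<in> graph_form A \<omega> p" if x\<xi>: "(x, \<xi>) \<in> S" for x \<xi>
  proof -
    have x: "x \<in> fib A p" and \<xi>: "\<xi> \<in> dual_fib A p" using S x\<xi> by (auto simp: linear_subspace_sum_def)
    have "\<xi> = flat A \<omega> p x"
    proof (rule dual_fib_eqI[OF \<xi> flat_dual[OF \<omega> x]])
      fix y assume y: "y \<in> fib A p"
      then have "(y, flat A \<omega> p y) \<in> S" using S by (auto simp: graph_form_def)
      then have "\<xi> y + flat A \<omega> p y x = 0" using S x\<xi> by (auto simp: isotropic_def)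
      then show "\<xi> y = flat A \<omega> p x y" using flat_skew[OF \<omega> x y] by simp
    qed
    then show ?thesis using x by (auto simp: graph_form_def)
  qed
  then show "S = graph_form A \<omega> p" using S by auto
qed

text \<open>The graph is parametrised linearly by its covector component, so the coframe lifts to a
  frame of it and its rank is that of A.\<close>

lemma subbundle_graph_bivector:
  assumes \<pi>: "bivector A \<pi>"
  shows "subbundle_sum A (graph_bivector A \<pi>)"
  unfolding subbundle_sum_def
proof (intro conjI allI linear_subspace_graph_bivector[OF \<pi>] exI[of _ "vrank A"])
  fix p
  obtain T where T: "T \<in> trivs A" "p \<in> fst T" by (rule triv_exists)
  let ?\<xi> = "coframe A T" and ?X = "\<lambda>i q. sharp A \<pi> q (coframe A T i q)"
  have "\<exists>!c. c \<in> topspace (Euclidean_space (vrank A)) \<and>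
      l = (\<Sum>i<vrank A. c i *\<^sub>R ?X i q, \<lambda>v. \<Sum>i<vrank A. c i * ?\<xi> i q v)"
    if q: "q \<in> fst T" and l: "l \<in> graph_bivector A \<pi> q" for q l
  proof -
    obtain \<eta> where \<eta>: "\<eta> \<in> dual_fib A q" "l = (sharp A \<pi> q \<eta>, \<eta>)"
      using l by (auto simp: graph_bivector_def)
    have sh: "sharp A \<pi> q (\<lambda>v. \<Sum>i<vrank A. c i * ?\<xi> i q v) = (\<Sum>i<vrank A. c i *\<^sub>R ?X i q)" for c
      by (rule sharp_sum[OF \<pi>]) (intro coframe_dual T q)
    show ?thesis
    \<comment> \<open>The coefficients are set to 0 from the rank on, since uniqueness is asked
      among the sequences in \<open>Euclidean_space (vrank A)\<close>.\<close>
    proof (rule ex1I[of _ "\<lambda>i. if i < vrank A then \<eta> (frame A T i q) else 0"])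
      have "\<eta> = (\<lambda>v. \<Sum>i<vrank A. (if i < vrank A then \<eta> (frame A T i q) else 0) * ?\<xi> i q v)"
        using dual_fib_expand[OF T(1) q \<eta>(1)] by simp
      then show "(\<lambda>i. if i < vrank A then \<eta> (frame A T i q) else 0) \<in> topspace (Euclidean_space (vrank A)) \<and>
        l = (\<Sum>i<vrank A. (if i < vrank A then \<eta> (frame A T i q) else 0) *\<^sub>R ?X i q,
          \<lambda>v. \<Sum>i<vrank A. (if i < vrank A then \<eta> (frame A T i q) else 0) * ?\<xi> i q v)"
        unfolding sh[symmetric] \<eta>(2) by (auto simp: topspace_Euclidean_space)
      fix c assume c: "c \<in> topspace (Euclidean_space (vrank A)) \<and>
        l = (\<Sum>i<vrank A. c i *\<^sub>R ?X i q, \<lambda>v. \<Sum>i<vrank A. c i * ?\<xi> i q v)"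
      show "c = (\<lambda>i. if i < vrank A then \<eta> (frame A T i q) else 0)"
      proof
        fix j
        show "c j = (if j < vrank A then \<eta> (frame A T j q) else 0)"
        proof (cases "j < vrank A")
          case True
          have "\<eta> (frame A T j q) = (\<Sum>i<vrank A. c i * ?\<xi> i q (frame A T j q))" using c \<eta>(2) by simp
          also have "\<dots> = (\<Sum>i<vrank A. if i = j then c j else 0)"
            by (intro sum.cong) (auto simp: coframe_frame[OF T(1) q True])
          also have "\<dots> = c j" using True by simp
          finally show ?thesis using True by simp
        next
          case False
          then show ?thesis using c by (auto simp: topspace_Euclidean_space)
        qed
      qed
    qed
  qed
  moreover have "(?X i q, ?\<xi> i q) \<in> graph_bivector A \<pi> q" if "q \<in> fst T" for i q
    using coframe_dual[OF T(1) that] by (auto simp: graph_bivector_def)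
  ultimately show "\<exists>W X \<xi>. open W \<and> p \<in> W \<and>
        (\<forall>i<vrank A. smooth_section_on A W (X i) \<and> smooth_dual_section_on A W (\<xi> i) \<and>
               (\<forall>q\<in>W. (X i q, \<xi> i q) \<in> graph_bivector A \<pi> q)) \<and>
        (\<forall>q\<in>W. \<forall>l\<in>graph_bivector A \<pi> q. \<exists>!c. c \<in> topspace (Euclidean_space (vrank A)) \<and>
           l = (\<Sum>i<vrank A. c i *\<^sub>R X i q, \<lambda>v. \<Sum>i<vrank A. c i * \<xi> i q v))"
    using T by (intro exI[of _ "fst T"] exI[of _ ?X] exI[of _ ?\<xi>] conjI allI impI ballI
        triv_open sharp_smooth[OF \<pi>] coframe_section) auto
qed

text \<open>Here the vector component is the parameter, so the frame of A lifts to the graph and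
  uniqueness is read off the coframe components of x.\<close>

lemma subbundle_graph_form:
  assumes \<omega>: "form2 A \<omega>"
  shows "subbundle_sum A (graph_form A \<omega>)"
  unfolding subbundle_sum_def
proof (intro conjI allI linear_subspace_graph_form[OF \<omega>] exI[of _ "vrank A"])
  fix p
  obtain T where T: "T \<in> trivs A" "p \<in> fst T" by (rule triv_exists)
  let ?X = "frame A T" and ?\<xi> = "\<lambda>i q. flat A \<omega> q (frame A T i q)"
  have "\<exists>!c. c \<in> topspace (Euclidean_space (vrank A)) \<and>
      l = (\<Sum>i<vrank A. c i *\<^sub>R ?X i q, \<lambda>v. \<Sum>i<vrank A. c i * ?\<xi> i q v)"
    if q: "q \<in> fst T" and l: "l \<in> graph_form A \<omega> q" for q l
  proof -
    obtain x where x: "x \<in> fib A q" "l = (x, flat A \<omega> q x)"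
      using l by (auto simp: graph_form_def)
    have fl: "flat A \<omega> q (\<Sum>i<vrank A. c i *\<^sub>R ?X i q) = (\<lambda>v. \<Sum>i<vrank A. c i * ?\<xi> i q v)" for c
      by (rule flat_sum[OF \<omega>]) (auto intro: frame_fib T q)
    show ?thesis
    proof (rule ex1I[of _ "\<lambda>i. if i < vrank A then coframe A T i q x else 0"])
      have "x = (\<Sum>i<vrank A. (if i < vrank A then coframe A T i q x else 0) *\<^sub>R ?X i q)"
        using fib_expand[OF T(1) q x(1)] by simp
      then show "(\<lambda>i. if i < vrank A then coframe A T i q x else 0) \<in> topspace (Euclidean_space (vrank A)) \<and>
        l = (\<Sum>i<vrank A. (if i < vrank A then coframe A T i q x else 0) *\<^sub>R ?X i q,
          \<lambda>v. \<Sum>i<vrank A. (if i < vrank A then coframe A T i q x else 0) * ?\<xi> i q v)"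
        unfolding fl[symmetric] x(2) by (auto simp: topspace_Euclidean_space)
      fix c assume c: "c \<in> topspace (Euclidean_space (vrank A)) \<and>
        l = (\<Sum>i<vrank A. c i *\<^sub>R ?X i q, \<lambda>v. \<Sum>i<vrank A. c i * ?\<xi> i q v)"
      show "c = (\<lambda>i. if i < vrank A then coframe A T i q x else 0)"
      proof
        fix j
        show "c j = (if j < vrank A then coframe A T j q x else 0)"
        proof (cases "j < vrank A")
          case True
          have "coframe A T j q x = (\<Sum>i<vrank A. c i * coframe A T j q (frame A T i q))"
            using c x(2) linear_fun_on_sum[OF dual_fib_linear[OF coframe_dual[OF T(1) q]] fib_subspace,
                of "{..<vrank A}" "\<lambda>i. frame A T i q" j c] frame_fib[OF T(1) q] by simp
          also have "\<dots> = (\<Sum>i<vrank A. if i = j then c j else 0)"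
            by (intro sum.cong) (auto simp: coframe_frame[OF T(1) q])
          also have "\<dots> = c j" using True by simp
          finally show ?thesis using True by simp
        next
          case False
          then show ?thesis using c by (auto simp: topspace_Euclidean_space)
        qed
      qed
    qed
  qed
  moreover have "(?X i q, ?\<xi> i q) \<in> graph_form A \<omega> q" if "i < vrank A" "q \<in> fst T" for i q
    using frame_fib[OF T(1) that(2,1)] by (auto simp: graph_form_def)
  ultimately show "\<exists>W X \<xi>. open W \<and> p \<in> W \<and>
        (\<forall>i<vrank A. smooth_section_on A W (X i) \<and> smooth_dual_section_on A W (\<xi> i) \<and>
               (\<forall>q\<in>W. (X i q, \<xi> i q) \<in> graph_form A \<omega> q)) \<and>
        (\<forall>q\<in>W. \<forall>l\<in>graph_form A \<omega> q. \<exists>!c. c \<in> topspace (Euclidean_space (vrank A)) \<and>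
           l = (\<Sum>i<vrank A. c i *\<^sub>R X i q, \<lambda>v. \<Sum>i<vrank A. c i * \<xi> i q v))"
    using T by (intro exI[of _ "fst T"] exI[of _ ?X] exI[of _ ?\<xi>] conjI allI impI ballI
        triv_open flat_smooth[OF \<omega>] frame_section) auto
qed

lemma sections_sum_graph_bivector:
  "(X, \<xi>) \<in> sections_sum A (graph_bivector A \<pi>) \<longleftrightarrow>
     X \<in> sections A \<and> \<xi> \<in> dual_sections A \<and> X = (\<lambda>p. sharp A \<pi> p (\<xi> p))"
  unfolding sections_sum_def graph_bivector_def using dual_section_fib by (auto intro!: ext)

lemma sections_sum_graph_form:
  "(X, \<xi>) \<in> sections_sum A (graph_form A \<omega>) \<longleftrightarrow>
     X \<in> sections A \<and> \<xi> \<in> dual_sections A \<and> \<xi> = (\<lambda>p. flat A \<omega> p (X p))"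
  unfolding sections_sum_def graph_form_def using section_fib by (auto intro!: ext)

text \<open>On this graph the covector part of the Dorfman bracket is the bracket of the two 1-forms
  defined by \<pi>. Closure is thus the bracket identity of a Poisson bivector.\<close>

lemma dirac_graph_bivector:
  assumes "poisson A \<pi>"
  shows "dirac_structure A (graph_bivector A \<pi>)"
  unfolding dirac_structure_def
proof (intro conjI allI ballI)
  have \<pi>: "bivector A \<pi>" using assms by (simp add: poisson_def)
  show "subbundle_sum A (graph_bivector A \<pi>)" by (rule subbundle_graph_bivector[OF \<pi>])
  show "maximally_isotropic A p (graph_bivector A \<pi> p)" for p by (rule maximally_isotropic_graph_bivector[OF \<pi>])
  fix s t assume "s \<in> sections_sum A (graph_bivector A \<pi>)" "t \<in> sections_sum A (graph_bivector A \<pi>)"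
  moreover obtain X \<xi> Y \<eta> where st: "s = (X, \<xi>)" "t = (Y, \<eta>)" by fastforce
  ultimately have X: "X = (\<lambda>p. sharp A \<pi> p (\<xi> p))" "X \<in> sections A" "\<xi> \<in> dual_sections A"
    and Y: "Y = (\<lambda>p. sharp A \<pi> p (\<eta> p))" "Y \<in> sections A" "\<eta> \<in> dual_sections A"
    unfolding st sections_sum_graph_bivector by blast+
  have "brk A X Y = (\<lambda>p. sharp A \<pi> p (\<lambda>v. lie_deriv A X \<eta> p v - int_diff A Y \<xi> p v))"
    using poisson_brk_sharp[OF assms X(3) Y(3)] by (auto simp: X(1) Y(1))
  then show "dorfman A s t \<in> sections_sum A (graph_bivector A \<pi>)"
    unfolding st dorfman.simps sections_sum_graph_bivector
    by (intro conjI brk_sections dual_sections_diff lie_deriv_sections int_diff_sections X(2,3) Y(2,3))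
qed

text \<open>The Koszul formula for $\mathrm d\beta(X,Y,Z)$, where \<open>f\<close> is the map $\Gamma A\to\Gamma A^*$ with
  $\beta(X,Y) = \langle fX, Y\rangle$.\<close>

definition diff_map :: "(('m \<Rightarrow> 'a) \<Rightarrow> 'm \<Rightarrow> 'a \<Rightarrow> real) \<Rightarrow> ('m \<Rightarrow> 'a) \<Rightarrow> ('m \<Rightarrow> 'a) \<Rightarrow> ('m \<Rightarrow> 'a) \<Rightarrow> 'm \<Rightarrow> real" where
  "diff_map f X Y Z p =
     anchor_sec A X (pair_sec (f Y) Z) p - anchor_sec A Y (pair_sec (f X) Z) p + anchor_sec A Z (pair_sec (f X) Y) p
     - pair_sec (f (brk A X Y)) Z p + pair_sec (f (brk A X Z)) Y p - pair_sec (f (brk A Y Z)) X p"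

text \<open>The sign reflects the convention that the map of a 2-form is minus its contraction.
  Passing to maps treats \<omega> and \<omega>_N alike and turns later identities into linear
  relations between pairings.\<close>

lemma diff2_diff_map:
  assumes "\<And>X Y. X \<in> sections A \<Longrightarrow> Y \<in> sections A \<Longrightarrow> eval2 \<omega> X Y = (\<lambda>p. - pair_sec (f X) Y p)"
    and "\<And>X. X \<in> sections A \<Longrightarrow> f X \<in> dual_sections A"
    and "X \<in> sections A" "Y \<in> sections A" "Z \<in> sections A"
  shows "diff2 A \<omega> X Y Z p = - diff_map f X Y Z p"
  using assms by (simp add: diff2_def diff_map_def brk_sections anchor_sec_minus_fun pair_sec_smooth)

lemma closed_form2_flat:
  assumes "form2 A \<omega>" "closed_form2 A \<omega>" "X \<in> sections A" "Y \<in> sections A" "Z \<in> sections A"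
  shows "diff_map (\<lambda>X p. flat A \<omega> p (X p)) X Y Z p = 0"
proof -
  have "diff2 A \<omega> X Y Z p = - diff_map (\<lambda>X p. flat A \<omega> p (X p)) X Y Z p"
    by (rule diff2_diff_map)
      (use assms flat_sections section_fib in \<open>auto simp: eval2_def pair_sec_def flat_apply\<close>)
  then show ?thesis using assms by (simp add: closed_form2_def)
qed

lemma pair_flat_skew:
  assumes "form2 A \<omega>" "X \<in> sections A" "Y \<in> sections A"
  shows "pair_sec (\<lambda>p. flat A \<omega> p (X p)) Y p = - pair_sec (\<lambda>p. flat A \<omega> p (Y p)) X p"
  using flat_skew[OF assms(1) section_fib[OF assms(2)] section_fib[OF assms(3)]] by (simp add: pair_sec_def)

text \<open>Once skewness of \<omega> moves the brackets [X,Z] and [Y,Z] into place, the covector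
  part of the Dorfman bracket minus \<omega>[X,Y], evaluated on Z, is the Koszul formula for the
  differential of \<omega>, which vanishes.\<close>

lemma dirac_graph_form:
  assumes "presymplectic A \<omega>"
  shows "dirac_structure A (graph_form A \<omega>)"
  unfolding dirac_structure_def
proof (intro conjI allI ballI)
  have \<omega>: "form2 A \<omega>" and cl: "closed_form2 A \<omega>" using assms by (auto simp: presymplectic_def)
  show "subbundle_sum A (graph_form A \<omega>)" by (rule subbundle_graph_form[OF \<omega>])
  show "maximally_isotropic A p (graph_form A \<omega> p)" for p by (rule maximally_isotropic_graph_form[OF \<omega>])
  let ?f = "\<lambda>X p. flat A \<omega> p (X p)"
  note fl = flat_sections[OF \<omega>]
  fix s t assume "s \<in> sections_sum A (graph_form A \<omega>)" "t \<in> sections_sum A (graph_form A \<omega>)"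
  moreover obtain X \<xi> Y \<eta> where st: "s = (X, \<xi>)" "t = (Y, \<eta>)" by fastforce
  ultimately have X: "X \<in> sections A" and \<xi>: "\<xi> = ?f X" and Y: "Y \<in> sections A" and \<eta>: "\<eta> = ?f Y"
    by (simp_all add: sections_sum_graph_form)
  let ?k = "\<lambda>p v. lie_deriv A X (?f Y) p v - int_diff A Y (?f X) p v"
  note B = brk_sections[OF X Y]
  have k: "?k \<in> dual_sections A"
    by (intro dual_sections_diff lie_deriv_sections int_diff_sections fl X Y)
  have "?k = ?f (brk A X Y)"
  proof (rule dual_section_eqI[OF k fl[OF B]])
    fix Z assume Z: "Z \<in> sections A"
    show "pair_sec ?k Z = pair_sec (?f (brk A X Y)) Z"
    proof
      fix p
      have "pair_sec ?k Z p = pair_sec (lie_deriv A X (?f Y)) Z p - pair_sec (int_diff A Y (?f X)) Z p"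
        by (simp add: pair_sec_def)
      also have "\<dots> = pair_sec (?f (brk A X Y)) Z p"
        using pair_lie_deriv[OF X fl[OF Y] Z, of p] pair_int_diff[OF Y fl[OF X] Z, of p]
          closed_form2_flat[OF \<omega> cl X Y Z, of p]
          pair_flat_skew[OF \<omega> Y brk_sections[OF X Z], of p] pair_flat_skew[OF \<omega> X brk_sections[OF Y Z], of p]
        unfolding diff1_def diff_map_def by linarith
      finally show "pair_sec ?k Z p = pair_sec (?f (brk A X Y)) Z p" .
    qed
  qed
  then show "dorfman A s t \<in> sections_sum A (graph_form A \<omega>)"
    using B k by (simp add: st \<xi> \<eta> sections_sum_graph_form)
qed

section \<open>The Nijenhuis torsion\<close>

context
  fixes \<pi> :: "'m \<Rightarrow> ('a \<Rightarrow> real) \<Rightarrow> ('a \<Rightarrow> real) \<Rightarrow> real" and \<omega> :: "'m \<Rightarrow> 'a \<Rightarrow> 'a \<Rightarrow> real"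
  assumes poisson: "poisson A \<pi>" and presymplectic: "presymplectic A \<omega>"
begin

abbreviation "flat_sec X \<equiv> (\<lambda>p. flat A \<omega> p (X p))"
abbreviation "sharp_sec \<xi> \<equiv> (\<lambda>p. sharp A \<pi> p (\<xi> p))"
abbreviation "N_sec X \<equiv> (\<lambda>p. sharp A \<pi> p (flat A \<omega> p (X p)))"

lemma bivector_pi: "bivector A \<pi>" and form2_omega: "form2 A \<omega>" and closed_omega: "closed_form2 A \<omega>"
  using poisson presymplectic by (auto simp: poisson_def presymplectic_def)

lemma N_sections: "X \<in> sections A \<Longrightarrow> N_sec X \<in> sections A"
  by (intro sharp_sections[OF bivector_pi] flat_sections[OF form2_omega])

text \<open>One sign comes from skewness of \<pi> and one from skewness of \<omega>, so N is
  self-adjoint with respect to \<omega>. This carries N across the pairing in the Koszul formula for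
  \<omega>_N.\<close>

lemma pair_flat_N:
  assumes "X \<in> sections A" "Y \<in> sections A"
  shows "pair_sec (flat_sec X) (N_sec Y) p = pair_sec (flat_sec (N_sec X)) Y p"
proof -
  note fX = flat_dual[OF form2_omega section_fib[OF assms(1)], of p]
    and fY = flat_dual[OF form2_omega section_fib[OF assms(2)], of p]
  have "pair_sec (flat_sec X) (N_sec Y) p = - pair_sec (flat_sec Y) (N_sec X) p"
    using sharp_skew[OF bivector_pi fY fX] by (simp add: pair_sec_def)
  then show ?thesis
    using pair_flat_skew[OF form2_omega assms(2) N_sections[OF assms(1)]] by simp
qed

text \<open>The left-hand side is $\langle S(X,Y),Z\rangle$.\<close>

lemma torsion_form:
  assumes X: "X \<in> sections A" and Y: "Y \<in> sections A" and Z: "Z \<in> sections A"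
  shows "pair_sec (lie_deriv A (N_sec X) (flat_sec Y)) Z p - pair_sec (int_diff A (N_sec Y) (flat_sec X)) Z p
     - pair_sec (flat_sec (brk A (N_sec X) Y)) Z p - pair_sec (flat_sec (brk A X (N_sec Y))) Z p
     + pair_sec (flat_sec (N_sec (brk A X Y))) Z p
   = - diff_map (\<lambda>X. flat_sec (N_sec X)) X Y Z p"
proof -
  note fl = flat_sections[OF form2_omega] and sk = pair_flat_skew[OF form2_omega]
  note NX = N_sections[OF X] and NY = N_sections[OF Y]
  have "diff_map (\<lambda>X. flat_sec X) (N_sec X) Y Z p = 0" "diff_map (\<lambda>X. flat_sec X) X (N_sec Y) Z p = 0"
    using closed_form2_flat[OF form2_omega closed_omega] X Y Z NX NY by auto
  \<comment> \<open>The two vanishing differentials replace the terms with [NX,Y] and [X,NY]. In the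
    remaining terms self-adjointness moves N from Y and X onto [X,Z] and [Y,Z], as the formula for
    \<omega>_N requires.\<close>
  then show ?thesis
    using pair_lie_deriv[OF NX fl[OF Y] Z, of p] pair_int_diff[OF NY fl[OF X] Z, of p]
      sk[OF Y brk_sections[OF NX Z], of p] sk[OF X brk_sections[OF NY Z], of p]
      pair_flat_N[OF brk_sections[OF X Z] Y, of p] pair_flat_N[OF brk_sections[OF Y Z] X, of p]
    unfolding diff_map_def diff1_def by linarith
qed

text \<open>The left side is \<alpha> on the torsion \<pi>S(X,Y), which is -S(X,Y)(\<pi>\<alpha>) by
  skewness. The sign in \<open>torsion_form\<close> cancels this one. The torsion therefore sees the
  differential of \<omega>_N only with its last argument in the image of \<pi>.\<close>

lemma torsion:
  assumes X: "X \<in> sections A" and Y: "Y \<in> sections A" and \<alpha>: "\<alpha> \<in> dual_sections A"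
  shows "pair_sec \<alpha> (brk A (N_sec X) (N_sec Y)) p
    - (pair_sec \<alpha> (N_sec (brk A (N_sec X) Y)) p + pair_sec \<alpha> (N_sec (brk A X (N_sec Y))) p)
    + pair_sec \<alpha> (N_sec (N_sec (brk A X Y))) p
   = diff_map (\<lambda>X. flat_sec (N_sec X)) X Y (sharp_sec \<alpha>) p"
proof -
  note fl = flat_sections[OF form2_omega]
  note NX = N_sections[OF X] and NY = N_sections[OF Y] and Z = sharp_sections[OF bivector_pi \<alpha>]
  let ?k = "\<lambda>p v. lie_deriv A (N_sec X) (flat_sec Y) p v - int_diff A (N_sec Y) (flat_sec X) p v"
  have sk: "pair_sec \<alpha> (sharp_sec \<xi>) p = - pair_sec \<xi> (sharp_sec \<alpha>) p" if "\<xi> \<in> dual_sections A" for \<xi>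
    using sharp_skew[OF bivector_pi dual_section_fib[OF that] dual_section_fib[OF \<alpha>], of p] by (simp add: pair_sec_def)
  have k: "?k \<in> dual_sections A"
    by (intro dual_sections_diff lie_deriv_sections int_diff_sections fl X Y NX NY)
  have "pair_sec \<alpha> (brk A (N_sec X) (N_sec Y)) p = pair_sec \<alpha> (sharp_sec ?k) p"
    using poisson_brk_sharp[OF poisson fl[OF X] fl[OF Y], of p] by (simp add: pair_sec_def)
  also have "\<dots> = - pair_sec ?k (sharp_sec \<alpha>) p" by (rule sk[OF k])
  also have "pair_sec ?k (sharp_sec \<alpha>) p = pair_sec (lie_deriv A (N_sec X) (flat_sec Y)) (sharp_sec \<alpha>) p
      - pair_sec (int_diff A (N_sec Y) (flat_sec X)) (sharp_sec \<alpha>) p"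
    by (simp add: pair_sec_def)
  finally show ?thesis
    using torsion_form[OF X Y Z, of p]
      sk[OF fl[OF brk_sections[OF NX Y]]] sk[OF fl[OF brk_sections[OF X NY]]]
      sk[OF fl[OF N_sections[OF brk_sections[OF X Y]]]] by linarith
qed

section \<open>The relation of the two graphs and its dual\<close>

lemma pair_relation_graphs:
  "pair_relation A (graph_bivector A \<pi>) (graph_form A \<omega>) = {(X, N_sec X) | X. X \<in> sections A}"
  using flat_sections[OF form2_omega] N_sections
  by (auto simp: pair_relation_def sections_sum_graph_bivector sections_sum_graph_form)

lemma dual_relation_graphs:
  "(\<beta>, \<alpha>) \<in> dual_relation A (pair_relation A (graph_bivector A \<pi>) (graph_form A \<omega>)) \<longleftrightarrow>
     \<beta> \<in> dual_sections A \<and> \<alpha> \<in> dual_sections A \<and> (\<forall>X\<in>sections A. pair_sec \<alpha> X = pair_sec \<beta> (N_sec X))"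
  by (auto simp: dual_relation_def pair_relation_graphs)

lemma diff2_omega_N:
  assumes "X \<in> sections A" "Y \<in> sections A" "Z \<in> sections A"
  shows "diff2 A (omega_N A \<pi> \<omega>) X Y Z p = - diff_map (\<lambda>X. flat_sec (N_sec X)) X Y Z p"
  by (rule diff2_diff_map)
    (use assms flat_sections[OF form2_omega] N_sections in
      \<open>auto simp: eval2_def pair_sec_def omega_N_def form_of_map_def N_map_def\<close>)

text \<open>Along the dual relation \<alpha>' is \<alpha> composed with N and \<alpha>'' is \<alpha>
  composed with N twice. The Nijenhuis expression is then \<alpha> evaluated on the torsion of
  N.\<close>

lemma nijenhuis_if_closed:
  assumes "closed_form2 A (omega_N A \<pi> \<omega>)"
  shows "nijenhuis_relation A (pair_relation A (graph_bivector A \<pi>) (graph_form A \<omega>))"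
  unfolding nijenhuis_relation_def dual_relation_graphs
proof (intro allI impI)
  fix u1 v1 u2 v2 \<alpha> \<alpha>' \<alpha>'' p
  assume "(u1, v1) \<in> pair_relation A (graph_bivector A \<pi>) (graph_form A \<omega>)"
    "(u2, v2) \<in> pair_relation A (graph_bivector A \<pi>) (graph_form A \<omega>)"
    and 1: "\<alpha> \<in> dual_sections A \<and> \<alpha>' \<in> dual_sections A \<and> (\<forall>X\<in>sections A. pair_sec \<alpha>' X = pair_sec \<alpha> (N_sec X))"
    and 2: "\<alpha>' \<in> dual_sections A \<and> \<alpha>'' \<in> dual_sections A \<and> (\<forall>X\<in>sections A. pair_sec \<alpha>'' X = pair_sec \<alpha>' (N_sec X))"
  then have u: "u1 \<in> sections A" "u2 \<in> sections A" and v: "v1 = N_sec u1" "v2 = N_sec u2"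
    by (auto simp: pair_relation_graphs)
  note Nu = N_sections[OF u(1)] N_sections[OF u(2)]
  note br = brk_sections[OF Nu(1) u(2)] brk_sections[OF u(1) Nu(2)] brk_sections[OF u]
  have "diff_map (\<lambda>X. flat_sec (N_sec X)) u1 u2 (sharp_sec \<alpha>) p = 0"
    using diff2_omega_N[OF u sharp_sections[OF bivector_pi], of \<alpha> p] 1 assms u sharp_sections[OF bivector_pi]
    by (simp add: closed_form2_def)
  then show "pair_sec \<alpha> (brk A v1 v2) p - pair_sec \<alpha>' (\<lambda>q. brk A v1 u2 q + brk A u1 v2 q) p
      + pair_sec \<alpha>'' (brk A u1 u2) p = 0"
    using torsion[OF u, of \<alpha> p] 1 2 br N_sections[OF br(3)] by (simp add: v pair_add)
qed

lemma closed_if_nijenhuis: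
  assumes nij: "nijenhuis_relation A (pair_relation A (graph_bivector A \<pi>) (graph_form A \<omega>))"
    and "nondegenerate A \<pi>"
  shows "closed_form2 A (omega_N A \<pi> \<omega>)"
  unfolding closed_form2_def
proof (intro ballI ext)
  fix X Y Z p assume X: "X \<in> sections A" and Y: "Y \<in> sections A" and Z: "Z \<in> sections A"
  obtain F where F: "smooth_bundle_map_to_dual A F" "\<And>p x. x \<in> fib A p \<Longrightarrow> sharp A \<pi> p (F p x) = x"
    using assms(2) unfolding nondegenerate_def by blast
  \<comment> \<open>The preimage of Z under \<pi>, a smooth section because the inverse of \<pi> is
    a smooth bundle map. It lets the torsion be tested on an arbitrary Z.\<close>
  define \<alpha> where "\<alpha> = (\<lambda>p. F p (Z p))"
  have \<alpha>: "\<alpha> \<in> dual_sections A" unfolding \<alpha>_def by (rule bundle_map_sections[OF F(1) Z])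
  have Z\<alpha>: "sharp_sec \<alpha> = Z" using F(2) section_fib[OF Z] by (auto simp: \<alpha>_def)
  have adj: "\<And>X. X \<in> sections A \<Longrightarrow> pair_sec (flat_sec (sharp_sec \<beta>)) X = pair_sec \<beta> (N_sec X)"
    and adj_sec: "flat_sec (sharp_sec \<beta>) \<in> dual_sections A" if \<beta>: "\<beta> \<in> dual_sections A" for \<beta>
  proof -
    show "flat_sec (sharp_sec \<beta>) \<in> dual_sections A"
      by (intro flat_sections[OF form2_omega] sharp_sections[OF bivector_pi] \<beta>)
    fix X assume X: "X \<in> sections A"
    show "pair_sec (flat_sec (sharp_sec \<beta>)) X = pair_sec \<beta> (N_sec X)"
    proof
      fix p
      show "pair_sec (flat_sec (sharp_sec \<beta>)) X p = pair_sec \<beta> (N_sec X) p"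
        using pair_flat_skew[OF form2_omega sharp_sections[OF bivector_pi \<beta>] X, of p]
          sharp_skew[OF bivector_pi flat_dual[OF form2_omega section_fib[OF X]] dual_section_fib[OF \<beta>], of p]
        by (simp add: pair_sec_def)
    qed
  qed
  \<comment> \<open>The Nijenhuis condition can be used only if \<alpha> starts a chain in the dual
    relation. As \<omega> and \<pi> are both skew, the composition of \<alpha> with \<pi>\<omega> is
    \<omega>\<pi>\<alpha>, so applying \<omega>\<pi> twice produces the chain within smooth
    sections.\<close>
  define \<alpha>' where "\<alpha>' = flat_sec (sharp_sec \<alpha>)"
  define \<alpha>'' where "\<alpha>'' = flat_sec (sharp_sec \<alpha>')"
  have \<alpha>': "\<alpha>' \<in> dual_sections A" unfolding \<alpha>'_def by (rule adj_sec[OF \<alpha>])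
  have p1: "\<And>X. X \<in> sections A \<Longrightarrow> pair_sec \<alpha>' X = pair_sec \<alpha> (N_sec X)" unfolding \<alpha>'_def by (rule adj[OF \<alpha>])
  have \<alpha>'': "\<alpha>'' \<in> dual_sections A" unfolding \<alpha>''_def by (rule adj_sec[OF \<alpha>'])
  have p2: "\<And>X. X \<in> sections A \<Longrightarrow> pair_sec \<alpha>'' X = pair_sec \<alpha>' (N_sec X)" unfolding \<alpha>''_def by (rule adj[OF \<alpha>'])
  note NX = N_sections[OF X] and NY = N_sections[OF Y]
  note br = brk_sections[OF NX Y] brk_sections[OF X NY] brk_sections[OF X Y]
  have "(X, N_sec X) \<in> pair_relation A (graph_bivector A \<pi>) (graph_form A \<omega>)"
    "(Y, N_sec Y) \<in> pair_relation A (graph_bivector A \<pi>) (graph_form A \<omega>)"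
    using X Y by (auto simp: pair_relation_graphs)
  moreover have "(\<alpha>, \<alpha>') \<in> dual_relation A (pair_relation A (graph_bivector A \<pi>) (graph_form A \<omega>))"
    "(\<alpha>', \<alpha>'') \<in> dual_relation A (pair_relation A (graph_bivector A \<pi>) (graph_form A \<omega>))"
    using \<alpha> \<alpha>' \<alpha>'' p1 p2 by (simp_all add: dual_relation_graphs)
  ultimately have "pair_sec \<alpha> (brk A (N_sec X) (N_sec Y)) p
      - pair_sec \<alpha>' (\<lambda>q. brk A (N_sec X) Y q + brk A X (N_sec Y) q) p + pair_sec \<alpha>'' (brk A X Y) p = 0"
    using nij unfolding nijenhuis_relation_def by blast
  then have "diff_map (\<lambda>X. flat_sec (N_sec X)) X Y Z p = 0"
    using torsion[OF X Y \<alpha>, of p] br N_sections[OF br(3)] by (simp add: pair_add[OF \<alpha>'] p1 p2 Z\<alpha>)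
  then show "diff2 A (omega_N A \<pi> \<omega>) X Y Z p = 0"
    using diff2_omega_N[OF X Y Z, of p] by simp
qed

end

end

theorem theorem4p3:
  fixes A :: "('m::{t2_space,second_countable_topology}, 'a::real_vector) lie_algebroid"
  assumes "lie_algebroid A"
  shows "(\<forall>\<pi> \<omega>. poisson A \<pi> \<and> presymplectic A \<omega> \<and> P_Omega_structure A \<pi> \<omega> \<longrightarrow>
            dirac_pair A (graph_bivector A \<pi>) (graph_form A \<omega>)) \<and>
         (\<forall>\<pi> \<omega>. poisson A \<pi> \<and> presymplectic A \<omega> \<and>
            dirac_pair A (graph_bivector A \<pi>) (graph_form A \<omega>) \<and> nondegenerate A \<pi> \<longrightarrow>
            P_Omega_structure A \<pi> \<omega>)"
proof -
  interpret lalgd A by unfold_locales (rule assms)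
  show ?thesis
    unfolding dirac_pair_def P_Omega_structure_def
    using dirac_graph_bivector dirac_graph_form nijenhuis_if_closed closed_if_nijenhuis
    by (auto simp: poisson_def presymplectic_def)
qed

end
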